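(* Let $K\subset\mathbb{R}^n$ be a convex body containing the origin in its interior such that $b_2(K)=1$. Then $S_K(\Omega_{n-2})=0$, where $\Omega_{n-2}=\{u\in\mathbb{S}^{n-1} : K^u \text{ is } (n-2)\text{-dimensional}\}$.
   Context: Here $n\ge 2$. A convex body in $\mathbb{R}^n$ is a compact convex set with non-empty interior. For compact convex sets $K_1,\dots,K_n\subset\mathbb{R}^n$, $V_n(K_1,\dots,K_n)$ denotes their mixed volume: the symmetric functional, Minkowski-multilinear in each argument, normalized by $V_n(K,\dots,K)=\mathrm{Vol}_n(K)$. The notation $K[m]$ means that $K$ is repeated $m$ times as an argument, and $V_n(K)=\mathrm{Vol}_n(K)$. For a convex body $K\subset\mathbb{R}^n$ define $$b_2(K)=\sup_{A,B}\frac{V_n(A,B,K[n-2])\,V_n(K)}{V_n(A,K[n-1])\,V_n(B,K[n-1])},$$ the supremum being over all pairs $(A,B)$ of compact convex sets in $\mathbb{R}^n$, neither of which is a single point. (Taking $A=B=K$ shows $b_2(K)\ge 1$.) The support function of $K$ is $h_K(u)=\max_{y\in K}\langle y,u\rangle$, and for $u\in\mathbb{S}^{n-1}$, $K^u=\{y\in K:\langle y,u\rangle=h_K(u)\}$. The surface area measure $S_K$ is the Borel measure on $\mathbb{S}^{n-1}$ given by $S_K(B)=\mathcal{H}^{n-1}\big(\bigcup_{u\in B}K^u\big)$ for Borel $B\subset\mathbb{S}^{n-1}$, where $\mathcal{H}^{n-1}$ is the $(n-1)$-dimensional Hausdorff measure. *)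

theory Defs
  imports "HOL-Analysis.Analysis" "HOL-Library.Set_Algebras"
begin

text \<open>The empty set is excluded: support functions and mixed volumes are
  only considered for nonempty sets.\<close>

definition compact_convex :: "'a::euclidean_space set \<Rightarrow> bool" where
  "compact_convex K \<longleftrightarrow> compact K \<and> convex K \<and> K \<noteq> {}"

definition convex_body :: "'a::euclidean_space set \<Rightarrow> bool" where
  "convex_body K \<longleftrightarrow> compact K \<and> convex K \<and> interior K \<noteq> {}"

text \<open>The arguments of a mixed volume form a list of length \<open>DIM('a)\<close>;
  \<open>+\<close> on sets is the Minkowski sum.\<close>

definition mixed_volume_functional :: "('a::euclidean_space set list \<Rightarrow> real) \<Rightarrow> bool" where
  "mixed_volume_functional V \<longleftrightarrow>
     (\<forall>Ks Ls. length Ks = DIM('a) \<and> (\<forall>K\<in>set Ks. compact_convex K) \<and> mset Ls = mset Ks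
        \<longrightarrow> V Ls = V Ks) \<and>
     (\<forall>Ks i A B a b. length Ks = DIM('a) \<and> (\<forall>K\<in>set Ks. compact_convex K) \<and> i < DIM('a) \<and>
        compact_convex A \<and> compact_convex B \<and> 0 \<le> a \<and> 0 \<le> b
        \<longrightarrow> V (Ks[i := (*\<^sub>R) a ` A + (*\<^sub>R) b ` B]) = a * V (Ks[i := A]) + b * V (Ks[i := B])) \<and>
     (\<forall>K. compact_convex K \<longrightarrow> V (replicate DIM('a) K) = measure lebesgue K)"

text \<open>By Minkowski's theorem such a functional exists, and by polarization its values on lists of
  \<open>DIM('a)\<close> nonempty compact convex sets are uniquely determined. The choice operator thus
  affects only the irrelevant values on other lists.\<close>

definition mixed_volume :: "'a::euclidean_space set list \<Rightarrow> real" where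
  "mixed_volume = (SOME V. mixed_volume_functional V)"

text \<open>The supremum is taken in the extended reals, so that it needs no boundedness proviso.\<close>

definition b2 :: "'a::euclidean_space set \<Rightarrow> ereal" where
  "b2 K =
     (SUP (A, B) \<in> {(A, B). compact_convex A \<and> (\<nexists>x. A = {x}) \<and> compact_convex B \<and> (\<nexists>x. B = {x})}.
        ereal (mixed_volume ([A, B] @ replicate (DIM('a) - 2) K) * measure lebesgue K /
          (mixed_volume (A # replicate (DIM('a) - 1) K) *
           mixed_volume (B # replicate (DIM('a) - 1) K))))"

definition support_function :: "'a::euclidean_space set \<Rightarrow> 'a \<Rightarrow> real" where
  "support_function K u = (SUP y\<in>K. y \<bullet> u)"

definition support_set :: "'a::euclidean_space set \<Rightarrow> 'a \<Rightarrow> 'a set" where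
  "support_set K u = {y \<in> K. y \<bullet> u = support_function K u}"

text \<open>Hausdorff (outer) measure, normalized to agree with Lebesgue measure in dimension \<open>d\<close>.
  Boundedness of the covering sets is required explicitly because \<open>diameter\<close> is a real
  supremum, which is meaningless for unbounded sets. The empty set gets weight \<open>0\<close> also when
  \<open>d = 0\<close>.\<close>

definition hausdorff_weight :: "nat \<Rightarrow> 'a::metric_space set \<Rightarrow> ennreal" where
  "hausdorff_weight d C =
     (if C = {} then 0 else ennreal (unit_ball_vol (real d) * (diameter C / 2) ^ d))"

definition hausdorff_content :: "nat \<Rightarrow> real \<Rightarrow> 'a::metric_space set \<Rightarrow> ennreal" where
  "hausdorff_content d \<delta> E =
     (INF C \<in> {C :: nat \<Rightarrow> 'a set. E \<subseteq> (\<Union>i. C i) \<and> (\<forall>i. bounded (C i) \<and> diameter (C i) \<le> \<delta>)}.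
        \<Sum>i. hausdorff_weight d (C i))"

definition hausdorff_measure :: "nat \<Rightarrow> 'a::metric_space set \<Rightarrow> ennreal" where
  "hausdorff_measure d E = (SUP \<delta>\<in>{0<..}. hausdorff_content d \<delta> E)"

text \<open>A set function rather than an element of type \<open>measure\<close>: \<open>emeasure\<close> would
  silently return \<open>0\<close> on a set not known to be measurable.\<close>

definition surface_area_measure :: "'a::euclidean_space set \<Rightarrow> 'a set \<Rightarrow> ennreal" where
  "surface_area_measure K B = hausdorff_measure (DIM('a) - 1) (\<Union>u\<in>B. support_set K u)"

end

theory Submission imports Defs begin

text \<open>Let \<open>u\<close> be a unit vector whose face \<open>F = K\<^sup>u\<close> has dimension \<open>n - 2\<close>, and suppose some
  \<open>x \<in> F\<close> had \<open>u\<close> as its only outer unit normal. Test the Bezout inequality on the hull \<open>A\<^sub>s\<close> of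
  \<open>K\<close> and \<open>x + s u\<close>, and on a segment \<open>I = [0, v]\<close> with \<open>v\<close> orthogonal to \<open>u\<close> and to \<open>F\<close>. Along \<open>v\<close>
  the face \<open>F\<close> projects onto a facet of the shadow of \<open>K\<close>, so passing from \<open>K\<close> to \<open>A\<^sub>s\<close> increases
  \<open>V(\<cdot>, I, K[n-2])\<close> at least linearly in \<open>s\<close>; but \<open>V(\<cdot>, K[n-1])\<close> increases only by \<open>o(s)\<close>, because by
  uniqueness of the normal only a small neighbourhood of \<open>F\<close> is affected and \<open>F\<close> is a null set for
  the surface measure. This contradicts \<open>b\<^sub>2(K) = 1\<close>. Hence all points of such faces are singular, and
  the singular boundary points are \<open>\<H>\<^sup>n\<^sup>-\<^sup>1\<close>-null: the normal cone at a singular point contains a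
  two-dimensional cone, so the point is the nearest-point image of a point with two prescribed rational
  coordinates, and the nearest-point map is 1-Lipschitz.

  Since \<open>mixed_volume\<close> is a choice, Minkowski's theorem is needed as well. A polytope with vertices
  in \<open>Y\<close> is, up to a null set, the bijective gradient image of the convex function
  \<open>x \<mapsto> ln (\<Sum>y\<in>Y. exp (x \<bullet> y))\<close>, and adding such functions adds the gradient images. By change of variables
  the volume of a Minkowski sum is therefore the integral of the determinant of a sum of Hessians, whose
  polarization is multilinear.\<close>

section \<open>A copy of an index type with a well-order\<close>

text \<open>Two limits have to be kept apart. The contradiction compares two bounds linear in s for
  one and the same A_s, so s is fixed before any derivative is taken; only then does the scale
  \<epsilon> of K + \<epsilon> A_s tend to 0. The part of K touched by the perturbation must
  therefore be controlled by s alone, uniformly in \<epsilon>. Compactness gives this, applied to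
  pairs of a point of K and a direction that is almost normal both there and at x. Accordingly o(s)
  means: for every \<mu> > 0 some s > 0 has increment at most s \<mu> / n. For A = K the Bezout
  inequality is an equality, so only increments over A = K matter. They are read off by comparing
  volumes of K + \<epsilon> A_s with those of K + \<epsilon> K. Shadows never appear as sets of
  lower dimension: for convex M the volume of M + [0, t v] is affine in t, its slope is n V(I,
  M[n-1]), and dividing by a large t isolates contributions proportional to t. Nor is a formula for
  mixed volumes as integrals against surface measures used; multilinearity, symmetry and one-sided
  derivatives carry the argument.\<close>

text \<open>Change of variables is available only for well-ordered index types.\<close>

typedef 'a wo = "UNIV :: 'a set" ..

lemma bij_Rep_wo: "bij Rep_wo"
  by (rule o_bij[of Abs_wo]) (auto simp: fun_eq_iff Abs_wo_inverse Rep_wo_inverse)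

instance wo :: (finite) finite
proof
  show "finite (UNIV :: 'a wo set)"
    using bij_betw_finite[OF bij_Rep_wo] finite[of "UNIV :: 'a set"] by blast
qed

definition wo_index :: "'a::finite wo \<Rightarrow> nat" where
  "wo_index = (SOME f. inj f)"

lemma inj_wo_index: "inj wo_index"
proof -
  obtain f :: "'a wo \<Rightarrow> nat" where "inj f"
    using finite_imp_inj_to_nat_seg[OF finite[of "UNIV :: 'a wo set"]] by blast
  then show ?thesis
    unfolding wo_index_def by (rule someI[where P = inj])
qed

instantiation wo :: (finite) wellorder
begin

definition "x \<le> y \<longleftrightarrow> wo_index x \<le> wo_index y"
definition "x < y \<longleftrightarrow> wo_index x < wo_index y"

instance
proof
  fix x y :: "'a wo" and P :: "'a wo \<Rightarrow> bool"
  show "x \<le> y \<Longrightarrow> y \<le> x \<Longrightarrow> x = y"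
    unfolding less_eq_wo_def by (rule injD[OF inj_wo_index]) linarith
  show "P x" if "\<And>x. (\<And>y. y < x \<Longrightarrow> P y) \<Longrightarrow> P x"
    by (rule measure_induct_rule[of wo_index], rule that) (simp add: less_wo_def)
qed (auto simp: less_eq_wo_def less_wo_def)

end

lemma card_wo: "CARD('a wo) = CARD('a)"
  using bij_Rep_wo bij_betw_same_card by blast

section \<open>Lebesgue measure under renaming of coordinates and under linear maps\<close>

lemma compact_linear_image:
  fixes f :: "'a::euclidean_space \<Rightarrow> 'b::real_normed_vector"
  assumes "linear f" "compact S"
  shows "compact (f ` S)"
  using assms by (intro compact_continuous_image linear_continuous_on linear_conv_bounded_linear[THEN iffD1])

definition to_wo :: "real ^ 'n \<Rightarrow> real ^ 'n::finite wo" where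
  "to_wo x = (\<chi> i. x $ Rep_wo i)"

definition of_wo :: "real ^ 'n::finite wo \<Rightarrow> real ^ 'n" where
  "of_wo x = (\<chi> i. x $ Abs_wo i)"

lemma of_to_wo [simp]: "of_wo (to_wo x) = x" and to_of_wo [simp]: "to_wo (of_wo y) = y"
  by (auto simp: of_wo_def to_wo_def vec_eq_iff Abs_wo_inverse Rep_wo_inverse)

lemma bij_to_wo: "bij to_wo" and bij_of_wo: "bij of_wo"
  by (rule o_bij[of of_wo] o_bij[of to_wo]; force simp: fun_eq_iff)+

lemma linear_to_wo: "linear to_wo" and linear_of_wo: "linear of_wo"
  by (auto intro!: linearI simp: of_wo_def to_wo_def vec_eq_iff)

lemma to_wo_image_eq: "to_wo ` T = of_wo -` T"
  by (force simp: image_iff)+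

text \<open>\<open>lborel\<close> is determined by its values on boxes, and renaming coordinates
  turns a box into a box with the same side lengths in another order.\<close>

lemma distr_of_wo: "distr lborel borel of_wo = (lborel :: (real ^ 'n) measure)"
proof (rule lborel_eqI[symmetric])
  have m: "of_wo \<in> borel_measurable borel"
    by (simp add: borel_measurable_continuous_onI linear_continuous_on linear_of_wo linear_conv_bounded_linear[symmetric])
  fix l u :: "real ^ 'n"
  assume le: "\<And>b. b \<in> Basis \<Longrightarrow> l \<bullet> b \<le> u \<bullet> b"
  have le': "l $ i \<le> u $ i" for i
    using le[of "axis i 1"] by (simp add: inner_axis axis_in_Basis_iff)
  have "of_wo -` box l u = box (to_wo l) (to_wo u)"
  proof (rule set_eqI)
    fix x
    have "(\<forall>i. l $ i < x $ Abs_wo i \<and> x $ Abs_wo i < u $ i) \<longleftrightarrow>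
        (\<forall>i. l $ Rep_wo i < x $ i \<and> x $ i < u $ Rep_wo i)"
      by (metis Rep_wo_inverse Abs_wo_inverse UNIV_I)
    then show "x \<in> of_wo -` box l u \<longleftrightarrow> x \<in> box (to_wo l) (to_wo u)"
      by (simp add: mem_box_cart of_wo_def to_wo_def)
  qed
  then have "emeasure (distr lborel borel of_wo) (box l u) = emeasure lborel (box (to_wo l) (to_wo u))"
    using m by (subst emeasure_distr) auto
  also have "\<dots> = ennreal (\<Prod>b\<in>Basis. (to_wo u - to_wo l) \<bullet> b)"
    by (rule emeasure_lborel_box) (use le' in \<open>auto simp: Basis_vec_def inner_axis to_wo_def\<close>)
  also have "(\<Prod>b\<in>Basis. (to_wo u - to_wo l) \<bullet> b) = (\<Prod>i\<in>UNIV. (to_wo u - to_wo l) $ i)"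
    unfolding Basis_vec_def
    by (subst prod.UNION_disjoint) (auto simp: axis_eq_axis inner_axis)
  also have "\<dots> = (\<Prod>i\<in>UNIV. (u - l) $ Rep_wo i)"
    by (simp add: to_wo_def)
  also have "\<dots> = (\<Prod>i\<in>UNIV. (u - l) $ i)"
    by (rule prod.reindex_bij_betw[OF bij_Rep_wo])
  also have "\<dots> = (\<Prod>b\<in>Basis. (u - l) \<bullet> b)"
    unfolding Basis_vec_def
    by (subst prod.UNION_disjoint) (auto simp: axis_eq_axis inner_axis)
  finally show "emeasure (distr lborel borel of_wo) (box l u) = ennreal (\<Prod>b\<in>Basis. (u - l) \<bullet> b)" .
qed simp

lemma measure_to_wo_compact:
  fixes S :: "(real ^ 'n) set"
  assumes "compact S"
  shows "measure lebesgue (to_wo ` S) = measure lebesgue S"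
proof -
  have m: "of_wo \<in> borel_measurable borel"
    by (simp add: borel_measurable_continuous_onI linear_continuous_on linear_of_wo linear_conv_bounded_linear[symmetric])
  have S: "S \<in> sets borel" using assms by (simp add: borel_compact)
  have "compact (to_wo ` S)"
    using assms by (intro compact_linear_image linear_to_wo)
  then have S': "to_wo ` S \<in> sets borel" by (simp add: borel_compact)
  have "measure lebesgue S = measure lborel S"
    using S by simp
  also have "\<dots> = measure (distr lborel borel of_wo) S"
    by (simp add: distr_of_wo)
  also have "\<dots> = measure lborel (to_wo ` S)"
    using S m by (subst measure_distr) (auto simp: to_wo_image_eq)
  finally show ?thesis using S' by simp
qed

text \<open>Conjugation by \<open>to_wo\<close> turns \<open>f\<close> into an endomorphism
  \<open>g\<close> of the renamed space, where the factor is the absolute value of a determinant.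
  Later arguments use only that it is positive and independent of the set.\<close>

lemma measure_linear_image_compact:
  fixes f :: "real ^ 'n \<Rightarrow> real ^ 'n"
  assumes "linear f" "inj f"
  obtains c where "c > 0" "\<And>S. compact S \<Longrightarrow> measure lebesgue (f ` S) = c * measure lebesgue S"
proof -
  define g where "g = to_wo \<circ> f \<circ> of_wo"
  have g: "linear g"
    unfolding g_def using assms linear_to_wo linear_of_wo by (intro linear_compose) auto
  have "inj g"
    unfolding g_def using assms bij_to_wo bij_of_wo by (intro inj_compose) (auto simp: bij_def)
  then have "det (matrix g) \<noteq> 0"
    using det_nz_iff_inj g by blast
  moreover have "measure lebesgue (f ` S) = \<bar>det (matrix g)\<bar> * measure lebesgue S" if "compact S" for S
  proof -
    have 1: "compact (f ` S)" "compact (to_wo ` S)"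
      using that assms by (auto intro!: compact_linear_image linear_to_wo)
    have "measure lebesgue (f ` S) = measure lebesgue (to_wo ` f ` S)"
      using 1 by (simp add: measure_to_wo_compact)
    also have "to_wo ` f ` S = g ` to_wo ` S"
      by (auto simp: g_def image_comp o_def)
    also have "measure lebesgue (g ` to_wo ` S) = \<bar>det (matrix g)\<bar> * measure lebesgue (to_wo ` S)"
      using 1 by (intro measure_linear_image g) (simp add: lmeasurable_compact)
    finally show ?thesis using that by (simp add: measure_to_wo_compact)
  qed
  ultimately show thesis using that by (metis zero_less_abs_iff)
qed

section \<open>Polarization of determinants\<close>

text \<open>The top mixed difference: if \<open>F S\<close> is a homogeneous polynomial of degree
  \<open>n\<close> in the sum of the objects indexed by \<open>S\<close>, this is n! times its polar
  form at these objects.\<close>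

definition polarization :: "nat \<Rightarrow> (nat set \<Rightarrow> real) \<Rightarrow> real" where
  "polarization n F = (\<Sum>S\<in>Pow {..<n}. (-1) ^ (n - card S) * F S)"

text \<open>Inclusion-exclusion in product form: the alternating sum is the expansion of the product
  of \<open>1 - ?f x\<close>, with \<open>?f\<close> the indicator of the complement of
  \<open>R\<close>, and a single index outside \<open>R\<close> makes a factor vanish.\<close>

lemma polarization_superset:
  assumes "R \<subseteq> {..<n}"
  shows "polarization n (\<lambda>S. if R \<subseteq> S then 1 else 0) = (if R = {..<n} then 1 else 0)"
proof -
  let ?f = "\<lambda>x. if x \<in> R then 0 else 1 :: real"
  have "(\<Prod>x<n. 1 - ?f x) = (\<Sum>S\<in>Pow {..<n}. (-1) ^ (card {..<n} - card S) * (\<Prod>x\<in>S. 1) * (\<Prod>x\<in>{..<n}-S. ?f x))"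
    by (rule prod_diff_conv_sum') simp
  moreover have "(\<Prod>x\<in>{..<n}-S. ?f x) = (if R \<subseteq> S then 1 else 0)" if "S \<in> Pow {..<n}" for S
  proof (cases "R \<subseteq> S")
    case False
    then obtain x where "x \<in> R" "x \<notin> S" by blast
    then have "(\<Prod>x\<in>{..<n}-S. ?f x) = 0"
      using assms by (intro prod_zero bexI[of _ x]) auto
    with False show ?thesis by simp
  qed (auto intro!: prod.neutral)
  moreover have "(\<Prod>x<n. 1 - ?f x) = (if R = {..<n} then 1 else 0)"
  proof (cases "R = {..<n}")
    case False
    then obtain x where "x < n" "x \<notin> R" using assms by auto
    then have "(\<Prod>x<n. 1 - ?f x) = 0" by (intro prod_zero bexI[of _ x]) auto
    with False show ?thesis by simp
  qed (auto intro!: prod.neutral)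
  ultimately show ?thesis unfolding polarization_def by simp
qed

text \<open>The expanded product is a sum over maps \<open>\<phi>\<close>, and \<open>\<phi>\<close>
  contributes for exactly those \<open>S\<close> that contain its range. Only maps onto
  \<open>{..<n}\<close> survive the alternating sum; since \<open>n\<close> is the number of
  factors, they are bijections, so each \<open>k\<close> is used exactly once.\<close>

lemma polarization_prod:
  fixes a :: "nat \<Rightarrow> 'n::finite \<Rightarrow> real"
  defines "n \<equiv> CARD('n)"
  shows "polarization n (\<lambda>S. \<Prod>j\<in>UNIV. \<Sum>k\<in>S. a k j) =
    (\<Sum>\<phi> | bij_betw \<phi> UNIV {..<n}. \<Prod>j\<in>UNIV. a (\<phi> j) j)"
proof -
  let ?\<Phi> = "UNIV \<rightarrow>\<^sub>E {..<n} :: ('n \<Rightarrow> nat) set"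
  have fin: "finite ?\<Phi>" by (simp add: finite_PiE)
  have "(\<Prod>j\<in>UNIV. \<Sum>k\<in>S. a k j) = (\<Sum>\<phi>\<in>?\<Phi>. (if range \<phi> \<subseteq> S then 1 else 0) * (\<Prod>j\<in>UNIV. a (\<phi> j) j))"
    if "S \<in> Pow {..<n}" for S
  proof -
    have "finite S" using that finite_subset by auto
    then have "(\<Prod>j\<in>UNIV. \<Sum>k\<in>S. a k j) = (\<Sum>\<phi>\<in>UNIV \<rightarrow>\<^sub>E S. \<Prod>j\<in>UNIV. a (\<phi> j) j)"
      by (intro prod_sum_PiE) auto
    also have "\<dots> = (\<Sum>\<phi>\<in>?\<Phi>. if range \<phi> \<subseteq> S then \<Prod>j\<in>UNIV. a (\<phi> j) j else 0)"
      using that by (intro sum.mono_neutral_cong_left fin) (auto simp: PiE_iff image_subset_iff)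
    finally show ?thesis by (simp add: if_distrib[of "\<lambda>x. x * _"] cong: if_cong)
  qed
  then have "polarization n (\<lambda>S. \<Prod>j\<in>UNIV. \<Sum>k\<in>S. a k j) =
     (\<Sum>S\<in>Pow {..<n}. \<Sum>\<phi>\<in>?\<Phi>. (\<Prod>j\<in>UNIV. a (\<phi> j) j) * ((-1) ^ (n - card S) * (if range \<phi> \<subseteq> S then 1 else 0)))"
    unfolding polarization_def
    by (intro sum.cong refl) (simp only: sum_distrib_left mult_ac)
  also have "\<dots> = (\<Sum>\<phi>\<in>?\<Phi>. (\<Prod>j\<in>UNIV. a (\<phi> j) j) * polarization n (\<lambda>S. if range \<phi> \<subseteq> S then 1 else 0))"
    unfolding polarization_def by (subst sum.swap) (simp only: sum_distrib_left)
  also have "\<dots> = (\<Sum>\<phi>\<in>?\<Phi>. if range \<phi> = {..<n} then \<Prod>j\<in>UNIV. a (\<phi> j) j else 0)"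
    by (intro sum.cong refl, subst polarization_superset) (auto simp: PiE_iff)
  also have "\<dots> = (\<Sum>\<phi> | bij_betw \<phi> UNIV {..<n}. \<Prod>j\<in>UNIV. a (\<phi> j) j)"
  proof (rule sum.mono_neutral_cong_right[OF fin])
    show "\<forall>\<phi>\<in>?\<Phi> - {\<phi>. bij_betw \<phi> UNIV {..<n}}.
        (if range \<phi> = {..<n} then \<Prod>j\<in>UNIV. a (\<phi> j) j else 0) = 0"
      by (auto simp: bij_betw_def n_def intro!: eq_card_imp_inj_on)
  qed (auto simp: bij_betw_def PiE_iff)
  finally show ?thesis .
qed

lemma polarization_linear:
  "polarization n (\<lambda>S. a * F S + b * G S) = a * polarization n F + b * polarization n G"
  unfolding polarization_def by (simp add: sum.distrib sum_distrib_left algebra_simps)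

lemma polarization_sum:
  "polarization n (\<lambda>S. \<Sum>i\<in>I. c i * F i S) = (\<Sum>i\<in>I. c i * polarization n (F i))"
  unfolding polarization_def sum_distrib_left
  by (subst sum.swap) (simp add: mult_ac)

lemma polarization_cong:
  "(\<And>S. S \<subseteq> {..<n} \<Longrightarrow> F S = G S) \<Longrightarrow> polarization n F = polarization n G"
  unfolding polarization_def by (intro sum.cong) auto

text \<open>A bijection takes the value \<open>i\<close> at exactly one index \<open>j0\<close>, so
  every summand contains exactly one factor from row \<open>i\<close>.\<close>

lemma polarization_prod_linear:
  fixes a :: "nat \<Rightarrow> 'n::finite \<Rightarrow> real"
  assumes "i < CARD('n)"
  defines "P \<equiv> \<lambda>a :: nat \<Rightarrow> 'n \<Rightarrow> real. polarization (CARD('n)) (\<lambda>S. \<Prod>j\<in>UNIV. \<Sum>k\<in>S. a k j)"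
  shows "P (a(i := \<lambda>j. s * x j + t * y j)) = s * P (a(i := x)) + t * P (a(i := y))"
proof -
  have "(\<Prod>j\<in>UNIV. (a(i := \<lambda>j. s * x j + t * y j)) (\<phi> j) j) =
      s * (\<Prod>j\<in>UNIV. (a(i := x)) (\<phi> j) j) + t * (\<Prod>j\<in>UNIV. (a(i := y)) (\<phi> j) j)"
    if "bij_betw \<phi> UNIV {..<CARD('n)}" for \<phi> :: "'n \<Rightarrow> nat"
  proof -
    have \<phi>: "inj \<phi>" "i \<in> range \<phi>"
      using that assms(1) by (auto simp: bij_betw_def)
    then obtain j0 where j0: "\<phi> j0 = i" by blast
    have ne: "\<phi> j \<noteq> i" if "j \<noteq> j0" for j
      using that j0 injD[OF \<phi>(1)] by blast
    have "(\<Prod>j\<in>UNIV. (a(i := z)) (\<phi> j) j) = z j0 * (\<Prod>j\<in>UNIV - {j0}. a (\<phi> j) j)" for z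
    proof -
      have "(\<Prod>j\<in>UNIV. (a(i := z)) (\<phi> j) j) = (a(i := z)) (\<phi> j0) j0 * (\<Prod>j\<in>UNIV - {j0}. (a(i := z)) (\<phi> j) j)"
        by (rule prod.remove) auto
      also have "(\<Prod>j\<in>UNIV - {j0}. (a(i := z)) (\<phi> j) j) = (\<Prod>j\<in>UNIV - {j0}. a (\<phi> j) j)"
        by (rule prod.cong) (auto simp: ne)
      finally show ?thesis by (simp add: j0)
    qed
    then show ?thesis by (simp add: algebra_simps)
  qed
  then show ?thesis
    unfolding P_def polarization_prod
    by (simp add: sum_distrib_left sum.distrib[symmetric])
qed

text \<open>\<open>D M\<close> is n! times the mixed discriminant. In the Leibniz formula a fixed
  permutation \<open>p\<close> contributes a product over \<open>j\<close> of sums over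
  \<open>k\<close> of the entries \<open>M k $ j $ p j\<close>, so the case of products applies to
  each \<open>p\<close> separately.\<close>

lemma polarization_det_linear:
  fixes M :: "nat \<Rightarrow> real ^ 'n ^ 'n"
  assumes "i < CARD('n)"
  defines "D \<equiv> \<lambda>M :: nat \<Rightarrow> real ^ 'n ^ 'n. polarization (CARD('n)) (\<lambda>S. det (\<Sum>k\<in>S. M k))"
  shows "D (M(i := s *\<^sub>R A + t *\<^sub>R B)) = s * D (M(i := A)) + t * D (M(i := B))"
proof -
  define P where "P \<equiv> \<lambda>a :: nat \<Rightarrow> 'n \<Rightarrow> real. polarization (CARD('n)) (\<lambda>S. \<Prod>j\<in>UNIV. \<Sum>k\<in>S. a k j)"
  have D: "D M = (\<Sum>p | p permutes UNIV. of_int (sign p) * P (\<lambda>k j. M k $ j $ p j))" for M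
    unfolding D_def P_def det_def polarization_sum by simp
  have upd: "(\<lambda>k j. (M(i := Z)) k $ j $ p j) = (\<lambda>k j. M k $ j $ p j)(i := \<lambda>j. Z $ j $ p j)" for Z and p :: "'n \<Rightarrow> 'n"
    by (auto simp: fun_eq_iff)
  have "P (\<lambda>k j. (M(i := s *\<^sub>R A + t *\<^sub>R B)) k $ j $ p j) =
      s * P (\<lambda>k j. (M(i := A)) k $ j $ p j) + t * P (\<lambda>k j. (M(i := B)) k $ j $ p j)" for p :: "'n \<Rightarrow> 'n"
    unfolding upd P_def
    using polarization_prod_linear[OF assms(1), of "\<lambda>k j. M k $ j $ p j" s "\<lambda>j. A $ j $ p j" t "\<lambda>j. B $ j $ p j"] by simp
  then show ?thesis unfolding D by (simp add: sum_distrib_left sum.distrib[symmetric] algebra_simps)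
qed

text \<open>With all entries equal to 1 the product formula counts bijections. The type
  \<open>'n\<close> only supplies an index set with \<open>n\<close> elements.\<close>

lemma polarization_power_card: "polarization n (\<lambda>S. real (card S) ^ n) = fact n" if "n = CARD('n::finite)"
proof -
  have "polarization n (\<lambda>S. real (card S) ^ n) =
      polarization CARD('n) (\<lambda>S. \<Prod>j\<in>(UNIV :: 'n set). \<Sum>k\<in>S. 1)"
    using that by simp
  also have "\<dots> = real (card {\<phi> :: 'n \<Rightarrow> nat. bij_betw \<phi> UNIV {..<CARD('n)}})"
    unfolding polarization_prod by simp
  also have "\<dots> = fact n"
  proof -
    have "{\<phi> :: 'n \<Rightarrow> nat. bij_betw \<phi> UNIV {..<CARD('n)}} = {\<phi> \<in> UNIV \<rightarrow>\<^sub>E {..<CARD('n)}. inj_on \<phi> UNIV}"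
    proof (intro equalityI subsetI; clarsimp simp: bij_betw_def PiE_iff)
      fix \<phi> :: "'n \<Rightarrow> nat" assume \<phi>: "\<forall>i. \<phi> i < CARD('n)" "inj \<phi>"
      show "range \<phi> = {..<CARD('n)}"
        using \<phi> by (intro card_subset_eq) (auto simp: card_image)
    qed auto
    then show ?thesis
      using that card_inj_on_subset_funcset[of "UNIV :: 'n set" "{..<CARD('n)}" UNIV] by (simp add: fact_prod_rev)
  qed
  finally show ?thesis .
qed

section \<open>Gradient images of convex functions\<close>

text \<open>Eigenvalues are avoided: all matrices on the segment from the identity to
  \<open>A\<close> have a positive quadratic form, hence are nonsingular, so the determinant cannot
  change sign along it.\<close>

lemma matrix_pos_det:
  fixes A :: "real ^ 'n ^ 'n"
  assumes "\<And>w. w \<noteq> 0 \<Longrightarrow> 0 < (A *v w) \<bullet> w"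
  shows "0 < det A"
proof -
  define B where "B t = (1 - t) *\<^sub>R mat 1 + t *\<^sub>R A" for t :: real
  have nz: "det (B t) \<noteq> 0" if "t \<in> {0..1}" for t
  proof -
    have "w = 0" if "B t *v w = 0" for w
    proof (rule ccontr)
      assume w: "w \<noteq> 0"
      have "0 = (B t *v w) \<bullet> w" using that by simp
      also have "\<dots> = (1 - t) * (w \<bullet> w) + t * ((A *v w) \<bullet> w)"
        by (simp add: B_def matrix_vector_mult_add_rdistrib scaleR_matrix_vector_assoc[symmetric] inner_add_left)
      also have "\<dots> > 0"
      proof (cases "t = 0")
        case False
        then have "0 < t * ((A *v w) \<bullet> w)" "0 \<le> (1 - t) * (w \<bullet> w)"
          using assms[OF w] \<open>t \<in> {0..1}\<close> by auto
        then show ?thesis by linarith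
      qed (use w in simp)
      finally show False by simp
    qed
    then have "invertible (B t)"
      using matrix_left_invertible_ker invertible_left_inverse by blast
    then show ?thesis by (simp add: invertible_det_nz)
  qed
  have "continuous_on {0..1} (\<lambda>t. det (B t))"
    unfolding B_def det_def
    by (intro continuous_intros)
  moreover have "det (B 0) = 1" "B 1 = A" by (auto simp: B_def)
  ultimately show ?thesis
    using nz IVT2'[of "\<lambda>t. det (B t)" 1 0 0] by fastforce
qed

lemma compact_set_plus:
  fixes A B :: "'a::real_normed_vector set"
  assumes "compact A" "compact B"
  shows "compact (A + B)"
proof -
  have "A + B = {x + y | x y. x \<in> A \<and> y \<in> B}"
    by (auto simp: set_plus_def)
  then show ?thesis using compact_sums[OF assms] by simp
qed

text \<open>\<open>f\<close> is strictly convex, lies above the support function of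
  \<open>K\<close>, and has its gradient in \<open>K\<close>. The bound by the support function
  stands in for surjectivity of \<open>g\<close> onto the interior, which does not visibly survive
  addition; each condition listed does.\<close>

definition gradient_rep ::
  "(real ^ 'n) set \<Rightarrow> (real ^ 'n \<Rightarrow> real) \<Rightarrow> (real ^ 'n \<Rightarrow> real ^ 'n) \<Rightarrow> (real ^ 'n \<Rightarrow> real ^ 'n ^ 'n) \<Rightarrow> bool" where
  "gradient_rep K f g H \<longleftrightarrow> compact K \<and> convex K \<and>
     (\<forall>x. (f has_derivative (\<lambda>w. g x \<bullet> w)) (at x)) \<and>
     (\<forall>x. (g has_derivative (\<lambda>w. H x *v w)) (at x)) \<and>
     (\<forall>x w. w \<noteq> 0 \<longrightarrow> 0 < (H x *v w) \<bullet> w) \<and>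
     (\<forall>x. g x \<in> K) \<and> (\<forall>x. \<forall>y\<in>K. x \<bullet> y \<le> f x)"

lemma gradient_rep_add:
  assumes "gradient_rep K1 f1 g1 H1" "gradient_rep K2 f2 g2 H2"
  shows "gradient_rep (K1 + K2) (\<lambda>x. f1 x + f2 x) (\<lambda>x. g1 x + g2 x) (\<lambda>x. H1 x + H2 x)"
  unfolding gradient_rep_def
proof (intro conjI allI impI ballI)
  note defs = assms[unfolded gradient_rep_def]
  fix x :: "real ^ 'a"
  show "compact (K1 + K2)" "convex (K1 + K2)"
    using defs by (auto intro: compact_set_plus convex_set_plus)
  show "((\<lambda>x. f1 x + f2 x) has_derivative (\<lambda>w. (g1 x + g2 x) \<bullet> w)) (at x)"
    unfolding inner_add_left using defs by (intro has_derivative_add) auto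
  show "((\<lambda>x. g1 x + g2 x) has_derivative (\<lambda>w. (H1 x + H2 x) *v w)) (at x)"
    unfolding matrix_vector_mult_add_rdistrib using defs by (intro has_derivative_add) auto
  show "0 < ((H1 x + H2 x) *v w) \<bullet> w" if "w \<noteq> 0" for w
    using defs that by (simp add: matrix_vector_mult_add_rdistrib inner_add_left add_pos_pos)
  show "g1 x + g2 x \<in> K1 + K2"
    using defs by (intro set_plus_intro) auto
  show "x \<bullet> y \<le> f1 x + f2 x" if "y \<in> K1 + K2" for y
    using that defs by (elim set_plus_elim) (simp add: inner_add_right add_mono)
qed

lemma gradient_rep_scale:
  assumes "gradient_rep K f g H" "a > 0"
  shows "gradient_rep ((*\<^sub>R) a ` K) (\<lambda>x. a * f x) (\<lambda>x. a *\<^sub>R g x) (\<lambda>x. a *\<^sub>R H x)"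
  unfolding gradient_rep_def
proof (intro conjI allI impI ballI)
  note defs = assms(1)[unfolded gradient_rep_def]
  fix x :: "real ^ 'a"
  show "compact ((*\<^sub>R) a ` K)" "convex ((*\<^sub>R) a ` K)"
    using defs by (auto intro: compact_scaling convex_scaling)
  show "((\<lambda>x. a * f x) has_derivative (\<lambda>w. (a *\<^sub>R g x) \<bullet> w)) (at x)"
    unfolding inner_scaleR_left using defs by (intro has_derivative_mult_right) auto
  show "((\<lambda>x. a *\<^sub>R g x) has_derivative (\<lambda>w. (a *\<^sub>R H x) *v w)) (at x)"
    unfolding scaleR_matrix_vector_assoc[symmetric] using defs by (intro has_derivative_scaleR_right) auto
  show "0 < ((a *\<^sub>R H x) *v w) \<bullet> w" if "w \<noteq> 0" for w
    using defs that assms(2) by (simp add: scaleR_matrix_vector_assoc[symmetric])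
  show "a *\<^sub>R g x \<in> (*\<^sub>R) a ` K"
    using defs by auto
  show "x \<bullet> y \<le> a * f x" if "y \<in> (*\<^sub>R) a ` K" for y
    using that defs assms(2) by (auto simp: mult_left_mono)
qed

text \<open>The gradient is strictly monotone: along the segment from \<open>x\<close> to
  \<open>y\<close> its component in the direction \<open>y - x\<close> has positive
  derivative.\<close>

lemma gradient_rep_inj:
  assumes "gradient_rep K f g H"
  shows "inj g"
proof (rule injI, rule ccontr)
  fix x y assume g: "g x = g y" and ne: "x \<noteq> y"
  have dg: "(g has_derivative (\<lambda>w. H x *v w)) (at x)" for x
    using assms by (auto simp: gradient_rep_def)
  let ?h = "\<lambda>t. g (x + t *\<^sub>R (y - x)) \<bullet> (y - x)"
  have "\<exists>t\<in>{0<..<1}. ?h 1 - ?h 0 = ((1 - 0) *\<^sub>R (H (x + t *\<^sub>R (y - x)) *v (y - x))) \<bullet> (y - x)"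
  proof (rule mvt_simple)
    fix t :: real
    have "((\<lambda>t. g (x + t *\<^sub>R (y - x))) has_derivative (\<lambda>s. H (x + t *\<^sub>R (y - x)) *v (s *\<^sub>R (y - x)))) (at t within {0..1})"
      by (rule has_derivative_compose[OF _ dg]) (auto intro!: derivative_eq_intros)
    then show "(?h has_derivative (\<lambda>s. (s *\<^sub>R (H (x + t *\<^sub>R (y - x)) *v (y - x))) \<bullet> (y - x))) (at t within {0..1})"
      by (auto intro!: derivative_eq_intros simp: matrix_vector_mult_scaleR)
  qed simp
  then obtain t where "(H (x + t *\<^sub>R (y - x)) *v (y - x)) \<bullet> (y - x) = 0"
    using g by auto
  moreover have "0 < (H (x + t *\<^sub>R (y - x)) *v (y - x)) \<bullet> (y - x)"
    using assms ne by (auto simp: gradient_rep_def)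
  ultimately show False by simp
qed

text \<open>A point \<open>z\<close> is the gradient of \<open>f\<close> at a minimizer of
  \<open>f x - x \<bullet> z\<close>. If the ball of radius \<open>r\<close> about \<open>z\<close>
  lies in \<open>K\<close>, testing \<open>x \<bullet> y \<le> f x\<close> with its extreme point in
  the direction \<open>x\<close> bounds this function below by \<open>r * norm x\<close>, so the
  minimum exists.\<close>

lemma gradient_rep_surj:
  assumes "gradient_rep K f g H"
  shows "interior K \<subseteq> range g"
proof
  fix z assume "z \<in> interior K"
  then obtain r where r: "r > 0" "cball z r \<subseteq> K"
    by (meson interior_subset mem_interior_cball)
  have df: "(f has_derivative (\<lambda>w. g x \<bullet> w)) (at x)" and f: "\<And>y. y \<in> K \<Longrightarrow> x \<bullet> y \<le> f x" for x
    using assms by (auto simp: gradient_rep_def)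
  define \<Phi> where "\<Phi> x = f x - x \<bullet> z" for x
  have low: "r * norm x \<le> \<Phi> x" for x
  proof (cases "x = 0")
    case True
    then show ?thesis using f[of z 0] r subsetD[OF r(2), of z] by (simp add: \<Phi>_def)
  next
    case False
    have "z + (r / norm x) *\<^sub>R x \<in> K"
      using r False by (intro subsetD[OF r(2)]) (auto simp: dist_norm)
    from f[OF this, of x] show ?thesis
      using False by (simp add: \<Phi>_def inner_add_right dot_square_norm power2_eq_square)
  qed
  \<comment> \<open>Outside the ball of this radius \<open>r * norm x\<close> exceeds
    \<open>\<Phi> 0\<close>, so the minimum over the ball is global.\<close>
  define R where "R = \<Phi> 0 / r"
  have "R \<ge> 0" using low[of 0] r by (simp add: R_def)
  have "continuous_on (cball 0 R) \<Phi>"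
    unfolding \<Phi>_def using df by (intro continuous_intros) (meson has_derivative_continuous continuous_at_imp_continuous_on)
  then obtain x0 where x0: "x0 \<in> cball 0 R" "\<And>x. x \<in> cball 0 R \<Longrightarrow> \<Phi> x0 \<le> \<Phi> x"
    using continuous_attains_inf[of "cball 0 R" \<Phi>] \<open>R \<ge> 0\<close> by auto
  have "\<Phi> x0 \<le> \<Phi> x" for x
  proof (cases "x \<in> cball 0 R")
    case False
    then have "\<Phi> 0 < r * norm x" using r by (simp add: R_def field_simps)
    then show ?thesis using low[of x] x0(2)[of 0] \<open>R \<ge> 0\<close> by simp
  qed (use x0 in simp)
  moreover have "(\<Phi> has_derivative (\<lambda>w. g x0 \<bullet> w - w \<bullet> z)) (at x0)"
    unfolding \<Phi>_def by (rule has_derivative_diff[OF df has_derivative_inner_left[OF has_derivative_ident]])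
  ultimately have "(\<lambda>w. g x0 \<bullet> w - w \<bullet> z) = (\<lambda>w. 0)"
    by (intro differential_zero_maxmin[of x0 UNIV]) auto
  then have "(g x0 - z) \<bullet> (g x0 - z) = 0"
    by (metis inner_commute inner_diff_left)
  then show "z \<in> range g" by auto
qed

text \<open>\<open>range g\<close> and \<open>K\<close> differ only in boundary points of
  \<open>K\<close>, a null set by convexity. Positivity of the determinant removes the absolute
  value from the change of variables, and what remains can be polarized.\<close>

lemma gradient_rep_measure:
  fixes K :: "(real ^ 'n::{finite,wellorder}) set"
  assumes "gradient_rep K f g H"
  shows "((\<lambda>x. det (H x)) has_integral measure lebesgue K) UNIV"
proof -
  have K: "compact K" "convex K" and dg: "(g has_derivative (\<lambda>w. H x *v w)) (at x)"
    and pos: "\<And>w. w \<noteq> 0 \<Longrightarrow> 0 < (H x *v w) \<bullet> w" and gK: "g x \<in> K" for x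
    using assms by (auto simp: gradient_rep_def)
  have "negligible (K - range g \<union> (range g - K))"
  proof (rule negligible_subset)
    show "negligible (frontier K)" by (rule negligible_convex_frontier[OF K(2)])
    show "K - range g \<union> (range g - K) \<subseteq> frontier K"
      using gradient_rep_surj[OF assms] gK K by (auto simp: frontier_def closure_closed compact_imp_closed)
  qed
  then have "range g \<in> lmeasurable" "measure lebesgue (range g) = measure lebesgue K"
    using lmeasurable_compact[OF K(1)] by (metis lmeasurable_negligible_symdiff, metis measure_negligible_symdiff)
  then have "((\<lambda>x. \<bar>det (matrix (\<lambda>w. H x *v w))\<bar>) has_integral measure lebesgue K) UNIV"
    using has_measure_differentiable_image[of UNIV g "\<lambda>x w. H x *v w" "measure lebesgue K"] dg gradient_rep_inj[OF assms]
    by auto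
  moreover have "0 < det (H x)" for x using pos by (rule matrix_pos_det)
  ultimately show ?thesis by (simp add: less_imp_le)
qed

text \<open>\<open>g x\<close> is the mean of the points of \<open>Y\<close> under the weights
  \<open>e x y / E x\<close>, and its derivative is the covariance matrix of this distribution,
  positive definite because \<open>Y\<close> lies in no hyperplane.\<close>

lemma gradient_rep_polytope:
  fixes Y :: "(real ^ 'n) set"
  assumes "finite Y" "interior (convex hull Y) \<noteq> {}"
  shows "\<exists>f g H. gradient_rep (convex hull Y) f g H"
proof -
  have "Y \<noteq> {}" using assms by auto
  define e where "e x y = exp (x \<bullet> y)" for x y :: "real ^ 'n"
  define E where "E x = (\<Sum>y\<in>Y. e x y)" for x
  define N where "N x = (\<Sum>y\<in>Y. e x y *\<^sub>R y)" for x
  define N' where "N' x w = (\<Sum>y\<in>Y. (e x y * (w \<bullet> y)) *\<^sub>R y)" for x w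
  define g where "g x = inverse (E x) *\<^sub>R N x" for x
  define g' where "g' x w = inverse (E x) *\<^sub>R N' x w + (- (inverse (E x) * (N x \<bullet> w) * inverse (E x))) *\<^sub>R N x" for x w
  have e_pos: "e x y > 0" for x y by (simp add: e_def)
  have E_pos: "E x > 0" for x
    unfolding E_def using assms(1) \<open>Y \<noteq> {}\<close> e_pos by (intro sum_pos) auto
  have e_der: "((\<lambda>x. e x y) has_derivative (\<lambda>w. e x y * (w \<bullet> y))) (at x)" for x y
    unfolding e_def by (auto intro!: derivative_eq_intros)
  have E_der: "(E has_derivative (\<lambda>w. N x \<bullet> w)) (at x)" for x
  proof -
    have "(E has_derivative (\<lambda>w. \<Sum>y\<in>Y. e x y * (w \<bullet> y))) (at x)"
      unfolding E_def by (intro has_derivative_sum e_der)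
    then show ?thesis unfolding N_def inner_sum_left inner_scaleR_left by (simp add: inner_commute)
  qed
  have N_der: "(N has_derivative N' x) (at x)" for x
    unfolding N_def N'_def by (intro has_derivative_sum has_derivative_scaleR_left e_der)
  have g_der: "(g has_derivative g' x) (at x)" for x
  proof -
    have "((\<lambda>x. inverse (E x)) has_derivative (\<lambda>w. - (inverse (E x) * (N x \<bullet> w) * inverse (E x)))) (at x)"
      using E_der E_pos[of x] by (intro Deriv.has_derivative_inverse) auto
    from has_derivative_scaleR[OF this N_der] show ?thesis
      unfolding g_def g'_def by simp
  qed
  have f_der: "((\<lambda>x. ln (E x)) has_derivative (\<lambda>w. g x \<bullet> w)) (at x)" for x
    using has_derivative_ln[OF E_pos E_der, of x] by (simp add: g_def mult.commute)
  have pos: "0 < g' x w \<bullet> w" if "w \<noteq> 0" for x w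
  proof -
    \<comment> \<open>Under these weights \<open>m\<close> is the mean of \<open>t\<close>, and the
      quadratic form at \<open>w\<close> is the variance of \<open>t\<close>.\<close>
    define t where "t y = y \<bullet> w" for y
    define m where "m = (N x \<bullet> w) / E x"
    have Nw: "N x \<bullet> w = (\<Sum>y\<in>Y. e x y * t y)"
      by (simp add: N_def inner_sum_left t_def)
    have N'w: "N' x w \<bullet> w = (\<Sum>y\<in>Y. e x y * (t y)\<^sup>2)"
      unfolding N'_def inner_sum_left inner_scaleR_left t_def by (simp add: inner_commute power2_eq_square mult.assoc)
    have "g' x w \<bullet> w * E x = N' x w \<bullet> w - (N x \<bullet> w)\<^sup>2 / E x"
      using E_pos[of x] by (simp add: g'_def inner_add_left inner_diff_left field_simps power2_eq_square)
    also have "\<dots> = (\<Sum>y\<in>Y. e x y * (t y - m)\<^sup>2)"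
    proof -
      have "(\<Sum>y\<in>Y. e x y * (t y - m)\<^sup>2) = (\<Sum>y\<in>Y. e x y * (t y)\<^sup>2) - 2 * m * (\<Sum>y\<in>Y. e x y * t y) + m\<^sup>2 * E x"
      proof -
        have "e x y * (t y - m)\<^sup>2 = e x y * (t y)\<^sup>2 - 2 * m * (e x y * t y) + m\<^sup>2 * e x y" for y
          by (simp add: power2_diff algebra_simps)
        then show ?thesis
          by (simp only: E_def sum.distrib sum_subtractf sum_distrib_left)
      qed
      also have "\<dots> = N' x w \<bullet> w - 2 * m * (N x \<bullet> w) + m\<^sup>2 * E x"
        by (simp add: Nw N'w)
      also have "\<dots> = N' x w \<bullet> w - (N x \<bullet> w)\<^sup>2 / E x"
        using E_pos[of x] by (simp add: m_def field_simps power2_eq_square)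
      finally show ?thesis by simp
    qed
    also have "\<dots> > 0"
    proof (rule ccontr)
      assume "\<not> ?thesis"
      moreover have "(\<Sum>y\<in>Y. e x y * (t y - m)\<^sup>2) \<ge> 0"
        using e_pos by (intro sum_nonneg mult_nonneg_nonneg) (auto simp: less_imp_le)
      ultimately have "(\<Sum>y\<in>Y. e x y * (t y - m)\<^sup>2) = 0" by linarith
      then have "\<forall>y\<in>Y. e x y * (t y - m)\<^sup>2 = 0"
        using e_pos by (subst (asm) sum_nonneg_eq_0_iff[OF assms(1)]) (auto simp: less_imp_le)
      then have "Y \<subseteq> {y. w \<bullet> y = m}"
        using less_imp_neq[OF e_pos, symmetric, of x] by (auto simp: t_def inner_commute)
      then have "convex hull Y \<subseteq> {y. w \<bullet> y = m}"
        by (intro hull_minimal) (auto intro: convex_hyperplane)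
      then have "interior (convex hull Y) \<subseteq> interior {y. w \<bullet> y = m}" by (rule interior_mono)
      then show False using assms(2) that by simp
    qed
    finally show ?thesis using E_pos[of x] by (simp add: zero_less_mult_iff)
  qed
  have g_in: "g x \<in> convex hull Y" for x
  proof -
    have "g x = (\<Sum>y\<in>Y. (e x y / E x) *\<^sub>R y)"
      by (simp add: g_def N_def scaleR_sum_right divide_inverse mult.commute)
    also have "\<dots> \<in> convex hull Y"
      using E_pos[of x] e_pos[of x]
      by (intro convex_sum[OF assms(1) convex_convex_hull])
        (auto simp: hull_inc less_imp_le sum_divide_distrib[symmetric] E_def[symmetric])
    finally show ?thesis .
  qed
  have f_ge: "x \<bullet> y \<le> ln (E x)" if "y \<in> convex hull Y" for x y
  proof -
    have "Y \<subseteq> {y. x \<bullet> y \<le> ln (E x)}"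
    proof clarify
      fix y assume "y \<in> Y"
      then have "e x y \<le> E x"
        unfolding E_def using e_pos assms(1) by (intro member_le_sum) (auto simp: less_imp_le)
      then show "x \<bullet> y \<le> ln (E x)"
        using E_pos by (simp add: e_def ln_ge_iff)
    qed
    then have "convex hull Y \<subseteq> {y. x \<bullet> y \<le> ln (E x)}"
      by (intro hull_minimal) (auto intro: convex_halfspace_le)
    then show ?thesis using that by auto
  qed
  have mat: "matrix (g' x) *v w = g' x w" for x w
    using has_derivative_linear[OF g_der, of x] by (intro matrix_works) (simp add: linear_def scalar_mult_eq_scaleR[abs_def])
  have "gradient_rep (convex hull Y) (\<lambda>x. ln (E x)) g (\<lambda>x. matrix (g' x))"
    unfolding gradient_rep_def mat
    by (intro conjI allI impI ballI finite_imp_compact_convex_hull assms(1) convex_convex_hull f_der g_der pos g_in f_ge)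
  then show ?thesis by blast
qed

section \<open>Outer approximation by polytopes\<close>

text \<open>Approximation from outside makes the volumes converge by outer regularity alone, also
  when \<open>K\<close> has no interior points. The explicit rate makes the notion stable under sums
  and multiples, which only change \<open>c\<close>.\<close>

definition outer_approx :: "'a::euclidean_space set \<Rightarrow> (nat \<Rightarrow> 'a set) \<Rightarrow> bool" where
  "outer_approx K Ks \<longleftrightarrow> compact K \<and> (\<forall>j. compact (Ks j) \<and> K \<subseteq> Ks j) \<and>
     (\<exists>c\<ge>0. \<forall>j. Ks j \<subseteq> K + cball 0 (c / real (Suc j)))"

lemma outer_approx_0: "outer_approx 0 (\<lambda>_. 0)"
  unfolding outer_approx_def by (auto simp: intro!: exI[of _ 0])

lemma cball_plus_cball: "cball (0::'a::real_normed_vector) r + cball 0 s \<subseteq> cball 0 (r + s)"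
  by (auto elim!: set_plus_elim intro: norm_triangle_mono)

lemma outer_approx_add:
  assumes "outer_approx A As" "outer_approx B Bs"
  shows "outer_approx (A + B) (\<lambda>j. As j + Bs j)"
proof -
  obtain c d where c: "c \<ge> 0" "\<And>j. As j \<subseteq> A + cball 0 (c / real (Suc j))"
    and d: "d \<ge> 0" "\<And>j. Bs j \<subseteq> B + cball 0 (d / real (Suc j))"
    using assms unfolding outer_approx_def by blast
  have "As j + Bs j \<subseteq> (A + B) + cball 0 ((c + d) / real (Suc j))" for j
  proof -
    have "As j + Bs j \<subseteq> (A + cball 0 (c / real (Suc j))) + (B + cball 0 (d / real (Suc j)))"
      by (intro set_plus_mono2 c d)
    also have "\<dots> = (A + B) + (cball 0 (c / real (Suc j)) + cball 0 (d / real (Suc j)))"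
      by (simp only: ac_simps)
    also have "\<dots> \<subseteq> (A + B) + cball 0 (c / real (Suc j) + d / real (Suc j))"
      by (intro set_plus_mono2 order_refl cball_plus_cball)
    finally show ?thesis by (simp add: add_divide_distrib)
  qed
  moreover have "A + B \<subseteq> As j + Bs j" "compact (As j + Bs j)" "compact (A + B)" for j
    using assms unfolding outer_approx_def by (intro compact_set_plus set_plus_mono2; blast)+
  ultimately show ?thesis
    using c(1) d(1) add_nonneg_nonneg unfolding outer_approx_def by blast
qed

lemma outer_approx_scale:
  assumes "outer_approx A As" "a \<ge> 0"
  shows "outer_approx ((*\<^sub>R) a ` A) (\<lambda>j. (*\<^sub>R) a ` As j)"
proof -
  obtain c where c: "c \<ge> 0" "\<And>j. As j \<subseteq> A + cball 0 (c / real (Suc j))"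
    using assms unfolding outer_approx_def by blast
  have "(*\<^sub>R) a ` As j \<subseteq> (*\<^sub>R) a ` A + cball 0 ((a * c) / real (Suc j))" for j
  proof clarify
    fix x assume "x \<in> As j"
    then obtain y z where "y \<in> A" "norm z \<le> c / real (Suc j)" and x: "x = y + z"
      using c(2)[of j] by (force elim!: set_plus_elim)
    then have "norm (a *\<^sub>R z) \<le> a * c / real (Suc j)"
      using assms(2) mult_left_mono[of "norm z" "c / real (Suc j)" a] by simp
    then show "a *\<^sub>R x \<in> (*\<^sub>R) a ` A + cball 0 ((a * c) / real (Suc j))"
      using \<open>y \<in> A\<close> unfolding x scaleR_add_right by (intro set_plus_intro) auto
  qed
  moreover have "(*\<^sub>R) a ` A \<subseteq> (*\<^sub>R) a ` As j" "compact ((*\<^sub>R) a ` As j)" "compact ((*\<^sub>R) a ` A)" for j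
    using assms unfolding outer_approx_def by (blast intro: compact_scaling)+
  ultimately show ?thesis
    using c(1) assms(2) mult_nonneg_nonneg unfolding outer_approx_def by blast
qed

lemma outer_approx_sum:
  assumes "finite I" "\<And>i. i \<in> I \<Longrightarrow> outer_approx (A i) (As i)"
  shows "outer_approx (\<Sum>i\<in>I. A i) (\<lambda>j. \<Sum>i\<in>I. As i j)"
  using assms
proof (induction I rule: finite_induct)
  case empty
  show ?case unfolding sum.empty by (rule outer_approx_0)
next
  case (insert i I)
  then show ?case by (simp add: outer_approx_add)
qed

text \<open>Outer regularity provides an open superset of nearly the same measure, and compactness a
  uniform margin inside it.\<close>

lemma measure_compact_neighbourhood:
  fixes K :: "'a::euclidean_space set"
  assumes "compact K" "e > 0"
  obtains d where "d > 0"
    "\<And>C. \<lbrakk>compact C; C \<subseteq> K + cball 0 d\<rbrakk> \<Longrightarrow> measure lebesgue C < measure lebesgue K + e"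
proof -
  have K: "K \<in> lmeasurable" using assms by (simp add: lmeasurable_compact)
  obtain T where T: "open T" "K \<subseteq> T" "T - K \<in> lmeasurable" "emeasure lebesgue (T - K) < ennreal e"
    using sets_lebesgue_outer_open[of K e] K assms fmeasurableD by blast
  obtain r where r: "r > 0" "(\<Union>x\<in>K. ball x r) \<subseteq> T"
    using compact_subset_open_imp_ball_epsilon_subset[OF assms(1) T(1,2)] by blast
  show thesis
  proof
    show "r / 2 > 0" using r by simp
    fix C assume C: "compact C" "C \<subseteq> K + cball 0 (r / 2)"
    have "C \<subseteq> T"
    proof
      fix x assume "x \<in> C"
      then obtain y z where "y \<in> K" "norm z \<le> r / 2" "x = y + z"
        using C by (force elim!: set_plus_elim)
      then have "x \<in> ball y r" using r by (simp add: dist_norm)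
      then show "x \<in> T" using \<open>y \<in> K\<close> r by blast
    qed
    have TK: "T = K \<union> (T - K)" using T by blast
    have Tm: "T \<in> lmeasurable" by (subst TK) (rule fmeasurable.Un[OF K T(3)])
    have "measure lebesgue C \<le> measure lebesgue T"
      using C by (intro measure_mono_fmeasurable \<open>C \<subseteq> T\<close> Tm fmeasurableD[OF lmeasurable_compact]) auto
    also have "\<dots> \<le> measure lebesgue K + measure lebesgue (T - K)"
      by (subst TK) (intro measure_Un_le fmeasurableD K T)
    also have "measure lebesgue (T - K) < e"
      using T(3,4) assms(2) by (simp add: emeasure_eq_measure2 ennreal_less_iff)
    finally show "measure lebesgue C < measure lebesgue K + e" by simp
  qed
qed

lemma outer_approx_measure:
  assumes "outer_approx K Ks"
  shows "(\<lambda>j. measure lebesgue (Ks j)) \<longlonglongrightarrow> measure lebesgue K"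
proof (rule LIMSEQ_I)
  fix e :: real assume "e > 0"
  obtain c where K: "compact K" "\<And>j. compact (Ks j)" "\<And>j. K \<subseteq> Ks j"
    and c: "c \<ge> 0" "\<And>j. Ks j \<subseteq> K + cball 0 (c / real (Suc j))"
    using assms unfolding outer_approx_def by blast
  obtain d where d: "d > 0"
    "\<And>C. \<lbrakk>compact C; C \<subseteq> K + cball 0 d\<rbrakk> \<Longrightarrow> measure lebesgue C < measure lebesgue K + e"
    using measure_compact_neighbourhood[OF K(1) \<open>e > 0\<close>] by blast
  obtain n where n: "c / d < real n" using reals_Archimedean2 by blast
  have "norm (measure lebesgue (Ks j) - measure lebesgue K) < e" if "j \<ge> n" for j
  proof -
    have "c / d < real (Suc j)" using n that by simp
    then have "c / real (Suc j) \<le> d" using d by (simp add: field_simps)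
    then have "Ks j \<subseteq> K + cball 0 d"
      by (intro order_trans[OF c(2)] set_plus_mono2) auto
    then have "measure lebesgue (Ks j) < measure lebesgue K + e" using d K by blast
    moreover have "measure lebesgue K \<le> measure lebesgue (Ks j)"
      using K by (intro measure_mono_fmeasurable) (auto simp: lmeasurable_compact intro: fmeasurableD)
    ultimately show ?thesis by simp
  qed
  then show "\<exists>n. \<forall>j\<ge>n. norm (measure lebesgue (Ks j) - measure lebesgue K) < e" by blast
qed

text \<open>Finitely many small cubes centred in \<open>K\<close> cover it, and \<open>Y\<close>
  consists of their vertices. The cubes give the hull interior points even when \<open>K\<close> is
  flat.\<close>

lemma outer_polytope:
  fixes K :: "'a::euclidean_space set"
  assumes "compact K" "convex K" "K \<noteq> {}" "e > 0"
  obtains Y where "finite Y" "interior (convex hull Y) \<noteq> {}" "K \<subseteq> convex hull Y"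
    "convex hull Y \<subseteq> K + cball 0 e"
proof -
  \<comment> \<open>With this half-side the coordinates of an offset from the centre add up to at
    most \<open>e\<close>, so each cube lies in the ball of radius \<open>e\<close>.\<close>
  define d where "d = e / DIM('a)"
  have "d > 0" using assms by (simp add: d_def)
  let ?D = "\<Sum>i\<in>Basis. d *\<^sub>R i :: 'a"
  have D: "?D \<bullet> i = d" if "i \<in> Basis" for i
    using that by (simp add: inner_sum_left inner_Basis if_distrib cong: if_cong)
  have "\<exists>S. finite S \<and> cbox (x - ?D) (x + ?D) = convex hull S" for x
    by (rule cube_convex_hull[OF \<open>d > 0\<close>, of x]) blast
  then obtain S where S: "\<And>x. finite (S x)" "\<And>x. cbox (x - ?D) (x + ?D) = convex hull S x"
    by metis
  have inbox: "x \<in> box (x - ?D) (x + ?D)" for x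
    using \<open>d > 0\<close> by (simp add: mem_box inner_diff_left inner_add_left D)
  have cb: "cbox (x - ?D) (x + ?D) \<subseteq> cball x e" for x
  proof
    fix z assume "z \<in> cbox (x - ?D) (x + ?D)"
    then have "\<bar>(z - x) \<bullet> i\<bar> \<le> d" if "i \<in> Basis" for i
      using that by (auto simp: mem_box inner_diff_left inner_add_left D abs_le_iff algebra_simps dest!: bspec)
    then have "norm (z - x) \<le> (\<Sum>i\<in>(Basis::'a set). d)"
      by (intro order_trans[OF norm_le_l1] sum_mono)
    then show "z \<in> cball x e" by (simp add: d_def dist_norm norm_minus_commute)
  qed
  obtain F where F: "F \<subseteq> K" "finite F" "K \<subseteq> (\<Union>x\<in>F. box (x - ?D) (x + ?D))"
    by (rule compactE_image[OF assms(1), of K "\<lambda>x. box (x - ?D) (x + ?D)"]) (use inbox in auto)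
  have "F \<noteq> {}" using F assms(3) by auto
  show thesis
  proof
    show "finite (\<Union>x\<in>F. S x)" using F S by auto
    have sub: "cbox (x - ?D) (x + ?D) \<subseteq> convex hull (\<Union>x\<in>F. S x)" if "x \<in> F" for x
      unfolding S(2) using that by (intro hull_mono) auto
    show "K \<subseteq> convex hull (\<Union>x\<in>F. S x)"
      by (intro order_trans[OF F(3)] UN_least order_trans[OF box_subset_cbox] sub)
    obtain x where "x \<in> F" using \<open>F \<noteq> {}\<close> by blast
    have "box (x - ?D) (x + ?D) \<subseteq> interior (convex hull (\<Union>x\<in>F. S x))"
      by (intro interior_maximal order_trans[OF box_subset_cbox sub] \<open>x \<in> F\<close> open_box)
    then show "interior (convex hull (\<Union>x\<in>F. S x)) \<noteq> {}" using inbox by blast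
    show "convex hull (\<Union>x\<in>F. S x) \<subseteq> K + cball 0 e"
    proof (rule hull_minimal)
      show "convex (K + cball 0 e)" using assms by (intro convex_set_plus) auto
      show "(\<Union>x\<in>F. S x) \<subseteq> K + cball 0 e"
      proof clarify
        fix x y assume "x \<in> F" "y \<in> S x"
        then have "y \<in> cball x e" using hull_inc[of y "S x" convex] cb[of x] unfolding S(2)[of x] by blast
        then have "x + (y - x) \<in> K + cball 0 e"
          using \<open>x \<in> F\<close> F by (intro set_plus_intro) (auto simp: dist_norm norm_minus_commute)
        then show "y \<in> K + cball 0 e" by simp
      qed
    qed
  qed
qed

section \<open>Existence of mixed volumes\<close>

text \<open>As a set, \<open>0\<close> is \<open>{0}\<close>. Including it closes the class under scaling by zero and empty sums.\<close>

definition gradient_rep0 :: "(real ^ 'n) set \<Rightarrow> (real ^ 'n \<Rightarrow> real ^ 'n ^ 'n) \<Rightarrow> bool" where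
  "gradient_rep0 K H \<longleftrightarrow> (\<exists>f g. gradient_rep K f g H) \<or> (K = 0 \<and> H = (\<lambda>_. 0))"

lemma gradient_rep0_add:
  assumes "gradient_rep0 K1 H1" "gradient_rep0 K2 H2"
  shows "gradient_rep0 (K1 + K2) (\<lambda>x. H1 x + H2 x)"
  using assms unfolding gradient_rep0_def
  by (elim disjE exE conjE) (auto dest: gradient_rep_add simp del: set_zero)

lemma gradient_rep0_scale:
  assumes "gradient_rep0 K H" "a \<ge> 0" "K \<noteq> {}"
  shows "gradient_rep0 ((*\<^sub>R) a ` K) (\<lambda>x. a *\<^sub>R H x)"
proof (cases "a = 0")
  case True
  then have "(*\<^sub>R) a ` K = 0" using assms(3) by auto
  then show ?thesis using True unfolding gradient_rep0_def by simp
next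
  case False
  then have "a > 0" using assms(2) by simp
  from assms(1) show ?thesis
    unfolding gradient_rep0_def
  proof (elim disjE exE conjE)
    fix f g assume "gradient_rep K f g H"
    from gradient_rep_scale[OF this \<open>a > 0\<close>] show "(\<exists>f g. gradient_rep ((*\<^sub>R) a ` K) f g (\<lambda>x. a *\<^sub>R H x)) \<or>
      (*\<^sub>R) a ` K = 0 \<and> (\<lambda>x. a *\<^sub>R H x) = (\<lambda>_. 0)" by blast
  qed auto
qed

lemma gradient_rep0_sum:
  assumes "finite I" "\<And>i. i \<in> I \<Longrightarrow> gradient_rep0 (K i) (H i)"
  shows "gradient_rep0 (\<Sum>i\<in>I. K i) (\<lambda>x. \<Sum>i\<in>I. H i x)"
  using assms
proof (induction I rule: finite_induct)
  case empty
  show ?case unfolding sum.empty gradient_rep0_def by blast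
next
  case (insert i I)
  then show ?case by (simp add: gradient_rep0_add)
qed

lemma gradient_rep0_measure:
  fixes K :: "(real ^ 'n::{finite,wellorder}) set"
  assumes "gradient_rep0 K H"
  shows "((\<lambda>x. det (H x)) has_integral measure lebesgue K) UNIV"
  using assms unfolding gradient_rep0_def
proof (elim disjE exE conjE)
  assume "K = 0" "H = (\<lambda>_. 0)"
  moreover have "det (0 :: ((real, 'n) vec, 'n) vec) = 0"
    by (rule det_zero_row[of undefined]) (simp add: row_def vec_eq_iff)
  ultimately show ?thesis by simp
qed (rule gradient_rep_measure)

text \<open>This is n! times the mixed volume of \<open>K 0\<close>, ..., \<open>K (n - 1)\<close>,
  where n is the dimension. Arguments form a function rather than a list, so that one of them is
  replaced by function update.\<close>

definition mixed_sum :: "(nat \<Rightarrow> 'a::euclidean_space set) \<Rightarrow> real" where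
  "mixed_sum K = polarization DIM('a) (\<lambda>S. measure lebesgue (\<Sum>k\<in>S. K k))"

lemma mixed_sum_has_integral:
  fixes K :: "nat \<Rightarrow> (real ^ 'n::{finite,wellorder}) set"
  assumes "\<And>k. k < CARD('n) \<Longrightarrow> gradient_rep0 (K k) (H k)"
  shows "((\<lambda>x. polarization CARD('n) (\<lambda>S. det (\<Sum>k\<in>S. H k x))) has_integral mixed_sum K) UNIV"
  unfolding mixed_sum_def polarization_def DIM_cart DIM_real mult_1_right
  by (intro has_integral_sum has_integral_mult_right gradient_rep0_measure gradient_rep0_sum)
    (auto intro: finite_subset assms)

text \<open>The integrand is a polarized determinant, linear at every point in the Hessian at place
  \<open>i\<close>; uniqueness of the integral transfers this to \<open>mixed_sum\<close>.\<close>

lemma mixed_sum_linear_polytope: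
  fixes K :: "nat \<Rightarrow> (real ^ 'n::{finite,wellorder}) set"
  assumes K: "\<And>k. k < CARD('n) \<Longrightarrow> gradient_rep0 (K k) (H k)"
    and A: "gradient_rep0 A HA" "A \<noteq> {}" and B: "gradient_rep0 B HB" "B \<noteq> {}"
    and i: "i < CARD('n)" and a: "a \<ge> 0" and b: "b \<ge> 0"
  shows "mixed_sum (K(i := (*\<^sub>R) a ` A + (*\<^sub>R) b ` B)) = a * mixed_sum (K(i := A)) + b * mixed_sum (K(i := B))"
proof -
  have rep: "((\<lambda>x. polarization CARD('n) (\<lambda>S. det (\<Sum>k\<in>S. ((\<lambda>k. H k x)(i := HX x)) k))) has_integral mixed_sum (K(i := X))) UNIV"
    if "gradient_rep0 X HX" for X HX
    using mixed_sum_has_integral[of "K(i := X)" "H(i := HX)"] K that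
    by (simp add: fun_upd_def if_distrib[of "\<lambda>h. h _"])
  have AB: "gradient_rep0 ((*\<^sub>R) a ` A + (*\<^sub>R) b ` B) (\<lambda>x. a *\<^sub>R HA x + b *\<^sub>R HB x)"
    using A B a b by (intro gradient_rep0_add gradient_rep0_scale)
  have "((\<lambda>x. a * polarization CARD('n) (\<lambda>S. det (\<Sum>k\<in>S. ((\<lambda>k. H k x)(i := HA x)) k)) +
        b * polarization CARD('n) (\<lambda>S. det (\<Sum>k\<in>S. ((\<lambda>k. H k x)(i := HB x)) k))) has_integral
        a * mixed_sum (K(i := A)) + b * mixed_sum (K(i := B))) UNIV"
    using rep[OF A(1)] rep[OF B(1)] by (intro has_integral_add has_integral_mult_right)
  then show ?thesis
    using rep[OF AB] unfolding polarization_det_linear[OF i] by (rule has_integral_unique[symmetric])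
qed

lemma polytope_outer_approx:
  fixes K :: "(real ^ 'n) set"
  assumes "compact_convex K"
  obtains Ks H where "outer_approx K Ks" "\<And>j. gradient_rep0 (Ks j) (H j)" "\<And>j. Ks j \<noteq> {}"
proof -
  have K: "compact K" "convex K" "K \<noteq> {}" using assms by (auto simp: compact_convex_def)
  have "\<exists>Y H. gradient_rep0 (convex hull Y) H \<and> compact (convex hull Y) \<and> K \<subseteq> convex hull Y \<and>
      convex hull Y \<subseteq> K + cball 0 (1 / real (Suc j))" for j
  proof -
    obtain Y where "finite Y" "interior (convex hull Y) \<noteq> {}" "K \<subseteq> convex hull Y"
      "convex hull Y \<subseteq> K + cball 0 (1 / real (Suc j))"
      using outer_polytope[OF K, of "1 / real (Suc j)"] by auto
    then show ?thesis
      using gradient_rep_polytope[of Y] finite_imp_compact_convex_hull unfolding gradient_rep0_def by blast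
  qed
  then obtain Y H where Y: "\<And>j. gradient_rep0 (convex hull Y j) (H j)" "\<And>j. compact (convex hull Y j)"
    "\<And>j. K \<subseteq> convex hull Y j" "\<And>j. convex hull Y j \<subseteq> K + cball 0 (1 / real (Suc j))"
    by metis
  show thesis
  proof
    show "outer_approx K (\<lambda>j. convex hull Y j)"
      unfolding outer_approx_def using Y K(1) by (intro conjI allI exI[of _ 1]) auto
    show "convex hull Y j \<noteq> {}" for j using Y(3) K(3) by blast
  qed (rule Y)
qed

lemma mixed_sum_outer_approx:
  fixes K :: "nat \<Rightarrow> 'a::euclidean_space set"
  assumes "\<And>k. k < DIM('a) \<Longrightarrow> outer_approx (K k) (\<lambda>j. Ks j k)"
  shows "(\<lambda>j. mixed_sum (Ks j)) \<longlonglongrightarrow> mixed_sum K"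
  unfolding mixed_sum_def polarization_def
  by (intro tendsto_sum tendsto_mult tendsto_const outer_approx_measure outer_approx_sum)
    (auto intro: finite_subset assms)

text \<open>Outer approximations by polytopes of all the bodies approximate the Minkowski
  combination as well, so the identity passes to the limit.\<close>

lemma mixed_sum_linear:
  fixes K :: "nat \<Rightarrow> (real ^ 'n::{finite,wellorder}) set"
  assumes K: "\<And>k. k < CARD('n) \<Longrightarrow> compact_convex (K k)"
    and A: "compact_convex A" and B: "compact_convex B"
    and i: "i < CARD('n)" and a: "a \<ge> 0" and b: "b \<ge> 0"
  shows "mixed_sum (K(i := (*\<^sub>R) a ` A + (*\<^sub>R) b ` B)) = a * mixed_sum (K(i := A)) + b * mixed_sum (K(i := B))"
proof -
  have "\<forall>k\<in>{..<CARD('n)}. \<exists>Ks H. outer_approx (K k) Ks \<and> (\<forall>j. gradient_rep0 (Ks j) (H j))"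
    using polytope_outer_approx[OF K] by (metis lessThan_iff)
  then obtain Ks H where Ks: "\<And>k. k < CARD('n) \<Longrightarrow> outer_approx (K k) (Ks k)"
    "\<And>k j. k < CARD('n) \<Longrightarrow> gradient_rep0 (Ks k j) (H k j)"
    by (subst (asm) bchoice_iff) (metis lessThan_iff)
  obtain As HA where As: "outer_approx A As" "\<And>j. gradient_rep0 (As j) (HA j)" "\<And>j. As j \<noteq> {}"
    using polytope_outer_approx[OF A] by blast
  obtain Bs HB where Bs: "outer_approx B Bs" "\<And>j. gradient_rep0 (Bs j) (HB j)" "\<And>j. Bs j \<noteq> {}"
    using polytope_outer_approx[OF B] by blast
  have lim: "(\<lambda>j. mixed_sum ((\<lambda>k. Ks k j)(i := Xs j))) \<longlonglongrightarrow> mixed_sum (K(i := X))" if "outer_approx X Xs" for X Xs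
    by (rule mixed_sum_outer_approx) (use Ks(1) that in \<open>auto simp: fun_upd_def\<close>)
  have eq: "mixed_sum ((\<lambda>k. Ks k j)(i := (*\<^sub>R) a ` As j + (*\<^sub>R) b ` Bs j)) =
      a * mixed_sum ((\<lambda>k. Ks k j)(i := As j)) + b * mixed_sum ((\<lambda>k. Ks k j)(i := Bs j))" for j
    by (rule mixed_sum_linear_polytope[OF Ks(2) As(2,3) Bs(2,3) i a b])
  have "(\<lambda>j. mixed_sum ((\<lambda>k. Ks k j)(i := (*\<^sub>R) a ` As j + (*\<^sub>R) b ` Bs j))) \<longlonglongrightarrow>
      a * mixed_sum (K(i := A)) + b * mixed_sum (K(i := B))"
    unfolding eq
    by (intro tendsto_add tendsto_mult tendsto_const lim As(1) Bs(1))
  moreover have "(\<lambda>j. mixed_sum ((\<lambda>k. Ks k j)(i := (*\<^sub>R) a ` As j + (*\<^sub>R) b ` Bs j))) \<longlonglongrightarrow>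
      mixed_sum (K(i := (*\<^sub>R) a ` A + (*\<^sub>R) b ` B))"
    by (intro lim outer_approx_add outer_approx_scale As(1) Bs(1) a b)
  ultimately show ?thesis by (rule LIMSEQ_unique[symmetric])
qed

lemma mixed_sum_permute:
  fixes K :: "nat \<Rightarrow> 'a::euclidean_space set"
  assumes "p permutes {..<DIM('a)}"
  shows "mixed_sum (\<lambda>k. K (p k)) = mixed_sum K"
proof -
  have inj: "inj_on p S" for S
    using permutes_inj[OF assms] by (rule inj_on_subset) simp
  have "mixed_sum K = (\<Sum>S\<in>(`) p ` Pow {..<DIM('a)}. (-1) ^ (DIM('a) - card S) * measure lebesgue (\<Sum>k\<in>S. K k))"
    unfolding mixed_sum_def polarization_def
    by (simp add: image_Pow_surj permutes_image[OF assms])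
  also have "\<dots> = mixed_sum (\<lambda>k. K (p k))"
    unfolding mixed_sum_def polarization_def
    using inj_on_image_Pow[OF inj]
    by (subst sum.reindex) (auto simp: card_image[OF inj] sum.reindex[OF inj] o_def)
  finally show ?thesis by simp
qed

text \<open>Convexity writes y + m z as m + 1 times a point of \<open>K\<close>; without it the sum
  can be larger than the multiple.\<close>

lemma sum_convex_const:
  fixes K :: "'a::real_vector set"
  assumes "convex K" "K \<noteq> {}" "finite S"
  shows "(\<Sum>k\<in>S. K) = (*\<^sub>R) (real (card S)) ` K"
  using assms(3)
proof (induction S rule: finite_induct)
  case empty
  then show ?case using assms(2) by (auto simp: set_zero)
next
  case (insert i S)
  have "K + (*\<^sub>R) (real (card S)) ` K = (*\<^sub>R) (1 + real (card S)) ` K"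
  proof (intro equalityI subsetI)
    fix x assume "x \<in> K + (*\<^sub>R) (real (card S)) ` K"
    then obtain y z where yz: "y \<in> K" "z \<in> K" "x = y + real (card S) *\<^sub>R z" by (auto elim!: set_plus_elim)
    let ?c = "1 + real (card S)"
    have "(1 / ?c) *\<^sub>R y + (real (card S) / ?c) *\<^sub>R z \<in> K"
      using yz by (intro convexD[OF assms(1)]) (auto simp: field_simps)
    moreover have "x = ?c *\<^sub>R ((1 / ?c) *\<^sub>R y + (real (card S) / ?c) *\<^sub>R z)"
      using yz by (simp add: scaleR_add_right)
    ultimately show "x \<in> (*\<^sub>R) ?c ` K" by blast
  next
    fix x assume "x \<in> (*\<^sub>R) (1 + real (card S)) ` K"
    then show "x \<in> K + (*\<^sub>R) (real (card S)) ` K" by (auto simp: scaleR_add_left)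
  qed
  then show ?case using insert by simp
qed

lemma mixed_sum_diag:
  fixes K :: "(real ^ 'n) set"
  assumes "compact_convex K"
  shows "mixed_sum (\<lambda>k. K) = fact CARD('n) * measure lebesgue K"
proof -
  have K: "convex K" "K \<noteq> {}" using assms by (auto simp: compact_convex_def)
  have "mixed_sum (\<lambda>k. K) = polarization CARD('n) (\<lambda>S. real (card S) ^ CARD('n) * measure lebesgue K)"
    unfolding mixed_sum_def DIM_cart DIM_real mult_1_right
  proof (rule polarization_cong)
    fix S assume "S \<subseteq> {..<CARD('n)}"
    then have "finite S" by (rule finite_subset) simp
    then show "measure lebesgue (\<Sum>k\<in>S. K) = real (card S) ^ CARD('n) * measure lebesgue K"
      using measure_lebesgue_affine[of "real (card S)" 0 K] by (simp add: sum_convex_const[OF K])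
  qed
  also have "\<dots> = fact CARD('n) * measure lebesgue K"
    using polarization_linear[of "CARD('n)" "measure lebesgue K" "\<lambda>S. real (card S) ^ CARD('n)" 0 "\<lambda>_. 0"]
    by (simp add: polarization_power_card[where 'n = 'n] mult.commute)
  finally show ?thesis .
qed

lemma mixed_volume_functional_exists_wo:
  "mixed_volume_functional (\<lambda>Ks :: (real ^ 'n::{finite,wellorder}) set list. mixed_sum ((!) Ks) / fact CARD('n))"
  unfolding mixed_volume_functional_def
proof (intro conjI allI impI; (elim conjE)?)
  fix Ks Ls :: "(real, 'n) vec set list"
  assume "length Ks = DIM((real, 'n) vec)" "mset Ls = mset Ks"
  then obtain p where p: "p permutes {..<DIM((real, 'n) vec)}" "permute_list p Ks = Ls"
    using mset_eq_permutation by metis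
  have "mixed_sum ((!) Ls) = mixed_sum (\<lambda>k. Ks ! p k)"
    unfolding mixed_sum_def p(2)[symmetric]
    by (intro polarization_cong arg_cong[where f = "measure lebesgue"] sum.cong refl)
      (use p(1) \<open>length Ks = _\<close> in \<open>auto simp: permute_list_nth\<close>)
  then show "mixed_sum ((!) Ls) / fact CARD('n) = mixed_sum ((!) Ks) / fact CARD('n)"
    using mixed_sum_permute[OF p(1), of "(!) Ks"] by simp
next
  fix Ks :: "(real, 'n) vec set list" and i and A B :: "(real, 'n) vec set" and a b :: real
  assume Ks: "length Ks = DIM((real, 'n) vec)" "\<forall>K\<in>set Ks. compact_convex K" and i: "i < DIM((real, 'n) vec)"
    and AB: "compact_convex A" "compact_convex B" "0 \<le> a" "0 \<le> b"
  have upd: "mixed_sum ((!) (Ks[i := X])) = mixed_sum (((!) Ks)(i := X))" for X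
    unfolding mixed_sum_def
    by (intro polarization_cong arg_cong[where f = "measure lebesgue"] sum.cong refl)
      (use i Ks in \<open>auto simp: nth_list_update\<close>)
  have "mixed_sum (((!) Ks)(i := (*\<^sub>R) a ` A + (*\<^sub>R) b ` B)) = a * mixed_sum (((!) Ks)(i := A)) + b * mixed_sum (((!) Ks)(i := B))"
    using Ks i AB by (intro mixed_sum_linear) auto
  then show "mixed_sum ((!) (Ks[i := (*\<^sub>R) a ` A + (*\<^sub>R) b ` B])) / fact CARD('n) =
      a * (mixed_sum ((!) (Ks[i := A])) / fact CARD('n)) + b * (mixed_sum ((!) (Ks[i := B])) / fact CARD('n))"
    unfolding upd by (simp add: add_divide_distrib)
next
  fix K :: "(real, 'n) vec set" assume "compact_convex K"
  have "mixed_sum ((!) (replicate DIM((real, 'n) vec) K)) = mixed_sum (\<lambda>k. K)"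
    unfolding mixed_sum_def
    by (intro polarization_cong arg_cong[where f = "measure lebesgue"] sum.cong refl) auto
  then show "mixed_sum ((!) (replicate DIM((real, 'n) vec) K)) / fact CARD('n) = measure lebesgue K"
    using mixed_sum_diag[OF \<open>compact_convex K\<close>] by simp
qed

text \<open>The functional is pulled back along \<open>to_wo\<close>, which preserves compact convex
  sets, Minkowski sums, multiples and volume.\<close>

lemma mixed_volume_functional_exists:
  "\<exists>V :: (real ^ 'n) set list \<Rightarrow> real. mixed_volume_functional V"
proof -
  let ?T = "(`) to_wo :: (real ^ 'n) set \<Rightarrow> (real ^ 'n wo) set"
  obtain W :: "(real ^ 'n wo) set list \<Rightarrow> real" where W: "mixed_volume_functional W"
    using mixed_volume_functional_exists_wo by blast
  have dim: "DIM(real ^ 'n wo) = DIM(real ^ 'n)" by (simp add: card_wo)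
  have cc: "compact_convex (?T K)" if "compact_convex K" for K
    using that unfolding compact_convex_def
    by (auto intro: compact_linear_image convex_linear_image linear_to_wo)
  have T_add: "?T (A + B) = ?T A + ?T B" for A B
  proof (intro equalityI subsetI)
    fix y assume "y \<in> ?T (A + B)"
    then obtain a b where "a \<in> A" "b \<in> B" "y = to_wo a + to_wo b"
      by (auto elim!: set_plus_elim simp: linear_add[OF linear_to_wo])
    then show "y \<in> ?T A + ?T B" by auto
  next
    fix y assume "y \<in> ?T A + ?T B"
    then obtain a b where "a \<in> A" "b \<in> B" "y = to_wo (a + b)"
      by (auto elim!: set_plus_elim simp: linear_add[OF linear_to_wo])
    then show "y \<in> ?T (A + B)" by auto
  qed
  have T_scale: "?T ((*\<^sub>R) a ` A) = (*\<^sub>R) a ` ?T A" for a A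
    by (simp add: image_image linear_scale[OF linear_to_wo])
  have "mixed_volume_functional (\<lambda>Ks. W (map ?T Ks))"
    unfolding mixed_volume_functional_def
  proof (intro conjI allI impI; (elim conjE)?)
    fix Ks Ls :: "(real ^ 'n) set list"
    assume "length Ks = DIM(real ^ 'n)" "\<forall>K\<in>set Ks. compact_convex K" "mset Ls = mset Ks"
    then show "W (map ?T Ls) = W (map ?T Ks)"
      using W unfolding mixed_volume_functional_def dim by (auto simp: cc)
  next
    fix Ks :: "(real ^ 'n) set list" and i and A B :: "(real ^ 'n) set" and a b :: real
    assume "length Ks = DIM(real ^ 'n)" "\<forall>K\<in>set Ks. compact_convex K" "i < DIM(real ^ 'n)"
      "compact_convex A" "compact_convex B" "0 \<le> a" "0 \<le> b"
    then show "W (map ?T (Ks[i := (*\<^sub>R) a ` A + (*\<^sub>R) b ` B])) = a * W (map ?T (Ks[i := A])) + b * W (map ?T (Ks[i := B]))"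
      using W unfolding mixed_volume_functional_def dim map_update T_add T_scale by (auto simp: cc)
  next
    fix K :: "(real ^ 'n) set" assume "compact_convex K"
    then show "W (map ?T (replicate DIM(real ^ 'n) K)) = measure lebesgue K"
      using W cc measure_to_wo_compact[of K] unfolding mixed_volume_functional_def dim map_replicate
      by (auto simp: compact_convex_def)
  qed
  then show ?thesis by blast
qed

lemma mixed_volume_functional_mixed_volume:
  "mixed_volume_functional (mixed_volume :: (real ^ 'n) set list \<Rightarrow> real)"
  unfolding mixed_volume_def using mixed_volume_functional_exists by (rule someI_ex)

section \<open>First variation of the volume\<close>

lemma compact_convex_add: "compact_convex A \<Longrightarrow> compact_convex B \<Longrightarrow> compact_convex (A + B)"
  unfolding compact_convex_def by (auto intro: compact_set_plus convex_set_plus)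

lemma compact_convex_scale: "compact_convex A \<Longrightarrow> compact_convex ((*\<^sub>R) a ` A)"
  unfolding compact_convex_def by (auto intro: compact_scaling convex_scaling)

context
  fixes V :: "'a::euclidean_space set list \<Rightarrow> real"
  assumes V: "mixed_volume_functional V"
begin

lemma mixed_volume_mset:
  assumes "length Ks = DIM('a)" "\<forall>K\<in>set Ks. compact_convex K" "mset Ls = mset Ks"
  shows "V Ls = V Ks"
  using V assms unfolding mixed_volume_functional_def by blast

lemma mixed_volume_replicate:
  "compact_convex K \<Longrightarrow> V (replicate DIM('a) K) = measure lebesgue K"
  using V unfolding mixed_volume_functional_def by blast

lemma mixed_volume_Cons:
  assumes "Suc (length L) = DIM('a)" "\<forall>K\<in>set L. compact_convex K"
    "compact_convex A" "compact_convex B" "0 \<le> b"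
  shows "V ((A + (*\<^sub>R) b ` B) # L) = V (A # L) + b * V (B # L)"
proof -
  have lin: "length Ks = DIM('a) \<and> (\<forall>K\<in>set Ks. compact_convex K) \<and> i < DIM('a) \<and>
        compact_convex A \<and> compact_convex B \<and> 0 \<le> a \<and> 0 \<le> b
        \<Longrightarrow> V (Ks[i := (*\<^sub>R) a ` A + (*\<^sub>R) b ` B]) = a * V (Ks[i := A]) + b * V (Ks[i := B])" for Ks i a
    using V unfolding mixed_volume_functional_def by blast
  have "(*\<^sub>R) 1 ` A = A" by simp
  then show ?thesis
    using lin[of "A # L" 0 1] assms by simp
qed

text \<open>Multilinearity splits one copy of \<open>K + \<epsilon> A\<close> into \<open>K\<close>
  and \<open>\<epsilon> A\<close>. The list \<open>L\<close> of frozen arguments is arbitrary so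
  that the induction can move \<open>K\<close> and \<open>A\<close> into it. The derivative is
  one-sided because Minkowski multiples are nonnegative.\<close>

lemma mixed_volume_has_derivative:
  assumes "j + length L = DIM('a)" "\<forall>K\<in>set L. compact_convex K" "compact_convex A" "compact_convex K"
  shows "((\<lambda>\<epsilon>. (V (replicate j (K + (*\<^sub>R) \<epsilon> ` A) @ L) - V (replicate j K @ L)) / \<epsilon>) \<longlongrightarrow>
      real j * V (A # replicate (j - 1) K @ L)) (at_right 0)"
  using assms(1,2)
proof (induction j arbitrary: L)
  case 0
  show ?case by simp
next
  case (Suc j)
  let ?M = "\<lambda>\<epsilon>. K + (*\<^sub>R) \<epsilon> ` A"
  have ccM: "compact_convex (?M \<epsilon>)" for \<epsilon>
    by (intro compact_convex_add compact_convex_scale assms)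
  let ?q = "\<lambda>L \<epsilon>. (V (replicate j (?M \<epsilon>) @ L) - V (replicate j K @ L)) / \<epsilon>"
  have IH: "((?q (X # L)) \<longlongrightarrow> real j * V (A # replicate (j - 1) K @ X # L)) (at_right 0)"
    if "compact_convex X" for X
    using Suc that by (intro Suc.IH) auto
  \<comment> \<open>A convergent difference quotient forces convergence of the function itself, so
    continuity comes from the induction hypothesis.\<close>
  have cont: "((\<lambda>\<epsilon>. V (replicate j (?M \<epsilon>) @ X # L)) \<longlongrightarrow> V (replicate j K @ X # L)) (at_right 0)"
    if "compact_convex X" for X
  proof -
    have "((\<lambda>\<epsilon>. ?q (X # L) \<epsilon> * \<epsilon> + V (replicate j K @ X # L)) \<longlongrightarrow>
        real j * V (A # replicate (j - 1) K @ X # L) * 0 + V (replicate j K @ X # L)) (at_right 0)"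
      by (intro tendsto_intros IH[OF that])
    moreover have "eventually (\<lambda>\<epsilon>. ?q (X # L) \<epsilon> * \<epsilon> + V (replicate j K @ X # L) = V (replicate j (?M \<epsilon>) @ X # L)) (at_right 0)"
      using eventually_at_right_less[of 0] by eventually_elim auto
    ultimately show ?thesis by (subst (asm) tendsto_cong) auto
  qed
  have step: "V (replicate (Suc j) (?M \<epsilon>) @ L) = V (replicate j (?M \<epsilon>) @ K # L) + \<epsilon> * V (replicate j (?M \<epsilon>) @ A # L)"
    if "\<epsilon> > 0" for \<epsilon>
  proof -
    have "\<forall>X\<in>set (replicate j (?M \<epsilon>) @ L). compact_convex X"
      using Suc.prems ccM by auto
    from mixed_volume_Cons[OF _ this assms(4,3), of \<epsilon>]
    have "V (replicate (Suc j) (?M \<epsilon>) @ L) = V (K # replicate j (?M \<epsilon>) @ L) + \<epsilon> * V (A # replicate j (?M \<epsilon>) @ L)"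
      using Suc.prems that by simp
    also have "V (K # replicate j (?M \<epsilon>) @ L) = V (replicate j (?M \<epsilon>) @ K # L)"
      using Suc.prems assms(3,4) ccM by (intro mixed_volume_mset) auto
    also have "V (A # replicate j (?M \<epsilon>) @ L) = V (replicate j (?M \<epsilon>) @ A # L)"
      using Suc.prems assms(3,4) ccM by (intro mixed_volume_mset) auto
    finally show ?thesis .
  qed
  have K: "V (replicate (Suc j) K @ L) = V (replicate j K @ K # L)"
    using Suc.prems assms(3,4) by (intro mixed_volume_mset) auto
  have "((\<lambda>\<epsilon>. ?q (K # L) \<epsilon> + V (replicate j (?M \<epsilon>) @ A # L)) \<longlongrightarrow>
      real j * V (A # replicate (j - 1) K @ K # L) + V (replicate j K @ A # L)) (at_right 0)"
    by (intro tendsto_add IH cont assms)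
  also have "V (replicate j K @ A # L) = V (A # replicate j K @ L)"
    using Suc.prems assms(3,4) by (intro mixed_volume_mset) auto
  \<comment> \<open>For \<open>j = 0\<close> the truncated \<open>j - 1\<close> leaves lists of
    different lengths; the factor \<open>real j\<close> makes both sides zero.\<close>
  also have "real j * V (A # replicate (j - 1) K @ K # L) = real j * V (A # replicate j K @ L)"
  proof (cases j)
    case (Suc i)
    then have "V (A # replicate (j - 1) K @ K # L) = V (A # replicate j K @ L)"
      using Suc.prems assms(3,4) by (intro mixed_volume_mset) auto
    then show ?thesis by simp
  qed simp
  finally have "((\<lambda>\<epsilon>. ?q (K # L) \<epsilon> + V (replicate j (?M \<epsilon>) @ A # L)) \<longlongrightarrow>
      real (Suc j) * V (A # replicate (Suc j - 1) K @ L)) (at_right 0)"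
    by (simp add: algebra_simps)
  moreover have "eventually (\<lambda>\<epsilon>. ?q (K # L) \<epsilon> + V (replicate j (?M \<epsilon>) @ A # L) =
      (V (replicate (Suc j) (?M \<epsilon>) @ L) - V (replicate (Suc j) K @ L)) / \<epsilon>) (at_right 0)"
    using eventually_at_right_less[of 0]
    by eventually_elim (simp only: step K, simp add: field_simps)
  ultimately show ?case by (subst (asm) tendsto_cong)
qed

lemma mixed_volume_first_variation:
  assumes "compact_convex A" "compact_convex K"
  shows "((\<lambda>\<epsilon>. (measure lebesgue (K + (*\<^sub>R) \<epsilon> ` A) - measure lebesgue K) / \<epsilon>) \<longlongrightarrow>
      real DIM('a) * V (A # replicate (DIM('a) - 1) K)) (at_right 0)"
  using mixed_volume_has_derivative[of "DIM('a)" "[]" A K] assms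
  by (simp add: mixed_volume_replicate compact_convex_add compact_convex_scale)

text \<open>The volume of \<open>M + [0, t v]\<close> is affine in t: what is added between s and s
  + t is a translate of what is added between 0 and t. Its derivative at 0 is thus equal to any
  difference quotient. The length \<open>k\<close> stays free because later arguments take it
  large.\<close>

lemma mixed_volume_segment:
  fixes v :: 'a
  assumes M: "compact_convex M" and "k > 0"
  shows "real DIM('a) * V (closed_segment 0 v # replicate (DIM('a) - 1) M) =
    (measure lebesgue (M + closed_segment 0 (real k *\<^sub>R v)) - measure lebesgue M) / real k"
proof -
  define \<phi> where "\<phi> t = measure lebesgue (M + closed_segment 0 (t *\<^sub>R v))" for t
  have seg: "closed_segment 0 (t *\<^sub>R v) = (*\<^sub>R) t ` closed_segment 0 v" for t
    using closed_segment_linear_image[of "(*\<^sub>R) t" 0 v] by (simp add: linear_scaleR)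
  have I: "compact_convex (closed_segment 0 v)" by (simp add: compact_convex_def)
  have cM: "compact (M + closed_segment 0 (t *\<^sub>R v))" for t
    using M by (intro compact_set_plus) (auto simp: compact_convex_def)
  have mem: "z \<in> M + closed_segment 0 (t *\<^sub>R v) \<longleftrightarrow> (\<exists>m\<in>M. \<exists>s. 0 \<le> s \<and> s \<le> t \<and> z = m + s *\<^sub>R v)" if "t \<ge> 0" for z t
  proof -
    have "closed_segment 0 (t *\<^sub>R v) = {s *\<^sub>R v | s. 0 \<le> s \<and> s \<le> t}"
    proof (intro equalityI subsetI)
      fix z assume "z \<in> closed_segment 0 (t *\<^sub>R v)"
      then obtain u where "0 \<le> u" "u \<le> 1" "z = (u * t) *\<^sub>R v" by (auto simp: in_segment)
      then show "z \<in> {s *\<^sub>R v | s. 0 \<le> s \<and> s \<le> t}" using that by (auto intro!: exI[of _ "u * t"] mult_left_le_one_le)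
    next
      fix z assume "z \<in> {s *\<^sub>R v | s. 0 \<le> s \<and> s \<le> t}"
      then obtain s where s: "0 \<le> s" "s \<le> t" "z = s *\<^sub>R v" by blast
      then show "z \<in> closed_segment 0 (t *\<^sub>R v)"
        by (cases "t = 0") (auto simp: in_segment intro!: exI[of _ "s / t"])
    qed
    then show ?thesis by (auto simp: set_plus_def)
  qed
  have add: "\<phi> (s + t) - \<phi> s = \<phi> t - \<phi> 0" if st: "s \<ge> 0" "t \<ge> 0" for s t
  proof -
    let ?S = "\<lambda>t. M + closed_segment 0 (t *\<^sub>R v)"
    have mono: "?S s \<subseteq> ?S (s + t)" "?S 0 \<subseteq> ?S t"
      using st by (auto simp: mem) force+
    have meas: "?S t \<in> lmeasurable" for t using cM by (simp add: lmeasurable_compact)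
    have "?S (s + t) - ?S s = (+) (s *\<^sub>R v) ` (?S t - ?S 0)"
    proof (intro equalityI subsetI)
      fix z assume "z \<in> ?S (s + t) - ?S s"
      then obtain m r where m: "m \<in> M" "0 \<le> r" "r \<le> s + t" "z = m + r *\<^sub>R v" and z: "z \<notin> ?S s"
        using st by (auto simp: mem)
      have "r > s"
      proof (rule ccontr)
        assume "\<not> r > s"
        then have "z \<in> ?S s" using m st by (auto simp: mem intro!: bexI[of _ m] exI[of _ r])
        then show False using z by simp
      qed
      have "z - s *\<^sub>R v \<in> ?S t"
        using st m \<open>r > s\<close> by (auto simp: mem algebra_simps intro!: bexI[of _ m] exI[of _ "r - s"])
      moreover have "z - s *\<^sub>R v \<notin> ?S 0"
      proof
        assume "z - s *\<^sub>R v \<in> ?S 0"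
        then have "z - s *\<^sub>R v \<in> M" by (auto simp: mem)
        then have "z \<in> ?S s" using st by (auto simp: mem intro!: bexI[of _ "z - s *\<^sub>R v"] exI[of _ s])
        then show False using z by simp
      qed
      ultimately show "z \<in> (+) (s *\<^sub>R v) ` (?S t - ?S 0)"
        by (intro image_eqI[of _ _ "z - s *\<^sub>R v"]) auto
    next
      fix z assume "z \<in> (+) (s *\<^sub>R v) ` (?S t - ?S 0)"
      then obtain m r where m: "m \<in> M" "0 \<le> r" "r \<le> t" "z = s *\<^sub>R v + (m + r *\<^sub>R v)" and nz: "m + r *\<^sub>R v \<notin> M"
        using st by (auto simp: mem)
      have "\<exists>m\<in>M. \<exists>r'. 0 \<le> r' \<and> r' \<le> s + t \<and> z = m + r' *\<^sub>R v"
        using st m by (intro bexI[of _ m] exI[of _ "r + s"]) (auto simp: scaleR_add_left)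
      then have "z \<in> ?S (s + t)"
        using st by (subst mem) auto
      moreover have "z \<notin> ?S s"
      proof
        assume "z \<in> ?S s"
        then obtain m' r' where m': "m' \<in> M" "0 \<le> r'" "r' \<le> s" "z = m' + r' *\<^sub>R v"
          using st by (auto simp: mem)
        \<comment> \<open>\<open>m'\<close> lies on the line through \<open>m\<close> in the
          direction \<open>v\<close>, and \<open>d \<ge> r\<close> because
          \<open>r' \<le> s\<close>. Hence \<open>m + r v\<close> lies between \<open>m\<close> and
          \<open>m'\<close> and would belong to \<open>M\<close>.\<close>
        define d where "d = s + r - r'"
        have m'_eq: "m' = m + d *\<^sub>R v" using m m' by (simp add: d_def algebra_simps)
        have "d \<noteq> 0"
        proof
          assume "d = 0"
          then have "r = 0" using m(2) m'(3) by (simp add: d_def)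
          then show False using nz m(1) by simp
        qed
        then have "m + r *\<^sub>R v = (1 - r / d) *\<^sub>R m + (r / d) *\<^sub>R m'"
          unfolding m'_eq by (simp add: algebra_simps)
        moreover have "r / d \<le> 1" "0 \<le> r / d"
          using m m' by (auto simp: d_def divide_le_eq_1)
        ultimately have "m + r *\<^sub>R v \<in> M"
          using M m(1) m'(1) convexD[of M m m' "1 - r / d" "r / d"]
          by (auto simp: compact_convex_def)
        then show False using nz by simp
      qed
      ultimately show "z \<in> ?S (s + t) - ?S s" by simp
    qed
    then have "measure lebesgue (?S (s + t) - ?S s) = measure lebesgue (?S t - ?S 0)"
      by (simp add: measure_translation)
    then show ?thesis
      using measurable_measure_Diff[OF meas fmeasurableD[OF meas] mono(1)]
        measurable_measure_Diff[OF meas fmeasurableD[OF meas] mono(2)] by (simp add: \<phi>_def)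
  qed
  \<comment> \<open>Integer multiples suffice: the limit at 0 is taken along
    \<open>k / (m + 1)\<close>, where the difference quotient is constant.\<close>
  have mult: "\<phi> (real m * t) - \<phi> 0 = real m * (\<phi> t - \<phi> 0)" if "t \<ge> 0" for m t
  proof (induction m)
    case (Suc m)
    then show ?case using add[of "real m * t" t] that by (simp add: algebra_simps)
  qed simp
  have "((\<lambda>\<epsilon>. (\<phi> \<epsilon> - \<phi> 0) / \<epsilon>) \<longlongrightarrow> real DIM('a) * V (closed_segment 0 v # replicate (DIM('a) - 1) M)) (at_right 0)"
    using mixed_volume_first_variation[OF I M] by (simp add: \<phi>_def seg image_constant_conv)
  moreover have "filterlim (\<lambda>m. real k / real (Suc m)) (at_right 0) sequentially"
    using \<open>k > 0\<close> tendsto_mult_right_zero[OF LIMSEQ_inverse_real_of_nat, of "real k"]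
    by (simp add: filterlim_at divide_inverse)
  ultimately have "((\<lambda>m. (\<phi> (real k / real (Suc m)) - \<phi> 0) / (real k / real (Suc m))) \<longlonglongrightarrow>
      real DIM('a) * V (closed_segment 0 v # replicate (DIM('a) - 1) M))"
    by (rule filterlim_compose)
  moreover have "(\<phi> (real k / real (Suc m)) - \<phi> 0) / (real k / real (Suc m)) = (\<phi> (real k) - \<phi> 0) / real k" for m
  proof -
    have "\<phi> (real k) - \<phi> 0 = real (Suc m) * (\<phi> (real k / real (Suc m)) - \<phi> 0)"
      using mult[of "real k / real (Suc m)" "Suc m"] by simp
    then show ?thesis by (simp del: of_nat_Suc add: mult.commute)
  qed
  ultimately have "(\<lambda>m. (\<phi> (real k) - \<phi> 0) / real k) \<longlonglongrightarrow>
      real DIM('a) * V (closed_segment 0 v # replicate (DIM('a) - 1) M)" by (simp only:)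
  then show ?thesis
    using LIMSEQ_unique[OF _ tendsto_const] by (simp add: \<phi>_def)
qed

end

section \<open>Singular boundary points\<close>

lemma hausdorff_content_le:
  assumes "E \<subseteq> (\<Union>i. C i)" "\<And>i. bounded (C i)" "\<And>i. diameter (C i) \<le> \<delta>"
  shows "hausdorff_content d \<delta> E \<le> (\<Sum>i. hausdorff_weight d (C i))"
  unfolding hausdorff_content_def using assms by (intro INF_lower) auto

lemma hausdorff_content_mono:
  "E \<subseteq> F \<Longrightarrow> hausdorff_content d \<delta> E \<le> hausdorff_content d \<delta> F"
  unfolding hausdorff_content_def by (rule INF_superset_mono) auto

text \<open>The \<open>k\<close>-th set is covered at cost less than \<open>e / 2 ^ (k + 1)\<close>
  and the covers are merged by a pairing function. The gauge \<open>\<delta>\<close> is fixed: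
  nullity is shown for each content, and the supremum over \<open>\<delta>\<close> is taken only at
  the end.\<close>

lemma hausdorff_content_UN_null:
  fixes E :: "nat \<Rightarrow> 'a::metric_space set"
  assumes "\<And>k. hausdorff_content d \<delta> (E k) = 0"
  shows "hausdorff_content d \<delta> (\<Union>k. E k) = 0"
proof -
  have eps: "hausdorff_content d \<delta> (\<Union>k. E k) \<le> 0 + ennreal e" if "e > 0" for e
  proof -
    have "\<exists>C. E k \<subseteq> (\<Union>i. C i) \<and> (\<forall>i. bounded (C i) \<and> diameter (C i) \<le> \<delta>) \<and>
        (\<Sum>i. hausdorff_weight d (C i)) < ennreal (e * (1/2) ^ Suc k)" for k
    proof -
      have "hausdorff_content d \<delta> (E k) < ennreal (e * (1/2) ^ Suc k)"
        using assms that by simp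
      then show ?thesis unfolding hausdorff_content_def INF_less_iff by auto
    qed
    then obtain C where C: "\<And>k. E k \<subseteq> (\<Union>i. C k i)" "\<And>k i. bounded (C k i)" "\<And>k i. diameter (C k i) \<le> \<delta>"
      "\<And>k. (\<Sum>i. hausdorff_weight d (C k i)) < ennreal (e * (1/2) ^ Suc k)"
      by metis
    define C' where "C' n = (case prod_decode n of (k, i) \<Rightarrow> C k i)" for n
    have "(\<Union>k. E k) \<subseteq> (\<Union>n. C' n)"
    proof
      fix x assume "x \<in> (\<Union>k. E k)"
      then obtain k i where "x \<in> C k i" using C(1) by blast
      then have "x \<in> C' (prod_encode (k, i))" by (simp add: C'_def)
      then show "x \<in> (\<Union>n. C' n)" by blast
    qed
    then have "hausdorff_content d \<delta> (\<Union>k. E k) \<le> (\<Sum>n. hausdorff_weight d (C' n))"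
      by (rule hausdorff_content_le) (auto simp: C'_def C split: prod.split)
    also have "\<dots> = (\<Sum>n. (\<lambda>(k, i). hausdorff_weight d (C k i)) (prod_decode n))"
      by (simp add: C'_def case_prod_beta)
    also have "\<dots> = (\<Sum>k. \<Sum>i. hausdorff_weight d (C k i))"
      by (rule suminf_ennreal_2dimen) simp
    also have "\<dots> \<le> (\<Sum>k. ennreal (e * (1/2) ^ Suc k))"
      using C(4) by (intro suminf_le) (auto simp: less_imp_le)
    also have "\<dots> = ennreal e"
    proof -
      have "(\<lambda>k. e * (1/2) ^ Suc k) sums (e * 1)"
        by (intro sums_mult power_half_series)
      then show ?thesis using that by (intro suminf_ennreal_eq) auto
    qed
    finally show ?thesis by simp
  qed
  have "hausdorff_content d \<delta> (\<Union>k. E k) \<le> 0"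
    by (rule ennreal_le_epsilon) (rule eps)
  then show ?thesis by simp
qed

lemma hausdorff_content_countable_UN_null:
  assumes "countable I" "\<And>i. i \<in> I \<Longrightarrow> hausdorff_content d \<delta> (E i) = 0" "\<delta> \<ge> 0"
  shows "hausdorff_content d \<delta> (\<Union>i\<in>I. E i) = 0"
proof (cases "I = {}")
  case True
  have "hausdorff_content d \<delta> ({} :: 'b set) \<le> (\<Sum>i. hausdorff_weight d ({} :: 'b set))"
    using assms(3) by (intro hausdorff_content_le) auto
  then show ?thesis using True by (simp add: hausdorff_weight_def)
next
  case False
  have "(\<Union>i\<in>I. E i) = (\<Union>i\<in>range (from_nat_into I). E i)"
    unfolding range_from_nat_into[OF False assms(1)] ..
  also have "\<dots> = (\<Union>k. E (from_nat_into I k))" by simp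
  finally show ?thesis
    using hausdorff_content_UN_null[of d \<delta> "\<lambda>k. E (from_nat_into I k)"] assms(2) from_nat_into[OF False]
    by simp
qed

lemma hausdorff_content_le_finite:
  assumes "finite I" "E \<subseteq> (\<Union>i\<in>I. C i)" "\<And>i. i \<in> I \<Longrightarrow> bounded (C i)"
    "\<And>i. i \<in> I \<Longrightarrow> diameter (C i) \<le> \<delta>" "\<delta> \<ge> 0"
  shows "hausdorff_content d \<delta> E \<le> (\<Sum>i\<in>I. hausdorff_weight d (C i))"
proof -
  obtain h where h: "bij_betw h {0..<card I} I" using ex_bij_betw_nat_finite[OF assms(1)] by blast
  \<comment> \<open>The cover is padded with empty sets, whose weight is 0 also for
    \<open>d = 0\<close>.\<close>
  define C' where "C' n = (if n < card I then C (h n) else {})" for n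
  have hI: "h n \<in> I" if "n < card I" for n using h that by (auto simp: bij_betw_def)
  have "E \<subseteq> (\<Union>n. C' n)"
  proof
    fix x assume "x \<in> E"
    then obtain i where i: "i \<in> I" "x \<in> C i" using assms by blast
    then have "i \<in> h ` {0..<card I}" using h by (simp add: bij_betw_def)
    then obtain n where "n < card I" "h n = i" by auto
    then have "x \<in> C' n" using i by (simp add: C'_def)
    then show "x \<in> (\<Union>n. C' n)" by blast
  qed
  then have "hausdorff_content d \<delta> E \<le> (\<Sum>n. hausdorff_weight d (C' n))"
    by (rule hausdorff_content_le) (auto simp: C'_def hI assms)
  also have "\<dots> = (\<Sum>n\<in>{0..<card I}. hausdorff_weight d (C' n))"
    by (rule suminf_finite) (auto simp: C'_def hausdorff_weight_def)
  also have "\<dots> = (\<Sum>n\<in>{0..<card I}. hausdorff_weight d (C (h n)))"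
    by (intro sum.cong) (auto simp: C'_def)
  also have "\<dots> = (\<Sum>i\<in>I. hausdorff_weight d (C i))"
    by (rule sum.reindex_bij_betw[OF h])
  finally show ?thesis .
qed

text \<open>The piece has dimension n - 2. A grid of \<open>N ^ (n - 2)\<close> cells of side
  \<open>s = 2 * m / N\<close> covers it, the images of the cells have diameter at most
  \<open>n * s\<close>, and each has weight of order 1 / N^(n-1). The total is at most
  \<open>c / N\<close>.\<close>

lemma hausdorff_content_lipschitz_flat_cube:
  fixes p :: "'a::euclidean_space \<Rightarrow> 'b::real_normed_vector"
  assumes p: "\<And>x y. dist (p x) (p y) \<le> dist x y"
    and ij: "i \<in> Basis" "j \<in> Basis" "i \<noteq> j" and "m > 0" "\<delta> > 0"
  shows "hausdorff_content (DIM('a) - 1) \<delta> (p ` {z. z \<bullet> i = q \<and> z \<bullet> j = r \<and> (\<forall>b\<in>Basis. \<bar>z \<bullet> b\<bar> \<le> m)}) = 0"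
    (is "hausdorff_content ?d \<delta> (p ` ?E) = 0")
proof -
  let ?B = "Basis - {i, j}"
  define n where "n = DIM('a)"
  have cardB: "card ?B = n - 2"
    using ij by (simp add: n_def card_Diff_subset)
  have "card {i, j} \<le> n" unfolding n_def using ij by (intro card_mono) auto
  then have "n \<ge> 2" using ij by simp
  define c where "c = unit_ball_vol (real (n - 1)) * (real n * m) ^ (n - 1)"
  have "c \<ge> 0" using \<open>m > 0\<close> by (simp add: c_def)
  have bound: "hausdorff_content ?d \<delta> (p ` ?E) \<le> ennreal (c / real N)"
    if N: "N > 0" "2 * real n * m / real N \<le> \<delta>" for N :: nat
  proof -
    define s where "s = 2 * m / real N"
    have "s > 0" using N \<open>m > 0\<close> by (simp add: s_def)
    define Q where "Q \<phi> = {z \<in> ?E. \<forall>b\<in>?B. - m + s * real (\<phi> b) \<le> z \<bullet> b \<and> z \<bullet> b \<le> - m + s * (real (\<phi> b) + 1)}" for \<phi> :: "'a \<Rightarrow> nat"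
    let ?\<Phi> = "?B \<rightarrow>\<^sub>E {..<N}"
    have fin: "finite ?\<Phi>" by (simp add: finite_PiE)
    have diamQ: "dist (p x) (p y) \<le> real n * s" if "x \<in> Q \<phi>" "y \<in> Q \<phi>" for x y \<phi>
    proof -
      have "\<bar>(x - y) \<bullet> b\<bar> \<le> s" if b: "b \<in> Basis" for b
      proof (cases "b \<in> ?B")
        case True
        then have "- m + s * real (\<phi> b) \<le> x \<bullet> b" "x \<bullet> b \<le> - m + s * (real (\<phi> b) + 1)"
          "- m + s * real (\<phi> b) \<le> y \<bullet> b" "y \<bullet> b \<le> - m + s * (real (\<phi> b) + 1)"
          using \<open>x \<in> Q \<phi>\<close> \<open>y \<in> Q \<phi>\<close> by (auto simp: Q_def)
        then show ?thesis by (simp add: inner_diff_left algebra_simps abs_le_iff)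
      next
        case False
        then have "(x - y) \<bullet> b = 0" using \<open>x \<in> Q \<phi>\<close> \<open>y \<in> Q \<phi>\<close> b by (auto simp: Q_def inner_diff_left)
        then show ?thesis using \<open>s > 0\<close> by simp
      qed
      then have "norm (x - y) \<le> (\<Sum>b\<in>(Basis :: 'a set). s)"
        by (intro order_trans[OF norm_le_l1] sum_mono)
      then show ?thesis using p[of x y] by (simp add: dist_norm n_def)
    qed
    have bddQ: "bounded (p ` Q \<phi>)" for \<phi>
    proof (cases "Q \<phi> = {}")
      case False
      then obtain x where "x \<in> Q \<phi>" by blast
      then have "\<forall>y\<in>p ` Q \<phi>. dist (p x) y \<le> real n * s" using diamQ by blast
      then show ?thesis unfolding bounded_def by blast
    qed simp
    have dQ: "diameter (p ` Q \<phi>) \<le> real n * s" for \<phi>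
      using diamQ[of _ \<phi>] \<open>s > 0\<close> by (intro diameter_le) (auto simp: dist_norm)
    have "p ` ?E \<subseteq> (\<Union>\<phi>\<in>?\<Phi>. p ` Q \<phi>)"
    proof (rule image_subsetI)
      fix z assume z: "z \<in> ?E"
      define k where "k b = nat \<lfloor>(z \<bullet> b + m) / s\<rfloor>" for b
      \<comment> \<open>Where \<open>z \<bullet> b = m\<close> the floor is \<open>N\<close>, one
        past the last cell; the minimum assigns such points to the cell
        \<open>N - 1\<close>.\<close>
      define \<phi> where "\<phi> = (\<lambda>b\<in>?B. min (N - 1) (k b))"
      have "- m + s * real (\<phi> b) \<le> z \<bullet> b \<and> z \<bullet> b \<le> - m + s * (real (\<phi> b) + 1)" if b: "b \<in> ?B" for b
      proof -
        have zb: "- m \<le> z \<bullet> b" "z \<bullet> b \<le> m" using z b by (auto simp: abs_le_iff)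
        then have "0 \<le> (z \<bullet> b + m) / s" using \<open>s > 0\<close> by simp
        then have k: "real (k b) \<le> (z \<bullet> b + m) / s" "(z \<bullet> b + m) / s < real (k b) + 1"
          unfolding k_def by linarith+
        have k': "s * real (k b) \<le> z \<bullet> b + m" "z \<bullet> b + m \<le> s * (real (k b) + 1)"
          using k \<open>s > 0\<close> by (simp_all add: field_simps)
        have "\<phi> b = min (N - 1) (k b)" using b by (simp add: \<phi>_def)
        then consider "\<phi> b = k b" | "\<phi> b = N - 1" "N - 1 \<le> k b" by (auto simp: min_def split: if_splits)
        then show ?thesis
        proof cases
          case 1
          then show ?thesis using k' by simp
        next
          case 2
          have "s * real (N - 1) \<le> s * real (k b)" using 2 \<open>s > 0\<close> by simp
          moreover have "s * (real (N - 1) + 1) = 2 * m" using N by (simp add: s_def of_nat_diff)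
          ultimately show ?thesis using 2 k' zb by simp
        qed
      qed
      then have "z \<in> Q \<phi>" using z by (simp add: Q_def)
      moreover have "\<phi> \<in> ?\<Phi>" using N by (auto simp: \<phi>_def)
      ultimately show "p z \<in> (\<Union>\<phi>\<in>?\<Phi>. p ` Q \<phi>)" by blast
    qed
    then have "hausdorff_content ?d \<delta> (p ` ?E) \<le> (\<Sum>\<phi>\<in>?\<Phi>. hausdorff_weight ?d (p ` Q \<phi>))"
      using bddQ \<open>\<delta> > 0\<close> N(2) by (intro hausdorff_content_le_finite fin order_trans[OF dQ]) (auto simp: s_def mult_ac)
    also have "\<dots> \<le> (\<Sum>\<phi>\<in>?\<Phi>. ennreal (unit_ball_vol (real (n - 1)) * (real n * s / 2) ^ (n - 1)))"
    proof (rule sum_mono)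
      fix \<phi>
      have "0 \<le> diameter (p ` Q \<phi>)" by (rule diameter_ge_0[OF bddQ])
      then have "(diameter (p ` Q \<phi>) / 2) ^ (n - 1) \<le> (real n * s / 2) ^ (n - 1)"
        using dQ[of \<phi>] by (intro power_mono) auto
      then show "hausdorff_weight ?d (p ` Q \<phi>) \<le> ennreal (unit_ball_vol (real (n - 1)) * (real n * s / 2) ^ (n - 1))"
        by (auto simp: hausdorff_weight_def n_def intro!: ennreal_leI mult_left_mono)
    qed
    also have "\<dots> = ennreal (real (N ^ (n - 2)) * (unit_ball_vol (real (n - 1)) * (real n * s / 2) ^ (n - 1)))"
      using \<open>s > 0\<close> cardB by (simp add: card_PiE ennreal_mult' ennreal_of_nat_eq_real_of_nat)
    also have "real (N ^ (n - 2)) * (unit_ball_vol (real (n - 1)) * (real n * s / 2) ^ (n - 1)) = c / real N"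
    proof -
      have "n - 1 = Suc (n - 2)" using \<open>n \<ge> 2\<close> by simp
      then show ?thesis
        using N unfolding c_def s_def by (simp add: field_simps power_mult_distrib power_divide)
    qed
    finally show ?thesis .
  qed
  have eps: "hausdorff_content ?d \<delta> (p ` ?E) \<le> 0 + ennreal e" if "e > 0" for e
  proof -
    obtain N :: nat where N: "max (2 * real n * m / \<delta>) (c / e) < real N" using reals_Archimedean2 by blast
    have "0 \<le> c / e" using \<open>c \<ge> 0\<close> that by simp
    then have "real N > 0" using N by linarith
    have "hausdorff_content ?d \<delta> (p ` ?E) \<le> ennreal (c / real N)"
      using N \<open>real N > 0\<close> \<open>\<delta> > 0\<close> by (intro bound) (auto simp: field_simps)
    also have "\<dots> \<le> ennreal e" using N \<open>real N > 0\<close> that by (intro ennreal_leI) (auto simp: field_simps)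
    finally show ?thesis by simp
  qed
  have "hausdorff_content ?d \<delta> (p ` ?E) \<le> 0"
    by (rule ennreal_le_epsilon) (rule eps)
  then show ?thesis by simp
qed

lemma hausdorff_content_lipschitz_flat:
  fixes p :: "'a::euclidean_space \<Rightarrow> 'b::real_normed_vector"
  assumes p: "\<And>x y. dist (p x) (p y) \<le> dist x y"
    and ij: "i \<in> Basis" "j \<in> Basis" "i \<noteq> j" and "\<delta> > 0"
  shows "hausdorff_content (DIM('a) - 1) \<delta> (p ` {z. z \<bullet> i = q \<and> z \<bullet> j = r}) = 0"
proof -
  let ?E = "\<lambda>m. {z. z \<bullet> i = q \<and> z \<bullet> j = r \<and> (\<forall>b\<in>Basis. \<bar>z \<bullet> b\<bar> \<le> real (Suc m))}"
  have "{z. z \<bullet> i = q \<and> z \<bullet> j = r} \<subseteq> (\<Union>m. ?E m)"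
  proof
    fix z assume z: "z \<in> {z. z \<bullet> i = q \<and> z \<bullet> j = r}"
    obtain m :: nat where "norm z < real m" using reals_Archimedean2 by blast
    then have "\<bar>z \<bullet> b\<bar> \<le> real (Suc m)" if "b \<in> Basis" for b
      using Basis_le_norm[OF that, of z] by simp
    then show "z \<in> (\<Union>m. ?E m)" using z by blast
  qed
  then have "hausdorff_content (DIM('a) - 1) \<delta> (p ` {z. z \<bullet> i = q \<and> z \<bullet> j = r}) \<le>
      hausdorff_content (DIM('a) - 1) \<delta> (\<Union>m. p ` ?E m)"
    by (intro hausdorff_content_mono) blast
  also have "\<dots> = 0"
    by (intro hausdorff_content_UN_null hausdorff_content_lipschitz_flat_cube p ij \<open>\<delta> > 0\<close>) simp
  finally show ?thesis by simp
qed

section \<open>Points with two outer unit normals\<close>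

definition singular_points :: "'a::euclidean_space set \<Rightarrow> 'a set" where
  "singular_points K = {x. \<exists>u w. norm u = 1 \<and> norm w = 1 \<and> u \<noteq> w \<and> x \<in> support_set K u \<and> x \<in> support_set K w}"

lemma support_set_iff:
  assumes "compact K"
  shows "x \<in> support_set K u \<longleftrightarrow> x \<in> K \<and> (\<forall>y\<in>K. y \<bullet> u \<le> x \<bullet> u)"
proof -
  have "bdd_above ((\<lambda>y. y \<bullet> u) ` K)"
    using assms by (intro bounded_imp_bdd_above compact_imp_bounded compact_continuous_image continuous_intros)
  then have le: "y \<bullet> u \<le> support_function K u" if "y \<in> K" for y
    unfolding support_function_def using that by (intro cSUP_upper)
  show ?thesis
  proof
    assume "x \<in> K \<and> (\<forall>y\<in>K. y \<bullet> u \<le> x \<bullet> u)"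
    then have "support_function K u \<le> x \<bullet> u" unfolding support_function_def by (intro cSUP_least) auto
    then show "x \<in> support_set K u"
      using le \<open>x \<in> K \<and> _\<close> unfolding support_set_def by force
  qed (use le in \<open>auto simp: support_set_def\<close>)
qed

lemma rational_in_open:
  assumes "open A" "(a::real) \<in> A"
  shows "\<exists>q\<in>\<rat>. q \<in> A"
proof -
  obtain e where e: "e > 0" "ball a e \<subseteq> A" using assms openE by blast
  obtain q where "q \<in> \<rat>" "a < q" "q < a + e" using Rats_dense_in_real[of a "a + e"] e by auto
  then have "q \<in> ball a e" by (simp add: dist_real_def)
  then show ?thesis using e \<open>q \<in> \<rat>\<close> by blast
qed

text \<open>If all these minors vanish, \<open>w\<close> is a multiple of \<open>u\<close>, and the
  unit length leaves only \<open>u\<close> and \<open>- u\<close>.\<close>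

lemma unit_vectors_minor:
  fixes u w :: "'a::euclidean_space"
  assumes "norm u = 1" "norm w = 1" "u \<noteq> w" "u \<noteq> - w"
  shows "\<exists>i\<in>Basis. \<exists>j\<in>Basis. (u \<bullet> i) * (w \<bullet> j) - (u \<bullet> j) * (w \<bullet> i) \<noteq> 0"
proof (rule ccontr)
  assume "\<not> ?thesis"
  then have minor: "(u \<bullet> i) * (w \<bullet> j) = (u \<bullet> j) * (w \<bullet> i)" if "i \<in> Basis" "j \<in> Basis" for i j
    using that by auto
  have "u \<noteq> 0" using assms by auto
  then obtain i where i: "i \<in> Basis" "u \<bullet> i \<noteq> 0" using euclidean_all_zero_iff by blast
  define c where "c = (w \<bullet> i) / (u \<bullet> i)"
  have "w = c *\<^sub>R u"
    by (rule euclidean_eqI) (use minor[OF i(1)] i(2) in \<open>simp add: c_def field_simps\<close>)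
  moreover have "\<bar>c\<bar> = 1" using assms(1,2) calculation by simp
  ultimately show False using assms(3,4) by (auto simp: abs_if split: if_splits)
qed

text \<open>Every x + \<alpha> u + \<beta> w with positive \<alpha> and \<beta> has x as its nearest
  point in K. Two coordinates in which u and w have a nonzero minor map these points onto an open
  set of the plane, so some of them have both coordinates rational.\<close>

lemma singular_points_subset:
  fixes K :: "'a::euclidean_space set"
  assumes "convex_body K" "x \<in> singular_points K"
  obtains i j q r where "i \<in> Basis" "j \<in> Basis" "i \<noteq> j" "q \<in> \<rat>" "r \<in> \<rat>"
    "x \<in> closest_point K ` {z. z \<bullet> i = q \<and> z \<bullet> j = r}"
proof -
  have K: "compact K" "convex K" "interior K \<noteq> {}" using assms by (auto simp: convex_body_def)
  obtain u w where uw: "norm u = 1" "norm w = 1" "u \<noteq> w" and x: "x \<in> K"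
    and xu: "\<And>y. y \<in> K \<Longrightarrow> y \<bullet> u \<le> x \<bullet> u" and xw: "\<And>y. y \<in> K \<Longrightarrow> y \<bullet> w \<le> x \<bullet> w"
    using assms(2) K(1) unfolding singular_points_def by (auto simp: support_set_iff)
  \<comment> \<open>Opposite normals would confine \<open>K\<close> to a hyperplane; excluding them
    makes \<open>u\<close> and \<open>w\<close> linearly independent.\<close>
  have "u \<noteq> - w"
  proof
    assume "u = - w"
    then have "K \<subseteq> {y. w \<bullet> y = w \<bullet> x}" using xu xw by (force simp: inner_commute)
    then have "interior K \<subseteq> interior {y. w \<bullet> y = w \<bullet> x}" by (rule interior_mono)
    moreover have "w \<noteq> 0" using uw by auto
    ultimately show False using K(3) by simp
  qed
  then obtain i j where ij: "i \<in> Basis" "j \<in> Basis" and minor: "(u \<bullet> i) * (w \<bullet> j) - (u \<bullet> j) * (w \<bullet> i) \<noteq> 0"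
    using unit_vectors_minor[OF uw] by blast
  define D where "D = (u \<bullet> i) * (w \<bullet> j) - (u \<bullet> j) * (w \<bullet> i)"
  have "D \<noteq> 0" using minor by (simp add: D_def)
  have "i \<noteq> j" using minor by auto
  \<comment> \<open>Cramer's rule: with these coefficients x + \<alpha> u + \<beta> w has
    \<open>i\<close>-coordinate \<open>q\<close> and \<open>j\<close>-coordinate
    \<open>r\<close>.\<close>
  define \<alpha> where "\<alpha> = (\<lambda>(q, r). ((q - x \<bullet> i) * (w \<bullet> j) - (r - x \<bullet> j) * (w \<bullet> i)) / D)"
  define \<beta> where "\<beta> = (\<lambda>(q, r). ((u \<bullet> i) * (r - x \<bullet> j) - (u \<bullet> j) * (q - x \<bullet> i)) / D)"
  have "open {p. 0 < \<alpha> p \<and> 0 < \<beta> p}"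
    unfolding \<alpha>_def \<beta>_def case_prod_beta using \<open>D \<noteq> 0\<close>
    by (intro open_Collect_conj open_Collect_less continuous_intros) auto
  \<comment> \<open>At the point \<open>x + u + w\<close> both coefficients are 1, so the open set
    is nonempty.\<close>
  moreover have "((x + u + w) \<bullet> i, (x + u + w) \<bullet> j) \<in> {p. 0 < \<alpha> p \<and> 0 < \<beta> p}"
  proof -
    have "\<alpha> ((x + u + w) \<bullet> i, (x + u + w) \<bullet> j) = D / D" "\<beta> ((x + u + w) \<bullet> i, (x + u + w) \<bullet> j) = D / D"
      by (simp_all add: \<alpha>_def \<beta>_def D_def inner_add_left algebra_simps)
    then show ?thesis using \<open>D \<noteq> 0\<close> by simp
  qed
  ultimately obtain A B where AB: "open A" "open B" "(x + u + w) \<bullet> i \<in> A" "(x + u + w) \<bullet> j \<in> B"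
    "A \<times> B \<subseteq> {p. 0 < \<alpha> p \<and> 0 < \<beta> p}"
    by (rule open_prod_elim) auto
  obtain q r where qr: "q \<in> \<rat>" "q \<in> A" "r \<in> \<rat>" "r \<in> B"
    using rational_in_open[OF AB(1,3)] rational_in_open[OF AB(2,4)] by blast
  then have pos: "0 < \<alpha> (q, r)" "0 < \<beta> (q, r)" using AB(5) by auto
  define z where "z = x + \<alpha> (q, r) *\<^sub>R u + \<beta> (q, r) *\<^sub>R w"
  have "D * (z \<bullet> i) = D * q" "D * (z \<bullet> j) = D * r"
    using \<open>D \<noteq> 0\<close>
    by (simp_all add: z_def \<alpha>_def \<beta>_def inner_add_left field_simps) (simp_all add: D_def algebra_simps)
  then have z: "z \<bullet> i = q" "z \<bullet> j = r" using \<open>D \<noteq> 0\<close> by auto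
  have "dist z x \<le> dist z y" if "y \<in> K" for y
  proof -
    have "0 \<le> (z - x) \<bullet> (x - y)"
    proof -
      have "(z - x) \<bullet> (x - y) = \<alpha> (q, r) * (x \<bullet> u - y \<bullet> u) + \<beta> (q, r) * (x \<bullet> w - y \<bullet> w)"
        by (simp add: z_def inner_add_left inner_diff_right inner_commute[of u] inner_commute[of w] right_diff_distrib)
      also have "\<dots> \<ge> 0"
        using xu[OF that] xw[OF that] pos by (intro add_nonneg_nonneg mult_nonneg_nonneg) auto
      finally show ?thesis .
    qed
    moreover have "(z - y) \<bullet> (z - y) = (z - x) \<bullet> (z - x) + 2 * ((z - x) \<bullet> (x - y)) + (x - y) \<bullet> (x - y)"
      by (simp add: inner_diff_left inner_diff_right inner_commute)
    moreover have "0 \<le> (x - y) \<bullet> (x - y)" by simp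
    ultimately have "(z - x) \<bullet> (z - x) \<le> (z - y) \<bullet> (z - y)" by linarith
    then show ?thesis unfolding dist_norm norm_le .
  qed
  then have "x = closest_point K z"
    using K x by (intro closest_point_unique) (auto intro: compact_imp_closed)
  then show thesis using that[OF ij \<open>i \<noteq> j\<close> qr(1,3)] z by blast
qed

text \<open>Countably many 1-Lipschitz images of flats of codimension two cover \<open>S\<close>.
  All estimates concern outer contents, so they apply to any subset, measurable or not.\<close>

lemma hausdorff_measure_singular_points:
  fixes K :: "'a::euclidean_space set"
  assumes "convex_body K" "S \<subseteq> singular_points K"
  shows "hausdorff_measure (DIM('a) - 1) S = 0"
proof -
  have K: "convex K" "closed K" "K \<noteq> {}"
    using assms by (auto simp: convex_body_def intro: compact_imp_closed)
  let ?I = "{(i, j). i \<in> Basis \<and> j \<in> Basis \<and> i \<noteq> (j::'a)} \<times> (\<rat> \<times> \<rat> :: (real \<times> real) set)"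
  let ?E = "\<lambda>((i, j), (q, r)). closest_point K ` {z. z \<bullet> i = q \<and> z \<bullet> j = r}"
  have "countable {(i, j). i \<in> Basis \<and> j \<in> Basis \<and> i \<noteq> (j::'a)}"
    by (rule countable_subset[of _ "Basis \<times> Basis"]) (auto intro: countable_finite)
  then have cI: "countable ?I" by (intro countable_SIGMA) (auto intro: countable_rat)
  have sub: "S \<subseteq> (\<Union>k\<in>?I. ?E k)"
  proof
    fix x assume "x \<in> S"
    then obtain i j q r where "i \<in> Basis" "j \<in> Basis" "i \<noteq> j" "q \<in> \<rat>" "r \<in> \<rat>"
      "x \<in> closest_point K ` {z. z \<bullet> i = q \<and> z \<bullet> j = r}"
      using singular_points_subset[OF assms(1)] assms(2) by blast
    then show "x \<in> (\<Union>k\<in>?I. ?E k)" by (intro UN_I[of "((i, j), (q, r))"]) auto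
  qed
  have "hausdorff_content (DIM('a) - 1) \<delta> S = 0" if "\<delta> > 0" for \<delta>
  proof -
    have "hausdorff_content (DIM('a) - 1) \<delta> S \<le> hausdorff_content (DIM('a) - 1) \<delta> (\<Union>k\<in>?I. ?E k)"
      by (rule hausdorff_content_mono[OF sub])
    also have "\<dots> = 0"
    proof (rule hausdorff_content_countable_UN_null[OF cI])
      fix k assume "k \<in> ?I"
      then show "hausdorff_content (DIM('a) - 1) \<delta> (?E k) = 0"
        by (auto simp del: One_nat_def intro!: hausdorff_content_lipschitz_flat that closest_point_lipschitz[OF K])
    qed (use that in simp)
    finally show ?thesis by simp
  qed
  then show ?thesis unfolding hausdorff_measure_def by (auto intro!: SUP_eq_const)
qed

section \<open>Perturbing a body near a face of codimension two\<close>

lemma orthogonal_not_in_span: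
  fixes x :: "'a::real_inner"
  assumes "x \<noteq> 0" "\<And>y. y \<in> S \<Longrightarrow> y \<bullet> x = 0"
  shows "x \<notin> span S"
proof
  assume "x \<in> span S"
  moreover have "y \<bullet> x = 0" if "y \<in> span S" for y
    using that by (induction rule: span_induct_alt) (auto simp: inner_add_left assms(2))
  ultimately show False using assms(1) by fastforce
qed

text \<open>The edges at the vertex \<open>a\<close> of a maximal simplex in \<open>F\<close>,
  together with \<open>u\<close> and a vector \<open>v\<close> orthogonal to all of these, form a
  basis. The linear map \<open>T\<close> sends the standard basis to it, and a box with sides
  \<open>k\<close>, \<open>l\<close> and fixed sides \<open>t\<close> to the parallelepiped. The
  constant \<open>c\<close> collects the determinant and the fixed sides; what counts is that it
  does not depend on \<open>k\<close> and \<open>l\<close>.\<close>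

lemma parallelepiped_over_face:
  fixes F :: "(real ^ 'n) set" and u :: "real ^ 'n"
  assumes F: "convex F" "aff_dim F = int CARD('n) - 2" and n: "CARD('n) \<ge> 2"
    and u: "u \<noteq> 0" "\<And>y. y \<in> F \<Longrightarrow> y \<bullet> u = h"
  obtains v b c where "v \<noteq> 0" "v \<bullet> u = 0" "\<And>y. y \<in> F \<Longrightarrow> y \<bullet> v = b" "c > 0"
    "\<And>k l. \<lbrakk>k \<ge> 0; l \<ge> 0\<rbrakk> \<Longrightarrow> \<exists>P. compact P \<and> measure lebesgue P = c * k * l \<and>
       P \<subseteq> F + closed_segment 0 (k *\<^sub>R v) + closed_segment 0 (l *\<^sub>R u)"
proof -
  obtain C where C: "C \<subseteq> F" "\<not> affine_dependent C" "affine hull F = affine hull C"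
    using affine_basis_exists by blast
  have cardC: "int (card C) = int CARD('n) - 1"
    using aff_dim_unique[of C F] C F(2) by auto
  then have "C \<noteq> {}" using n by auto
  then obtain a where a: "a \<in> C" by blast
  define B where "B = (\<lambda>x. - a + x) ` (C - {a})"
  have finC: "finite C" by (rule aff_independent_finite[OF C(2)])
  have indB: "independent B"
    using affine_dependent_iff_dependent2[OF a] C(2) by (simp add: B_def)
  have finB: "finite B" using finC by (simp add: B_def)
  have cardB: "card B = CARD('n) - 2"
  proof -
    have "card B = card (C - {a})" unfolding B_def by (rule card_image) (auto simp: inj_on_def)
    then show ?thesis using cardC a finC by (simp add: card_Diff_singleton)
  qed
  have Bu: "y \<bullet> u = 0" if "y \<in> B" for y
    using that u(2)[OF subsetD[OF C(1)]] a by (auto simp: B_def inner_diff_left inner_add_left)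
  have u_span: "u \<notin> span B" by (rule orthogonal_not_in_span[OF u(1) Bu])
  have ind1: "independent (insert u B)"
    using indB u_span by (simp add: independent_insert)
  have card1: "card (insert u B) = CARD('n) - 1"
    using u_span finB cardB n span_base by (subst card_insert_disjoint) auto
  have "dim (insert u B) < DIM(real ^ 'n)"
    using dim_le_card'[of "insert u B"] finB card1 n by simp
  then obtain v where v: "v \<noteq> 0" "\<And>y. y \<in> span (insert u B) \<Longrightarrow> orthogonal v y"
    using orthogonal_to_subspace_exists[OF \<open>dim (insert u B) < DIM(real ^ 'n)\<close>] by metis
  have v_orth: "y \<bullet> v = 0" if "y \<in> insert u B" for y
    using v(2)[OF span_base[OF that]] by (simp add: orthogonal_def inner_commute)
  have v_span: "v \<notin> span (insert u B)" by (rule orthogonal_not_in_span[OF v(1) v_orth])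
  define S where "S = insert v (insert u B)"
  have indS: "independent S" using ind1 v_span by (simp add: S_def independent_insert)
  have cardS: "card S = CARD('n)"
    unfolding S_def using span_base[of v "insert u B"] v_span finB card1 n
    by (subst card_insert_disjoint) (auto simp del: insert_iff)
  have finS: "finite S" using finB by (simp add: S_def)
  obtain f where f: "bij_betw f (Basis :: (real ^ 'n) set) S"
    using finite_same_card_bij[of "Basis :: (real ^ 'n) set" S] finS cardS by auto
  define T where "T z = (\<Sum>e\<in>Basis. (z \<bullet> e) *\<^sub>R f e)" for z
  have linT: "linear T"
    unfolding T_def by (intro linearI) (simp_all add: inner_add_left scaleR_add_left sum.distrib scaleR_sum_right)
  have injT: "inj T"
  proof (subst linear_injective_0[OF linT], intro allI impI)
    fix z assume "T z = 0"
    define g where "g = the_inv_into Basis f"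
    have g: "g (f e) = e" if "e \<in> Basis" for e
      using that f by (auto simp: g_def bij_betw_def intro: the_inv_into_f_f)
    have "T z = (\<Sum>y\<in>S. (z \<bullet> g y) *\<^sub>R y)"
      unfolding T_def sum.reindex_bij_betw[OF f, symmetric] by (rule sum.cong) (auto simp: g)
    then have "(\<Sum>y\<in>S. (z \<bullet> g y) *\<^sub>R y) = 0" using \<open>T z = 0\<close> by simp
    then have zero: "z \<bullet> g y = 0" if "y \<in> S" for y
      using independentD[OF indS finS order_refl, of "\<lambda>y. z \<bullet> g y" y] that by simp
    have "z \<bullet> e = 0" if "e \<in> Basis" for e
      using zero[of "f e"] g[OF that] f that by (auto simp: bij_betw_def)
    then show "z = 0" using euclidean_all_zero_iff by blast
  qed
  obtain c where c: "c > 0" "\<And>A. compact A \<Longrightarrow> measure lebesgue (T ` A) = c * measure lebesgue A"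
    using measure_linear_image_compact[OF linT injT] by blast
  have uS: "u \<in> S" and vS: "v \<in> S" and uv: "u \<noteq> v"
    using v_span span_base[of u "insert u B"] by (auto simp: S_def)
  obtain eu ev where eu: "eu \<in> Basis" "f eu = u" and ev: "ev \<in> Basis" "f ev = v"
    using f uS vS by (metis bij_betw_imp_surj_on imageE)
  have "eu \<noteq> ev" using eu ev uv by auto
  let ?R = "Basis - {eu, ev}"
  have fR: "f e \<in> B" if "e \<in> ?R" for e
  proof -
    have "f e \<in> S" "f e \<noteq> u" "f e \<noteq> v"
      using that f eu ev by (auto simp: bij_betw_def inj_on_def)
    then show ?thesis by (auto simp: S_def)
  qed
  \<comment> \<open>At most \<open>CARD('n)\<close> coefficients, each at most \<open>t\<close>,
    have sum at most 1, so adding the edge vectors with these coefficients to \<open>a\<close> does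
    not leave the simplex.\<close>
  define t where "t = 1 / real CARD('n)"
  have "t > 0" by (simp add: t_def)
  define N where "N = card ?R"
  have "N \<le> card (Basis :: (real ^ 'n) set)" unfolding N_def by (intro card_mono) auto
  then have "real N * t \<le> 1" by (simp add: t_def field_simps)
  show thesis
  proof (rule that)
    show "v \<noteq> 0" by (rule v(1))
    show "v \<bullet> u = 0" using v_orth[of u] by (simp add: inner_commute)
    show "y \<bullet> v = a \<bullet> v" if "y \<in> F" for y
    proof -
      have "y \<in> affine hull C" using hull_inc[OF that, of affine] C(3) by simp
      moreover have "C \<subseteq> {z. v \<bullet> z = v \<bullet> a}"
      proof
        fix z assume "z \<in> C"
        show "z \<in> {z. v \<bullet> z = v \<bullet> a}"
        proof (cases "z = a")
          case False
          then have "- a + z \<in> B" using \<open>z \<in> C\<close> by (auto simp: B_def)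
          then show ?thesis using v_orth[of "- a + z"] by (simp add: inner_commute inner_diff_right)
        qed simp
      qed
      then have "affine hull C \<subseteq> {z. v \<bullet> z = v \<bullet> a}"
        by (intro hull_minimal affine_hyperplane)
      ultimately show ?thesis by (auto simp: inner_commute)
    qed
    show "c * t ^ N > 0" using c \<open>t > 0\<close> by simp
    fix k l :: real assume kl: "k \<ge> 0" "l \<ge> 0"
    define w where "w = (\<Sum>e\<in>Basis. (if e = ev then k else if e = eu then l else t) *\<^sub>R e)"
    have w: "w \<bullet> e = (if e = ev then k else if e = eu then l else t)" if "e \<in> Basis" for e
      unfolding w_def using that by (rule inner_sum_left_Basis)
    have split: "(\<Sum>e\<in>Basis. g e) = g ev + g eu + (\<Sum>e\<in>?R. g e)" for g :: "real ^ 'n \<Rightarrow> real ^ 'n"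
    proof -
      have "(Basis :: (real ^ 'n) set) = insert ev (insert eu ?R)" using eu ev by auto
      then have "(\<Sum>e\<in>Basis. g e) = (\<Sum>e\<in>insert ev (insert eu ?R). g e)" by simp
      also have "\<dots> = g ev + g eu + (\<Sum>e\<in>?R. g e)"
        using \<open>eu \<noteq> ev\<close> by (simp add: add.assoc)
      finally show ?thesis .
    qed
    have "measure lebesgue (cbox 0 w) = (\<Prod>e\<in>Basis. w \<bullet> e)"
      using kl \<open>t > 0\<close> content_cbox[of 0 w] by (simp add: w)
    also have "\<dots> = k * (l * t ^ N)"
    proof -
      have "(Basis :: (real ^ 'n) set) = insert ev (insert eu ?R)" using eu ev by auto
      then have "(\<Prod>e\<in>Basis. w \<bullet> e) = (\<Prod>e\<in>insert ev (insert eu ?R). w \<bullet> e)" by simp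
      also have "\<dots> = w \<bullet> ev * (w \<bullet> eu * (\<Prod>e\<in>?R. w \<bullet> e))"
        using \<open>eu \<noteq> ev\<close> by simp
      also have "(\<Prod>e\<in>?R. w \<bullet> e) = t ^ N" by (simp add: w N_def)
      finally show ?thesis using eu ev \<open>eu \<noteq> ev\<close> by (simp add: w)
    qed
    finally have meas: "measure lebesgue (T ` cbox 0 w) = c * t ^ N * k * l"
      using c(2)[OF compact_cbox] by simp
    have sub: "(+) a ` T ` cbox 0 w \<subseteq> F + closed_segment 0 (k *\<^sub>R v) + closed_segment 0 (l *\<^sub>R u)"
    proof clarify
      fix z assume z: "z \<in> cbox 0 w"
      then have z0: "0 \<le> z \<bullet> e" and z1: "z \<bullet> e \<le> w \<bullet> e" if "e \<in> Basis" for e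
        using that by (auto simp: mem_box)
      define y where "y = a + (\<Sum>e\<in>?R. (z \<bullet> e) *\<^sub>R f e)"
      have "y \<in> F"
      proof -
        let ?s = "\<Sum>e\<in>?R. z \<bullet> e"
        have "?s \<le> (\<Sum>e\<in>?R. t)" proof (rule sum_mono)
          fix e assume "e \<in> ?R"
          then show "z \<bullet> e \<le> t" using z1[of e] w[of e] by auto
        qed
        then have s1: "?s \<le> 1" using \<open>real N * t \<le> 1\<close> by (simp add: N_def)
        have "y = (1 - ?s) *\<^sub>R a + (\<Sum>e\<in>?R. (z \<bullet> e) *\<^sub>R (a + f e))"
          by (simp add: y_def scaleR_add_right sum.distrib scaleR_sum_left[symmetric] algebra_simps)
        \<comment> \<open>The vertex \<open>a\<close> needs an index of its own in this convex
          combination; \<open>eu\<close> is free for it, being absent from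
          \<open>?R\<close>.\<close>
        also have "\<dots> = (\<Sum>e\<in>insert eu ?R. (if e = eu then 1 - ?s else z \<bullet> e) *\<^sub>R (if e = eu then a else a + f e))"
          by (subst sum.insert) (auto intro!: sum.cong)
        also have "\<dots> \<in> F"
        proof (rule convex_sum[OF _ F(1)])
          show "(\<Sum>e\<in>insert eu ?R. if e = eu then 1 - ?s else z \<bullet> e) = 1"
          proof -
            have "(\<Sum>e\<in>?R. if e = eu then 1 - ?s else z \<bullet> e) = ?s" by (rule sum.cong) auto
            then show ?thesis by (subst sum.insert) auto
          qed
          fix e assume e: "e \<in> insert eu ?R"
          show "0 \<le> (if e = eu then 1 - ?s else z \<bullet> e)" using e s1 z0 by auto
          show "(if e = eu then a else a + f e) \<in> F"
          proof (cases "e = eu")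
            case False
            then have "f e \<in> B" using e fR by blast
            then show ?thesis using False C(1) by (auto simp: B_def)
          qed (use a C in auto)
        qed simp
        finally show ?thesis .
      qed
      moreover have "(z \<bullet> ev) *\<^sub>R v \<in> closed_segment 0 (k *\<^sub>R v)"
      proof (cases "k = 0")
        case False
        then show ?thesis
          using z0[OF ev(1)] z1[OF ev(1)] kl w[OF ev(1)]
          by (auto simp: in_segment intro!: exI[of _ "(z \<bullet> ev) / k"])
      qed (use z0[OF ev(1)] z1[OF ev(1)] w[OF ev(1)] in auto)
      moreover have "(z \<bullet> eu) *\<^sub>R u \<in> closed_segment 0 (l *\<^sub>R u)"
      proof (cases "l = 0")
        case False
        then show ?thesis
          using z0[OF eu(1)] z1[OF eu(1)] kl w[OF eu(1)] \<open>eu \<noteq> ev\<close>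
          by (auto simp: in_segment intro!: exI[of _ "(z \<bullet> eu) / l"])
      qed (use z0[OF eu(1)] z1[OF eu(1)] w[OF eu(1)] \<open>eu \<noteq> ev\<close> in auto)
      moreover have "a + T z = y + (z \<bullet> ev) *\<^sub>R v + (z \<bullet> eu) *\<^sub>R u"
        unfolding T_def split[of "\<lambda>e. (z \<bullet> e) *\<^sub>R f e"] y_def using eu ev by (simp add: algebra_simps)
      ultimately show "a + T z \<in> F + closed_segment 0 (k *\<^sub>R v) + closed_segment 0 (l *\<^sub>R u)"
        by (auto intro: set_plus_intro)
    qed
    have "compact ((+) a ` T ` cbox 0 w)"
      by (intro compact_translation compact_linear_image linT compact_cbox)
    then show "\<exists>P. compact P \<and> measure lebesgue P = c * t ^ N * k * l \<and>
        P \<subseteq> F + closed_segment 0 (k *\<^sub>R v) + closed_segment 0 (l *\<^sub>R u)"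
      using sub meas by (intro exI[of _ "(+) a ` T ` cbox 0 w"]) (simp add: measure_translation)
  qed
qed

text \<open>Along each line parallel to \<open>u\<close> the layer \<open>D - M\<close> is a half-open interval of length at
  most \<open>\<tau>\<close>, so its translates by multiples of \<open>\<tau> u\<close> are disjoint.\<close>

lemma layer_measure_le:
  fixes M D C :: "'a::euclidean_space set"
  assumes M: "compact M" "convex M" and D: "compact D" and C: "compact C" and "M \<subseteq> D"
    and sub: "D \<subseteq> M + closed_segment 0 (\<tau> *\<^sub>R u)"
    and inC: "\<And>z t. \<lbrakk>z \<in> D - M; 0 \<le> t; t \<le> 1\<rbrakk> \<Longrightarrow> z + t *\<^sub>R u \<in> C"
    and \<tau>: "0 < \<tau>" "\<tau> \<le> 1 / 2"
  shows "measure lebesgue D - measure lebesgue M \<le> 2 * \<tau> * measure lebesgue C"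
proof -
  \<comment> \<open>The number of translates that fit into the unit displacement allowed by
    \<open>inC\<close>. As \<open>1 / \<tau> \<ge> 2\<close>, rounding down loses at most half,
    whence the factor 2 in the bound.\<close>
  define J where "J = nat \<lfloor>1 / \<tau>\<rfloor>"
  have "1 / \<tau> \<ge> 2" using \<tau> by (simp add: field_simps)
  then have J: "real J \<le> 1 / \<tau>" "1 / \<tau> - 1 \<le> real J" unfolding J_def by linarith+
  have J2: "1 / (2 * \<tau>) \<le> real J" using J(2) \<open>1 / \<tau> \<ge> 2\<close> by (simp add: field_simps)
  define Z where "Z i = (+) ((real i * \<tau>) *\<^sub>R u) ` (D - M)" for i :: nat
  have mD: "D \<in> lmeasurable" "M \<in> lmeasurable" "C \<in> lmeasurable" using assms by (auto simp: lmeasurable_compact)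
  have mZ: "Z i \<in> lmeasurable" for i
    unfolding Z_def by (intro measurable_translation fmeasurable.Diff mD)
  have "Z i \<inter> Z j = {}" if "i < j" for i j
  proof (rule ccontr)
    assume "Z i \<inter> Z j \<noteq> {}"
    then obtain z1 z2 where z: "z1 \<in> D - M" "z2 \<in> D - M"
      and eq: "(real i * \<tau>) *\<^sub>R u + z1 = (real j * \<tau>) *\<^sub>R u + z2"
      by (auto simp: Z_def)
    obtain m1 t1 where m1: "m1 \<in> M" "0 \<le> t1" "t1 \<le> \<tau>" "z1 = m1 + t1 *\<^sub>R u"
    proof -
      obtain m s where "m \<in> M" "0 \<le> s" "s \<le> 1" "z1 = m + (s * \<tau>) *\<^sub>R u"
        using sub z(1) by (force simp: set_plus_def in_segment)
      then show thesis using that[of m "s * \<tau>"] \<tau> by (simp add: mult_left_le_one_le)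
    qed
    obtain m2 t2 where m2: "m2 \<in> M" "0 \<le> t2" "z2 = m2 + t2 *\<^sub>R u"
    proof -
      obtain m s where "m \<in> M" "0 \<le> s" "s \<le> 1" "z2 = m + (s * \<tau>) *\<^sub>R u"
        using sub z(2) by (force simp: set_plus_def in_segment)
      then show thesis using that[of m "s * \<tau>"] \<tau> by simp
    qed
    define r where "r = (real j - real i) * \<tau> - t1"
    have "1 \<le> real j - real i" using that by linarith
    then have "\<tau> \<le> (real j - real i) * \<tau>" using \<tau> by (simp add: mult_le_cancel_right1)
    then have "r \<ge> 0" using m1 by (simp add: r_def)
    have "m1 = z2 + r *\<^sub>R u"
      using eq m1(4) by (simp add: r_def algebra_simps)
    then have m12: "m1 = m2 + (t2 + r) *\<^sub>R u" using m2 by (simp add: algebra_simps)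
    \<comment> \<open>\<open>m1\<close> lies at or beyond \<open>z2\<close> on the ray from
      \<open>m2\<close> in the direction \<open>u\<close>, so convexity puts \<open>z2\<close> into
      \<open>M\<close>.\<close>
    have "z2 \<in> M"
    proof (cases "t2 + r = 0")
      case True
      then have "t2 = 0" using \<open>r \<ge> 0\<close> m2(2) by linarith
      then show ?thesis using m2 by simp
    next
      case False
      define d where "d = t2 + r"
      have "d \<noteq> 0" using False by (simp add: d_def)
      have "m1 = m2 + d *\<^sub>R u" using m12 by (simp add: d_def)
      then have "z2 = (1 - t2 / d) *\<^sub>R m2 + (t2 / d) *\<^sub>R m1"
        unfolding m2(3) using \<open>d \<noteq> 0\<close> by (simp add: algebra_simps)
      moreover have "t2 / d \<le> 1" "0 \<le> t2 / d" using m2 \<open>r \<ge> 0\<close> by (auto simp: d_def divide_le_eq_1)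
      ultimately show ?thesis
        using convexD[OF M(2) m2(1) m1(1), of "1 - t2 / d" "t2 / d"] by simp
    qed
    then show False using z by simp
  qed
  then have disj: "disjoint_family_on Z {..<J}"
    unfolding disjoint_family_on_def by (metis Int_commute nat_neq_iff)
  have "(\<Union>i<J. Z i) \<subseteq> C"
  proof clarify
    fix z i assume i: "i < J" and "z \<in> Z i"
    then obtain y where y: "y \<in> D - M" "z = (real i * \<tau>) *\<^sub>R u + y" by (auto simp: Z_def)
    have "real i * \<tau> \<le> real J * \<tau>" using i \<tau> by simp
    also have "\<dots> \<le> 1" using J(1) \<tau> by (simp add: field_simps)
    finally show "z \<in> C" using inC[OF y(1), of "real i * \<tau>"] y(2) \<tau> by (simp add: add.commute)
  qed
  then have "measure lebesgue (\<Union>i<J. Z i) \<le> measure lebesgue C"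
    using mZ mD by (intro measure_mono_fmeasurable sets.finite_UN) (auto intro: fmeasurableD)
  also have "measure lebesgue (\<Union>i<J. Z i) = (\<Sum>i<J. measure lebesgue (Z i))"
    using mZ by (intro measure_finite_Union disj) (auto intro: fmeasurableD simp: fmeasurableD2[OF mZ, unfolded infinity_ennreal_def] simp del: emeasure_completion)
  also have "\<dots> = real J * measure lebesgue (D - M)"
    by (simp add: Z_def measure_translation)
  finally have le: "real J * measure lebesgue (D - M) \<le> measure lebesgue C" .
  have "1 / (2 * \<tau>) * measure lebesgue (D - M) \<le> real J * measure lebesgue (D - M)"
    by (intro mult_right_mono J2) auto
  also note le
  finally have "measure lebesgue (D - M) \<le> 2 * \<tau> * measure lebesgue C"
    using \<tau> by (simp add: field_simps)
  moreover have "measure lebesgue (D - M) = measure lebesgue D - measure lebesgue M"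
    using mD \<open>M \<subseteq> D\<close> by (intro measurable_measure_Diff fmeasurableD)
  ultimately show ?thesis by simp
qed

text \<open>Counterexamples for \<open>s = 1 / (j + 1)\<close> have, along a subsequence, limits
  \<open>k0\<close> and \<open>w0\<close> without slack: \<open>w0\<close> is an outer normal both
  at \<open>x\<close> and at \<open>k0\<close>. Since \<open>x\<close> is regular,
  \<open>w0 = u\<close>, so \<open>k0\<close> lies on the face, although every \<open>k j\<close>
  keeps distance at least \<open>e\<close> from it.\<close>

lemma near_face:
  fixes K :: "'a::euclidean_space set"
  assumes K: "compact K" "x \<in> support_set K u" "x \<notin> singular_points K" "norm u = 1" and "e > 0"
  obtains s where "s > 0"
    "\<And>k w. \<lbrakk>k \<in> K; norm w = 1; \<And>y. y \<in> K \<Longrightarrow> y \<bullet> w \<le> x \<bullet> w + s; \<And>y. y \<in> K \<Longrightarrow> y \<bullet> w \<le> k \<bullet> w + s\<rbrakk>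
      \<Longrightarrow> k \<in> support_set K u + ball 0 e"
proof (rule ccontr)
  let ?F = "support_set K u"
  assume contra: "\<not> thesis"
  have "\<exists>k w. k \<in> K \<and> norm w = 1 \<and> (\<forall>y\<in>K. y \<bullet> w \<le> x \<bullet> w + 1 / real (Suc j)) \<and>
      (\<forall>y\<in>K. y \<bullet> w \<le> k \<bullet> w + 1 / real (Suc j)) \<and> k \<notin> ?F + ball 0 e" for j
  proof (rule ccontr)
    assume no: "\<not> ?thesis"
    have thesis
    proof (rule that[of "1 / real (Suc j)"])
      show "0 < 1 / real (Suc j)" by simp
      show "k \<in> ?F + ball 0 e"
        if "k \<in> K" "norm w = 1" "\<And>y. y \<in> K \<Longrightarrow> y \<bullet> w \<le> x \<bullet> w + 1 / real (Suc j)"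
          "\<And>y. y \<in> K \<Longrightarrow> y \<bullet> w \<le> k \<bullet> w + 1 / real (Suc j)" for k w
        using no that by blast
    qed
    then show False using contra by simp
  qed
  then obtain k w where kw: "\<And>j. k j \<in> K" "\<And>j. norm (w j) = 1"
    "\<And>j y. y \<in> K \<Longrightarrow> y \<bullet> w j \<le> x \<bullet> w j + 1 / real (Suc j)"
    "\<And>j y. y \<in> K \<Longrightarrow> y \<bullet> w j \<le> k j \<bullet> w j + 1 / real (Suc j)" "\<And>j. k j \<notin> ?F + ball 0 e"
    by metis
  have "seq_compact (K \<times> sphere (0::'a) 1)"
    by (intro compact_imp_seq_compact compact_Times K compact_sphere)
  moreover have "\<forall>j. (k j, w j) \<in> K \<times> sphere 0 1" using kw by simp
  ultimately obtain p r where p: "p \<in> K \<times> sphere 0 1" "strict_mono r" "((\<lambda>j. (k j, w j)) \<circ> r) \<longlonglongrightarrow> p"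
    by (elim seq_compactE)
  obtain k0 w0 where p_def: "p = (k0, w0)" by (cases p)
  have lim: "(\<lambda>j. k (r j)) \<longlonglongrightarrow> k0" "(\<lambda>j. w (r j)) \<longlonglongrightarrow> w0"
    using tendsto_fst[OF p(3)] tendsto_snd[OF p(3)] by (simp_all add: p_def o_def)
  have lim0: "(\<lambda>j. 1 / real (Suc (r j))) \<longlonglongrightarrow> 0"
    using LIMSEQ_subseq_LIMSEQ[OF LIMSEQ_inverse_real_of_nat p(2)] by (simp add: o_def inverse_eq_divide)
  have w0: "y \<bullet> w0 \<le> x \<bullet> w0" "y \<bullet> w0 \<le> k0 \<bullet> w0" if "y \<in> K" for y
  proof -
    have "y \<bullet> w0 \<le> x \<bullet> w0 + 0"
      by (rule LIMSEQ_le[OF tendsto_inner[OF tendsto_const lim(2)] tendsto_add[OF tendsto_inner[OF tendsto_const lim(2)] lim0]])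
        (use kw(3)[OF that] in auto)
    then show "y \<bullet> w0 \<le> x \<bullet> w0" by simp
    have "y \<bullet> w0 \<le> k0 \<bullet> w0 + 0"
      by (rule LIMSEQ_le[OF tendsto_inner[OF tendsto_const lim(2)] tendsto_add[OF tendsto_inner[OF lim] lim0]])
        (use kw(4)[OF that] in auto)
    then show "y \<bullet> w0 \<le> k0 \<bullet> w0" by simp
  qed
  have "x \<in> K" using K(2) by (simp add: support_set_def)
  then have "x \<in> support_set K w0" using w0 K(1) by (simp add: support_set_iff)
  then have "w0 = u"
    using K(2,3,4) p(1) unfolding singular_points_def p_def by auto
  then have "k0 \<in> ?F" using w0 p(1) K(1) by (simp add: support_set_iff p_def)
  have "eventually (\<lambda>j. dist (k (r j)) k0 < e) sequentially"
    using lim(1) \<open>e > 0\<close> by (simp add: tendsto_iff)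
  then obtain j where "dist (k (r j)) k0 < e" by (meson eventually_sequentially order_refl)
  then have "k0 + (k (r j) - k0) \<in> ?F + ball 0 e"
    using \<open>k0 \<in> ?F\<close> by (intro set_plus_intro) (auto simp: dist_norm norm_minus_commute)
  then show False using kw(5) by simp
qed

lemma compact_support_set: "compact K \<Longrightarrow> compact (support_set K u)"
proof -
  assume "compact K"
  moreover have "support_set K u = K \<inter> {y. u \<bullet> y = support_function K u}"
    by (auto simp: support_set_def inner_commute)
  ultimately show ?thesis by (simp add: compact_Int_closed closed_hyperplane)
qed

lemma convex_support_set: "convex K \<Longrightarrow> convex (support_set K u)"
proof -
  assume "convex K"
  moreover have "support_set K u = K \<inter> {y. u \<bullet> y = support_function K u}"
    by (auto simp: support_set_def inner_commute)
  ultimately show ?thesis by (simp add: convex_Int convex_hyperplane)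
qed

lemma pushed_hull:
  fixes K :: "'a::euclidean_space set" and u :: 'a
  assumes K: "compact_convex K" "x \<in> K" and "s > 0"
  defines "A \<equiv> convex hull (insert (x + s *\<^sub>R u) K)"
  shows "compact_convex A" "K \<subseteq> A" "A \<subseteq> K + closed_segment 0 (s *\<^sub>R u)"
proof -
  show "compact_convex A"
    using K unfolding A_def compact_convex_def by (auto intro!: compact_convex_hull)
  show "K \<subseteq> A" unfolding A_def using hull_subset[of "insert (x + s *\<^sub>R u) K" convex] by blast
  show "A \<subseteq> K + closed_segment 0 (s *\<^sub>R u)"
    unfolding A_def
  proof (rule hull_minimal)
    show "convex (K + closed_segment 0 (s *\<^sub>R u))"
      using K by (intro convex_set_plus) (auto simp: compact_convex_def)
    have "k + 0 \<in> K + closed_segment 0 (s *\<^sub>R u)" if "k \<in> K" for k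
      using that by (intro set_plus_intro) auto
    moreover have "x + s *\<^sub>R u \<in> K + closed_segment 0 (s *\<^sub>R u)"
      using K by (intro set_plus_intro) auto
    ultimately show "insert (x + s *\<^sub>R u) K \<subseteq> K + closed_segment 0 (s *\<^sub>R u)" by auto
  qed
qed

text \<open>Separate \<open>z\<close> from \<open>K + \<epsilon> K\<close> by a direction
  \<open>w\<close>. The apex \<open>x + s u\<close> must then overtake \<open>K\<close> in this
  direction, and it exceeds \<open>x\<close> by at most \<open>s\<close> there; so \<open>w\<close>
  is normal at \<open>x\<close> up to \<open>s\<close>. The point \<open>k\<close> misses the
  maximum by at most the gain from \<open>\<epsilon> a\<close>, which is at most
  \<open>\<epsilon> s\<close>. Both slacks are thus bounded independently of
  \<open>\<epsilon>\<close>.\<close>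

lemma layer_near_face:
  fixes K :: "'a::euclidean_space set"
  assumes K: "compact_convex K" and x: "x \<in> K" and u: "norm u = 1" and s: "s > 0" and \<epsilon>: "0 < \<epsilon>" "\<epsilon> \<le> 1"
    and z: "z \<in> K + (*\<^sub>R) \<epsilon> ` (convex hull (insert (x + s *\<^sub>R u) K))" "z \<notin> K + (*\<^sub>R) \<epsilon> ` K"
  obtains k a w where "z = k + \<epsilon> *\<^sub>R a" "k \<in> K" "a \<in> convex hull (insert (x + s *\<^sub>R u) K)" "norm w = 1"
    "\<And>y. y \<in> K \<Longrightarrow> y \<bullet> w \<le> x \<bullet> w + s" "\<And>y. y \<in> K \<Longrightarrow> y \<bullet> w \<le> k \<bullet> w + s"
proof -
  let ?A = "convex hull (insert (x + s *\<^sub>R u) K)" and ?M = "K + (*\<^sub>R) \<epsilon> ` K"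
  have K': "compact K" "convex K" "K \<noteq> {}" using K by (auto simp: compact_convex_def)
  obtain k a where ka: "k \<in> K" "a \<in> ?A" "z = k + \<epsilon> *\<^sub>R a" using z(1) by (auto elim!: set_plus_elim)
  obtain \<theta> k' where \<theta>: "0 \<le> \<theta>" "\<theta> \<le> 1" "k' \<in> K" "a = (1 - \<theta>) *\<^sub>R k' + \<theta> *\<^sub>R (x + s *\<^sub>R u)"
  proof -
    obtain l l' b where "0 \<le> l" "0 \<le> l'" "l + l' = 1" "b \<in> K" "a = l *\<^sub>R (x + s *\<^sub>R u) + l' *\<^sub>R b"
      using ka(2) unfolding convex_hull_insert[OF K'(3)] hull_same[of convex K, OF K'(2)] by blast
    moreover have "l' = 1 - l" using \<open>l + l' = 1\<close> by simp
    ultimately show thesis using that[of l b] by (simp add: add.commute)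
  qed
  have "compact_convex ?M" by (intro compact_convex_add compact_convex_scale K)
  then have "convex ?M" "closed ?M" by (auto simp: compact_convex_def intro: compact_imp_closed)
  then obtain c b where cb: "c \<bullet> z < b" "\<And>m. m \<in> ?M \<Longrightarrow> c \<bullet> m > b"
    using separating_hyperplane_closed_point[OF _ _ z(2)] by blast
  obtain m0 where "m0 \<in> ?M" using \<open>compact_convex ?M\<close> by (auto simp: compact_convex_def)
  then have "c \<noteq> 0" using cb(1) cb(2)[of m0] by auto
  \<comment> \<open>The functional \<open>c\<close> is smaller at \<open>z\<close> than on
    \<open>?M\<close>; the sign is reversed so that \<open>z\<close> sticks out in the direction
    \<open>w\<close>.\<close>
  define w where "w = (- 1 / norm c) *\<^sub>R c"
  have w1: "norm w = 1" using \<open>c \<noteq> 0\<close> by (simp add: w_def)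
  have sep: "y \<bullet> w + \<epsilon> * (y' \<bullet> w) < z \<bullet> w" if "y \<in> K" "y' \<in> K" for y y'
  proof -
    have "c \<bullet> z < c \<bullet> (y + \<epsilon> *\<^sub>R y')"
      using cb(1) cb(2)[of "y + \<epsilon> *\<^sub>R y'"] that by (meson imageI less_trans set_plus_intro)
    then have "(y + \<epsilon> *\<^sub>R y') \<bullet> w < z \<bullet> w"
      using \<open>c \<noteq> 0\<close> by (simp add: w_def inner_commute divide_strict_right_mono)
    then show ?thesis by (simp add: inner_add_left)
  qed
  obtain h where h: "h \<in> K" "\<And>y. y \<in> K \<Longrightarrow> y \<bullet> w \<le> h \<bullet> w"
    using continuous_attains_sup[OF K'(1,3) continuous_on_inner[OF continuous_on_id continuous_on_const], of w]
    by auto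
  have uw: "u \<bullet> w \<le> 1" using norm_cauchy_schwarz[of u w] u w1 by simp
  have zw: "z \<bullet> w \<le> k \<bullet> w + \<epsilon> * ((1 - \<theta>) * (h \<bullet> w) + \<theta> * (x \<bullet> w + s))"
  proof -
    have "(1 - \<theta>) * (k' \<bullet> w) \<le> (1 - \<theta>) * (h \<bullet> w)" using \<theta> h(2) by (intro mult_left_mono) auto
    moreover have "\<theta> * (x \<bullet> w + s * (u \<bullet> w)) \<le> \<theta> * (x \<bullet> w + s)"
      using \<theta>(1) uw s by (intro mult_left_mono) auto
    ultimately have "a \<bullet> w \<le> (1 - \<theta>) * (h \<bullet> w) + \<theta> * (x \<bullet> w + s)"
      unfolding \<theta>(4) by (simp add: inner_add_left)
    then have "\<epsilon> * (a \<bullet> w) \<le> \<epsilon> * ((1 - \<theta>) * (h \<bullet> w) + \<theta> * (x \<bullet> w + s))"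
      using \<epsilon> by (intro mult_left_mono) auto
    then show ?thesis unfolding ka(3) by (simp add: inner_add_left)
  qed
  \<comment> \<open>Strictness of the separation rules out \<open>\<theta> = 0\<close>, so
    \<open>\<theta>\<close> can be cancelled.\<close>
  have hx: "h \<bullet> w < x \<bullet> w + s"
  proof -
    have "\<epsilon> * (h \<bullet> w) < \<epsilon> * ((1 - \<theta>) * (h \<bullet> w) + \<theta> * (x \<bullet> w + s))"
      using sep[OF ka(1) h(1)] zw by linarith
    then have "h \<bullet> w < (1 - \<theta>) * (h \<bullet> w) + \<theta> * (x \<bullet> w + s)" using \<epsilon> by simp
    then have "\<theta> * (h \<bullet> w) < \<theta> * (x \<bullet> w + s)" by (simp add: algebra_simps)
    then show ?thesis using \<theta>(1) by (cases "\<theta> = 0") (auto simp: mult_less_cancel_left)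
  qed
  show thesis
  proof (rule that[OF ka(3,1,2) w1])
    show "y \<bullet> w \<le> x \<bullet> w + s" if "y \<in> K" for y using h(2)[OF that] hx by linarith
    show "y \<bullet> w \<le> k \<bullet> w + s" if y: "y \<in> K" for y
    proof -
      have "\<theta> * (x \<bullet> w + s) \<le> \<theta> * (h \<bullet> w) + s"
      proof -
        have "\<theta> * (x \<bullet> w) \<le> \<theta> * (h \<bullet> w)" using h(2)[OF x] \<theta> by (intro mult_left_mono)
        moreover have "\<theta> * s \<le> s" using \<theta> s by (simp add: mult_left_le_one_le)
        ultimately show ?thesis by (simp add: algebra_simps)
      qed
      then have "\<epsilon> * ((1 - \<theta>) * (h \<bullet> w) + \<theta> * (x \<bullet> w + s)) \<le> \<epsilon> * (h \<bullet> w + s)"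
        using \<epsilon> by (intro mult_left_mono) (auto simp: algebra_simps)
      moreover have "\<epsilon> * s \<le> s" using \<epsilon> s by (simp add: mult_left_le_one_le)
      ultimately show ?thesis using sep[OF y h(1)] zw by (simp add: algebra_simps)
    qed
  qed
qed

text \<open>\<open>K + \<epsilon> A\<close> exceeds \<open>K + \<epsilon> K\<close> by a layer of
  thickness at most \<open>\<epsilon> s\<close> along \<open>u\<close>. The layer and its translates
  by up to \<open>u\<close> stay in a thin neighbourhood of the face plus \<open>[0, u]\<close>,
  which is null, so the layer has volume at most \<open>\<epsilon> s \<mu>\<close>. The choices
  depend on each other in the order \<open>\<mu>\<close>, \<open>d\<close>, \<open>s\<close>,
  \<open>\<epsilon>\<close>.\<close>

lemma first_variation_upper_bound:
  fixes K :: "'a::euclidean_space set"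
  assumes V: "mixed_volume_functional V" and K: "compact_convex K" and u: "norm u = 1"
    and x: "x \<in> support_set K u" "x \<notin> singular_points K"
    and null: "negligible (support_set K u + closed_segment 0 u)" and "\<mu> > 0"
  obtains s where "s > 0"
    "real DIM('a) * (V (convex hull (insert (x + s *\<^sub>R u) K) # replicate (DIM('a) - 1) K) - measure lebesgue K) \<le> s * \<mu>"
proof -
  let ?F = "support_set K u"
  have K': "compact K" "convex K" "K \<noteq> {}" using K by (auto simp: compact_convex_def)
  have xK: "x \<in> K" using x by (simp add: support_set_def)
  have cF: "compact ?F" by (rule compact_support_set[OF K'(1)])
  then have cG: "compact (?F + closed_segment 0 u)" by (intro compact_set_plus compact_segment)
  obtain d where d: "d > 0" "\<And>C. \<lbrakk>compact C; C \<subseteq> (?F + closed_segment 0 u) + cball 0 d\<rbrakk>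
      \<Longrightarrow> measure lebesgue C < measure lebesgue (?F + closed_segment 0 u) + \<mu> / 2"
    using measure_compact_neighbourhood[OF cG, of "\<mu> / 2"] \<open>\<mu> > 0\<close> by auto
  define C where "C = (?F + closed_segment 0 u) + cball 0 d"
  have cC: "compact C" unfolding C_def by (intro compact_set_plus cG compact_cball)
  have mC: "measure lebesgue C \<le> \<mu> / 2"
    using d(2)[of C] cC null by (simp add: C_def negligible_imp_measure0)
  obtain s where s: "s > 0" "\<And>k w. \<lbrakk>k \<in> K; norm w = 1; \<And>y. y \<in> K \<Longrightarrow> y \<bullet> w \<le> x \<bullet> w + s;
      \<And>y. y \<in> K \<Longrightarrow> y \<bullet> w \<le> k \<bullet> w + s\<rbrakk> \<Longrightarrow> k \<in> ?F + ball 0 (d / 2)"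
    using near_face[OF K'(1) x u, of "d / 2"] d(1) by auto
  define A where "A = convex hull (insert (x + s *\<^sub>R u) K)"
  note A = pushed_hull[OF K xK \<open>s > 0\<close>, of u, folded A_def]
  obtain R where R: "R > 0" "\<And>a. a \<in> A \<Longrightarrow> norm a \<le> R"
    using A(1) unfolding compact_convex_def by (meson bounded_pos compact_imp_bounded)
  \<comment> \<open>The three entries give \<open>\<epsilon> \<le> 1\<close> for the separation
    argument, \<open>\<epsilon> * norm a \<le> d / 2\<close> to remain in \<open>C\<close>, and
    \<open>\<epsilon> * s \<le> 1 / 2\<close> for the layer estimate.\<close>
  define \<epsilon>0 where "\<epsilon>0 = Min {1, d / (2 * R), 1 / (2 * s)}"
  have \<epsilon>0: "\<epsilon>0 > 0" using d R s by (simp add: \<epsilon>0_def)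
  have bound: "(measure lebesgue (K + (*\<^sub>R) \<epsilon> ` A) - measure lebesgue (K + (*\<^sub>R) \<epsilon> ` K)) / \<epsilon> \<le> s * \<mu>"
    if \<epsilon>: "0 < \<epsilon>" "\<epsilon> < \<epsilon>0" for \<epsilon>
  proof -
    have \<epsilon>': "\<epsilon> \<le> 1" "\<epsilon> * R \<le> d / 2" "\<epsilon> * s \<le> 1 / 2"
      using \<epsilon> R s by (auto simp: \<epsilon>0_def field_simps)
    let ?D = "K + (*\<^sub>R) \<epsilon> ` A" and ?M = "K + (*\<^sub>R) \<epsilon> ` K"
    have "compact_convex ?D" "compact_convex ?M" by (intro compact_convex_add compact_convex_scale K A(1))+
    moreover have "?M \<subseteq> ?D" using A(2) by (intro set_plus_mono2) auto
    moreover have "?D \<subseteq> ?M + closed_segment 0 ((\<epsilon> * s) *\<^sub>R u)"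
    proof -
      have "(*\<^sub>R) \<epsilon> ` A \<subseteq> (*\<^sub>R) \<epsilon> ` K + closed_segment 0 ((\<epsilon> * s) *\<^sub>R u)"
      proof clarify
        fix a assume "a \<in> A"
        then obtain k t where "k \<in> K" "0 \<le> t" "t \<le> 1" "a = k + t *\<^sub>R s *\<^sub>R u"
          using A(3) by (force elim!: set_plus_elim simp: in_segment)
        then have "\<epsilon> *\<^sub>R a = \<epsilon> *\<^sub>R k + t *\<^sub>R (\<epsilon> * s) *\<^sub>R u" by (simp add: scaleR_add_right mult_ac)
        also have "\<dots> \<in> (*\<^sub>R) \<epsilon> ` K + closed_segment 0 ((\<epsilon> * s) *\<^sub>R u)"
          using \<open>k \<in> K\<close> \<open>0 \<le> t\<close> \<open>t \<le> 1\<close> by (intro set_plus_intro) (auto simp: in_segment)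
        finally show "\<epsilon> *\<^sub>R a \<in> (*\<^sub>R) \<epsilon> ` K + closed_segment 0 ((\<epsilon> * s) *\<^sub>R u)" .
      qed
      then have "?D \<subseteq> K + ((*\<^sub>R) \<epsilon> ` K + closed_segment 0 ((\<epsilon> * s) *\<^sub>R u))"
        by (intro set_plus_mono2) auto
      then show ?thesis by (simp add: add.assoc)
    qed
    moreover have "z + t *\<^sub>R u \<in> C" if z: "z \<in> ?D - ?M" and t: "0 \<le> t" "t \<le> 1" for z t
    proof -
      obtain k a w where ka: "z = k + \<epsilon> *\<^sub>R a" "k \<in> K" "a \<in> A" "norm w = 1"
        "\<And>y. y \<in> K \<Longrightarrow> y \<bullet> w \<le> x \<bullet> w + s" "\<And>y. y \<in> K \<Longrightarrow> y \<bullet> w \<le> k \<bullet> w + s"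
        using layer_near_face[OF K xK u \<open>s > 0\<close> \<epsilon>(1) \<epsilon>'(1), of z] z unfolding A_def by blast
      have "k \<in> ?F + ball 0 (d / 2)" by (rule s(2)[OF ka(2,4,5,6)])
      then obtain f b where fb: "f \<in> ?F" "norm b < d / 2" "k = f + b" by (auto elim!: set_plus_elim)
      have "\<epsilon> * norm a \<le> \<epsilon> * R" using R(2)[OF ka(3)] \<epsilon> by simp
      moreover have "norm (b + \<epsilon> *\<^sub>R a) \<le> norm b + \<epsilon> * norm a"
        using norm_triangle_ineq[of b "\<epsilon> *\<^sub>R a"] \<epsilon>(1) by simp
      ultimately have "norm (b + \<epsilon> *\<^sub>R a) \<le> d"
        using fb(2) \<epsilon>'(2) by linarith
      then have "(f + t *\<^sub>R u) + (b + \<epsilon> *\<^sub>R a) \<in> C"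
        unfolding C_def using fb(1) t by (intro set_plus_intro) (auto simp: in_segment)
      then show ?thesis by (simp add: ka(1) fb(3) algebra_simps)
    qed
    ultimately have "measure lebesgue ?D - measure lebesgue ?M \<le> 2 * (\<epsilon> * s) * measure lebesgue C"
      using \<epsilon> s(1) \<epsilon>'(3) by (intro layer_measure_le[OF _ _ _ cC]) (auto simp: compact_convex_def)
    also have "\<dots> \<le> 2 * (\<epsilon> * s) * (\<mu> / 2)"
      using \<epsilon> s(1) by (intro mult_left_mono mC) auto
    finally show ?thesis using \<epsilon>(1) by (simp add: divide_le_eq mult_ac)
  qed
  let ?n = "real DIM('a)" and ?L = "replicate (DIM('a) - 1) K"
  have "V (K # ?L) = measure lebesgue K"
    using mixed_volume_replicate[OF V K] by (metis DIM_positive Suc_pred' replicate_Suc)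
  have "((\<lambda>\<epsilon>. (measure lebesgue (K + (*\<^sub>R) \<epsilon> ` A) - measure lebesgue K) / \<epsilon> -
      (measure lebesgue (K + (*\<^sub>R) \<epsilon> ` K) - measure lebesgue K) / \<epsilon>) \<longlongrightarrow> ?n * V (A # ?L) - ?n * V (K # ?L)) (at_right 0)"
    by (intro tendsto_diff mixed_volume_first_variation[OF V] A(1) K)
  moreover have "eventually (\<lambda>\<epsilon>. \<epsilon> \<in> {0<..<\<epsilon>0}) (at_right 0)"
    by (rule eventually_at_right_real[OF \<epsilon>0])
  then have "eventually (\<lambda>\<epsilon>. (measure lebesgue (K + (*\<^sub>R) \<epsilon> ` A) - measure lebesgue K) / \<epsilon> -
      (measure lebesgue (K + (*\<^sub>R) \<epsilon> ` K) - measure lebesgue K) / \<epsilon> \<le> s * \<mu>) (at_right 0)"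
    by eventually_elim (use bound in \<open>simp add: diff_divide_distrib[symmetric]\<close>)
  ultimately have "?n * V (A # ?L) - ?n * V (K # ?L) \<le> s * \<mu>"
    by (rule tendsto_upperbound) simp
  then show thesis
    using that[OF \<open>s > 0\<close>] \<open>V (K # ?L) = _\<close> by (simp add: A_def right_diff_distrib)
qed

text \<open>V(I, M[n-1]) is, up to the factor n, the slope in k of the volume of M + k I, and its
  derivative at M = K towards A produces V(A, I, K[n-2]). With A in place of K as the summand scaled
  by \<epsilon>, the sum gains a parallelepiped of volume c k \<epsilon> s above the hyperplane that
  supports (K + \<epsilon> K) + k I in the direction u; c s is what remains after division by k and
  \<epsilon>.\<close>

lemma first_variation_segment_lower_bound:
  fixes K :: "'a::euclidean_space set"
  assumes V: "mixed_volume_functional V" and K: "compact_convex K" and dim: "DIM('a) \<ge> 2"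
    and u: "norm u = 1" and v: "v \<bullet> u = 0" and c: "c > 0"
    and P: "\<And>k l. \<lbrakk>k \<ge> 0; l \<ge> 0\<rbrakk> \<Longrightarrow> \<exists>P. compact P \<and> measure lebesgue P = c * k * l \<and>
       P \<subseteq> support_set K u + closed_segment 0 (k *\<^sub>R v) + closed_segment 0 (l *\<^sub>R u)"
    and x: "x \<in> support_set K u" and s: "s > 0"
  defines "A \<equiv> convex hull (insert (x + s *\<^sub>R u) K)" and "I \<equiv> closed_segment 0 v"
  shows "c * s \<le> real DIM('a) * real (DIM('a) - 1) *
    (V (A # I # replicate (DIM('a) - 2) K) - V (I # replicate (DIM('a) - 1) K))"
proof -
  let ?n = "DIM('a)"
  have K': "compact K" "convex K" "K \<noteq> {}" using K by (auto simp: compact_convex_def)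
  have xK: "x \<in> K" using x by (simp add: support_set_def)
  have face: "y \<bullet> u \<le> x \<bullet> u" if "y \<in> K" for y using x that K'(1) by (simp add: support_set_iff)
  have F: "y \<in> K \<and> y \<bullet> u = x \<bullet> u" if "y \<in> support_set K u" for y
    using that x by (simp add: support_set_def)
  note A = pushed_hull[OF K xK s, of u, folded A_def]
  have yA: "x + s *\<^sub>R u \<in> A" unfolding A_def by (simp add: hull_inc)
  have I: "compact_convex I" by (simp add: I_def compact_convex_def)
  have lower: "c * (\<epsilon> * s) \<le> real ?n * V (I # replicate (?n - 1) (K + (*\<^sub>R) \<epsilon> ` A)) -
      real ?n * V (I # replicate (?n - 1) (K + (*\<^sub>R) \<epsilon> ` K))" if \<epsilon>: "\<epsilon> > 0" for \<epsilon>
  proof -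
    let ?D = "K + (*\<^sub>R) \<epsilon> ` A" and ?M = "K + (*\<^sub>R) \<epsilon> ` K"
    have cD: "compact_convex ?D" "compact_convex ?M" by (intro compact_convex_add compact_convex_scale K A(1))+
    have "?M \<subseteq> ?D" using A(2) by (intro set_plus_mono2) auto
    have big: "measure lebesgue (?M + closed_segment 0 (real k *\<^sub>R v)) + c * real k * (\<epsilon> * s)
        \<le> measure lebesgue (?D + closed_segment 0 (real k *\<^sub>R v))" for k :: nat
    proof -
      let ?J = "closed_segment 0 (real k *\<^sub>R v)"
      obtain P where P: "compact P" "measure lebesgue P = c * real k * (\<epsilon> * s)"
        "P \<subseteq> support_set K u + ?J + closed_segment 0 ((\<epsilon> * s) *\<^sub>R u)"
        using assms(7)[of "real k" "\<epsilon> * s"] \<epsilon> s by auto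
      \<comment> \<open>\<open>P\<close> sits on the face of \<open>K\<close>; the shift by
        \<open>\<epsilon> x\<close> moves it onto the hyperplane supporting
        \<open>?M + ?J\<close>.\<close>
      define Q where "Q = (+) (\<epsilon> *\<^sub>R x) ` P"
      have Q: "compact Q" "measure lebesgue Q = c * real k * (\<epsilon> * s)"
        unfolding Q_def using P by (auto simp: measure_translation compact_translation)
      have cM: "compact (?M + ?J)" "compact (?D + ?J)"
        using cD by (auto intro!: compact_set_plus simp: compact_convex_def)
      have Jv: "j \<bullet> u = 0" if "j \<in> ?J" for j using that v by (auto simp: in_segment)
      have Qelem: "z \<in> ?D + ?J \<and> (1 + \<epsilon>) * (x \<bullet> u) \<le> z \<bullet> u" if zQ: "z \<in> Q" for z
      proof -
        obtain y j r where y: "y \<in> support_set K u" "j \<in> ?J" "0 \<le> r" "r \<le> 1"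
          "z = \<epsilon> *\<^sub>R x + (y + j + r *\<^sub>R (\<epsilon> * s) *\<^sub>R u)"
        proof -
          obtain p where p: "p \<in> P" "z = \<epsilon> *\<^sub>R x + p" using zQ by (auto simp: Q_def)
          from subsetD[OF P(3) p(1)] obtain q i
            where q: "p = q + i" "q \<in> support_set K u + ?J" "i \<in> closed_segment 0 ((\<epsilon> * s) *\<^sub>R u)"
            by (rule set_plus_elim)
          from q(2) obtain y j where y: "q = y + j" "y \<in> support_set K u" "j \<in> ?J" by (rule set_plus_elim)
          from q(3) obtain r where "0 \<le> r" "r \<le> 1" "i = r *\<^sub>R (\<epsilon> * s) *\<^sub>R u" by (auto simp: in_segment)
          with p q y show thesis by (intro that[of y j r]) auto
        qed
        \<comment> \<open>The height \<open>r * (\<epsilon> * s)\<close> is absorbed by the summand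
          \<open>\<epsilon> A\<close>, since \<open>A\<close> contains the segment from
          \<open>x\<close> to the apex.\<close>
        have "(1 - r) *\<^sub>R x + r *\<^sub>R (x + s *\<^sub>R u) \<in> A"
          using A(1) y xK A(2) yA by (intro convexD) (auto simp: compact_convex_def)
        then have "(y + \<epsilon> *\<^sub>R ((1 - r) *\<^sub>R x + r *\<^sub>R (x + s *\<^sub>R u))) + j \<in> ?D + ?J"
          using F[OF y(1)] y(2) by (intro set_plus_intro) auto
        moreover have "(y + \<epsilon> *\<^sub>R ((1 - r) *\<^sub>R x + r *\<^sub>R (x + s *\<^sub>R u))) + j = z"
          unfolding y(5) by (simp add: algebra_simps)
        moreover have "z \<bullet> u = (1 + \<epsilon>) * (x \<bullet> u) + r * (\<epsilon> * s)"
          unfolding y(5) using F[OF y(1)] Jv[OF y(2)] u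
          by (simp add: inner_add_left algebra_simps dot_square_norm)
        ultimately show ?thesis using y(3) \<epsilon> s by simp
      qed
      have Melem: "z \<bullet> u \<le> (1 + \<epsilon>) * (x \<bullet> u)" if zM: "z \<in> ?M + ?J" for z
      proof -
        obtain y y' j where y: "y \<in> K" "y' \<in> K" "j \<in> ?J" "z = y + \<epsilon> *\<^sub>R y' + j"
          using zM by (auto elim!: set_plus_elim)
        have "\<epsilon> * (y' \<bullet> u) \<le> \<epsilon> * (x \<bullet> u)" using face[OF y(2)] \<epsilon> by simp
        then show ?thesis
          unfolding y(4) using face[OF y(1)] Jv[OF y(3)] by (simp add: inner_add_left algebra_simps)
      qed
      have "negligible ((?M + ?J) \<inter> Q)"
      proof (rule negligible_subset)
        have "u \<noteq> 0" using u by auto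
        then show "negligible {z. u \<bullet> z = (1 + \<epsilon>) * (x \<bullet> u)}" by (intro negligible_hyperplane) simp
        show "(?M + ?J) \<inter> Q \<subseteq> {z. u \<bullet> z = (1 + \<epsilon>) * (x \<bullet> u)}"
          using Qelem Melem by (force simp: inner_commute[of u])
      qed
      then have "measure lebesgue ((?M + ?J) \<union> Q) = measure lebesgue (?M + ?J) + measure lebesgue Q"
        using cM(1) Q(1) by (simp add: measure_Un3 lmeasurable_compact negligible_imp_measure0)
      moreover have "measure lebesgue ((?M + ?J) \<union> Q) \<le> measure lebesgue (?D + ?J)"
      proof (rule measure_mono_fmeasurable)
        show "(?M + ?J) \<union> Q \<subseteq> ?D + ?J"
          using Qelem set_plus_mono2[OF \<open>?M \<subseteq> ?D\<close> order_refl, of ?J] by blast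
        show "(?M + ?J) \<union> Q \<in> sets lebesgue"
          using cM(1) Q(1) by (intro fmeasurableD lmeasurable_compact compact_Un)
      qed (use cM in \<open>simp add: lmeasurable_compact\<close>)
      ultimately show ?thesis using Q(2) by simp
    qed
    let ?m = "measure lebesgue ?D - measure lebesgue ?M"
    \<comment> \<open>The error \<open>?m\<close> compares the volumes before the segment is added.
      It does not depend on the length of the segment and disappears as the length grows.\<close>
    have "c * (\<epsilon> * s) - ?m / real (Suc j) \<le> real ?n * V (I # replicate (?n - 1) ?D) - real ?n * V (I # replicate (?n - 1) ?M)" for j
    proof -
      have "c * (\<epsilon> * s) - ?m / real (Suc j) = (c * real (Suc j) * (\<epsilon> * s) - ?m) / real (Suc j)"
        by (simp add: diff_divide_distrib)
      also have "\<dots> \<le> ((measure lebesgue (?D + closed_segment 0 (real (Suc j) *\<^sub>R v)) - measure lebesgue ?D) -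
          (measure lebesgue (?M + closed_segment 0 (real (Suc j) *\<^sub>R v)) - measure lebesgue ?M)) / real (Suc j)"
        using big[of "Suc j"] by (intro divide_right_mono) auto
      also have "\<dots> = real ?n * V (I # replicate (?n - 1) ?D) - real ?n * V (I # replicate (?n - 1) ?M)"
        unfolding I_def mixed_volume_segment[OF V cD(1) zero_less_Suc[of j]] mixed_volume_segment[OF V cD(2) zero_less_Suc[of j]]
        by (simp only: diff_divide_distrib)
      finally show ?thesis .
    qed
    moreover have "(\<lambda>j. c * (\<epsilon> * s) - ?m / real (Suc j)) \<longlonglongrightarrow> c * (\<epsilon> * s) - 0"
      using tendsto_mult_right_zero[OF LIMSEQ_inverse_real_of_nat, of ?m]
      by (intro tendsto_diff tendsto_const) (simp add: divide_inverse)
    ultimately show ?thesis using LIMSEQ_le_const2[of "\<lambda>j. c * (\<epsilon> * s) - ?m / real (Suc j)"] by simp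
  qed
  let ?d = "\<lambda>A \<epsilon>. (V (replicate (?n - 1) (K + (*\<^sub>R) \<epsilon> ` A) @ [I]) - V (replicate (?n - 1) K @ [I])) / \<epsilon>"
  have swap: "V (replicate (?n - 1) M @ [I]) = V (I # replicate (?n - 1) M)" if "compact_convex M" for M
    using that I dim by (intro mixed_volume_mset[OF V]) auto
  have swap': "V (B # replicate (?n - 1 - 1) K @ [I]) = V (B # I # replicate (?n - 2) K)" if "compact_convex B" for B
    using that I K dim by (intro mixed_volume_mset[OF V]) (auto simp: numeral_2_eq_2)
  have lim: "(?d B \<longlongrightarrow> real (?n - 1) * V (B # I # replicate (?n - 2) K)) (at_right 0)" if "compact_convex B" for B
    unfolding swap'[OF that, symmetric]
    using I K dim that by (intro mixed_volume_has_derivative[OF V]) auto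
  have "eventually (\<lambda>\<epsilon>. c * s / real ?n \<le> ?d A \<epsilon> - ?d K \<epsilon>) (at_right 0)"
    using eventually_at_right_less[of 0]
  proof eventually_elim
    fix \<epsilon> :: real assume "0 < \<epsilon>"
    have "c * s / real ?n = (c * (\<epsilon> * s)) / (real ?n * \<epsilon>)" using \<open>0 < \<epsilon>\<close> by simp
    also have "\<dots> \<le> (real ?n * V (I # replicate (?n - 1) (K + (*\<^sub>R) \<epsilon> ` A)) -
      real ?n * V (I # replicate (?n - 1) (K + (*\<^sub>R) \<epsilon> ` K))) / (real ?n * \<epsilon>)"
      using \<open>0 < \<epsilon>\<close> by (intro divide_right_mono lower) auto
    also have "\<dots> = ?d A \<epsilon> - ?d K \<epsilon>"
      unfolding swap[OF compact_convex_add[OF K compact_convex_scale[OF A(1)]]]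
        swap[OF compact_convex_add[OF K compact_convex_scale[OF K]]]
      using \<open>0 < \<epsilon>\<close> by (simp add: field_simps)
    finally show "c * s / real ?n \<le> ?d A \<epsilon> - ?d K \<epsilon>" .
  qed
  then have "c * s / real ?n \<le> real (?n - 1) * V (A # I # replicate (?n - 2) K) - real (?n - 1) * V (K # I # replicate (?n - 2) K)"
    by (intro tendsto_lowerbound[OF tendsto_diff[OF lim[OF A(1)] lim[OF K]]]) auto
  moreover have "V (K # I # replicate (?n - 2) K) = V (I # replicate (?n - 1) K)"
  proof (rule mixed_volume_mset[OF V])
    have "?n - 1 = Suc (?n - 2)" using dim by simp
    then show "mset (K # I # replicate (?n - 2) K) = mset (I # replicate (?n - 1) K)" by simp
  qed (use I K dim in auto)
  ultimately show ?thesis using dim by (simp add: field_simps)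
qed

section \<open>Positivity, monotonicity and the contradiction with the Bezout inequality\<close>

lemma mixed_volume_segment_pos:
  fixes K :: "'a::euclidean_space set"
  assumes V: "mixed_volume_functional V" and K: "compact_convex K" "measure lebesgue K > 0" and "v \<noteq> 0"
  shows "0 < V (closed_segment 0 v # replicate (DIM('a) - 1) K)"
proof -
  have cK: "compact K" using K by (simp add: compact_convex_def)
  then obtain R where R: "\<And>y. y \<in> K \<Longrightarrow> norm y \<le> R" by (meson bounded_iff compact_imp_bounded)
  \<comment> \<open>Long enough to push \<open>K\<close> off itself, so that its sum with the
    segment contains two disjoint copies of \<open>K\<close>.\<close>
  obtain k :: nat where k: "2 * \<bar>R\<bar> / norm v < real k" using reals_Archimedean2 by blast
  moreover have "0 \<le> 2 * \<bar>R\<bar> / norm v" by simp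
  ultimately have "real k > 0" by linarith
  have "2 * \<bar>R\<bar> < real k * norm v" using k \<open>v \<noteq> 0\<close> by (simp add: field_simps)
  let ?J = "closed_segment 0 (real k *\<^sub>R v)"
  let ?K' = "(+) (real k *\<^sub>R v) ` K"
  have disj: "K \<inter> ?K' = {}"
  proof (rule ccontr)
    assume "K \<inter> ?K' \<noteq> {}"
    then obtain y where y: "y \<in> K" "real k *\<^sub>R v + y \<in> K" by auto
    have "norm (real k *\<^sub>R v) \<le> norm (real k *\<^sub>R v + y) + norm y"
      using norm_triangle_ineq4[of "real k *\<^sub>R v + y" y] by simp
    then show False using R[OF y(1)] R[OF y(2)] \<open>2 * \<bar>R\<bar> < real k * norm v\<close> by simp
  qed
  have sub: "K \<union> ?K' \<subseteq> K + ?J"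
  proof -
    have "y + 0 \<in> K + ?J" "y + real k *\<^sub>R v \<in> K + ?J" if "y \<in> K" for y
      using that by (intro set_plus_intro; simp)+
    then show ?thesis by (auto simp: add.commute)
  qed
  have m: "K \<in> lmeasurable" "?K' \<in> lmeasurable" "K + ?J \<in> lmeasurable"
    using cK by (auto intro!: lmeasurable_compact compact_set_plus compact_translation)
  have "2 * measure lebesgue K = measure lebesgue (K \<union> ?K')"
    using m disj by (simp add: measure_Un3 measure_translation)
  also have "\<dots> \<le> measure lebesgue (K + ?J)"
    using m sub by (intro measure_mono_fmeasurable) (auto intro: fmeasurableD fmeasurable.Un)
  finally have "0 < (measure lebesgue (K + ?J) - measure lebesgue K) / real k"
    using K(2) \<open>real k > 0\<close> by simp
  then have "0 < real DIM('a) * V (closed_segment 0 v # replicate (DIM('a) - 1) K)"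
    using mixed_volume_segment[OF V K(1), of k v] \<open>real k > 0\<close> by simp
  then show ?thesis by (simp add: zero_less_mult_iff)
qed

text \<open>Compare first variations: \<open>K + \<epsilon> K\<close> is contained in
  \<open>K + \<epsilon> A\<close>, and the variation towards \<open>K\<close> itself gives the
  volume of \<open>K\<close>.\<close>

lemma mixed_volume_superset_ge:
  fixes K :: "'a::euclidean_space set"
  assumes V: "mixed_volume_functional V" and K: "compact_convex K" and A: "compact_convex A" "K \<subseteq> A"
  shows "measure lebesgue K \<le> V (A # replicate (DIM('a) - 1) K)"
proof -
  let ?n = "real DIM('a)" and ?L = "replicate (DIM('a) - 1) K"
  have VK: "V (K # ?L) = measure lebesgue K"
    using mixed_volume_replicate[OF V K] by (metis DIM_positive Suc_pred' replicate_Suc)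
  have "((\<lambda>\<epsilon>. (measure lebesgue (K + (*\<^sub>R) \<epsilon> ` A) - measure lebesgue K) / \<epsilon> -
      (measure lebesgue (K + (*\<^sub>R) \<epsilon> ` K) - measure lebesgue K) / \<epsilon>) \<longlongrightarrow> ?n * V (A # ?L) - ?n * V (K # ?L)) (at_right 0)"
    by (intro tendsto_diff mixed_volume_first_variation[OF V] A(1) K)
  moreover have "eventually (\<lambda>\<epsilon>. 0 \<le> (measure lebesgue (K + (*\<^sub>R) \<epsilon> ` A) - measure lebesgue K) / \<epsilon> -
      (measure lebesgue (K + (*\<^sub>R) \<epsilon> ` K) - measure lebesgue K) / \<epsilon>) (at_right 0)"
    using eventually_at_right_less[of 0]
  proof eventually_elim
    fix \<epsilon> :: real assume "0 < \<epsilon>"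
    have "compact (K + (*\<^sub>R) \<epsilon> ` K)" "compact (K + (*\<^sub>R) \<epsilon> ` A)"
      using compact_convex_add[OF K compact_convex_scale[OF K]] compact_convex_add[OF K compact_convex_scale[OF A(1)]]
      by (auto simp: compact_convex_def)
    then have "measure lebesgue (K + (*\<^sub>R) \<epsilon> ` K) \<le> measure lebesgue (K + (*\<^sub>R) \<epsilon> ` A)"
      using A(2) by (intro measure_mono_fmeasurable set_plus_mono2 fmeasurableD lmeasurable_compact) auto
    then show "0 \<le> (measure lebesgue (K + (*\<^sub>R) \<epsilon> ` A) - measure lebesgue K) / \<epsilon> -
        (measure lebesgue (K + (*\<^sub>R) \<epsilon> ` K) - measure lebesgue K) / \<epsilon>"
      using \<open>0 < \<epsilon>\<close> by (simp add: diff_divide_distrib[symmetric])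
  qed
  ultimately have "0 \<le> ?n * V (A # ?L) - ?n * V (K # ?L)"
    by (rule tendsto_lowerbound) simp
  then have "V (K # ?L) \<le> V (A # ?L)" by simp
  then show ?thesis unfolding VK .
qed

text \<open>Positivity of both factors is what permits clearing the denominator: with a zero
  denominator the quotient would be 0 and say nothing.\<close>

lemma bezout_if_b2_le_1:
  fixes K :: "'a::euclidean_space set"
  assumes "b2 K \<le> 1" "compact_convex A" "\<nexists>x. A = {x}" "compact_convex B" "\<nexists>x. B = {x}"
    and "0 < mixed_volume (A # replicate (DIM('a) - 1) K)" "0 < mixed_volume (B # replicate (DIM('a) - 1) K)"
  shows "mixed_volume (A # B # replicate (DIM('a) - 2) K) * measure lebesgue K \<le>
    mixed_volume (A # replicate (DIM('a) - 1) K) * mixed_volume (B # replicate (DIM('a) - 1) K)"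
proof -
  let ?q = "mixed_volume ([A, B] @ replicate (DIM('a) - 2) K) * measure lebesgue K /
    (mixed_volume (A # replicate (DIM('a) - 1) K) * mixed_volume (B # replicate (DIM('a) - 1) K))"
  have "ereal ?q \<le> b2 K"
    unfolding b2_def by (rule SUP_upper2[of "(A, B)"]) (use assms in auto)
  also note assms(1)
  finally have "?q \<le> 1" by (simp only: one_ereal_def ereal_less_eq)
  then show ?thesis using mult_pos_pos[OF assms(6,7)] by (simp add: pos_divide_le_eq)
qed

lemma codimension_2_face_singular:
  fixes K :: "(real ^ 'n) set"
  assumes n: "CARD('n) \<ge> 2" and K: "convex_body K" and b2: "b2 K \<le> 1"
    and u: "norm u = 1" and F: "aff_dim (support_set K u) = int CARD('n) - 2"
    and x: "x \<in> support_set K u"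
  shows "x \<in> singular_points K"
proof (rule ccontr)
  assume reg: "x \<notin> singular_points K"
  let ?F = "support_set K u" and ?V = "mixed_volume :: (real ^ 'n) set list \<Rightarrow> real"
  have dim: "DIM(real ^ 'n) = CARD('n)" by simp
  note V = mixed_volume_functional_mixed_volume[where 'n = 'n]
  have K': "compact K" "convex K" "interior K \<noteq> {}" using K by (auto simp: convex_body_def)
  have ccK: "compact_convex K" using K' by (auto simp: compact_convex_def)
  have xK: "x \<in> K" using x by (simp add: support_set_def)
  have u0: "u \<noteq> 0" using u by auto
  have Fu: "y \<bullet> u = support_function K u" if "y \<in> ?F" for y using that by (simp add: support_set_def)
  obtain v b c where v: "v \<noteq> 0" "v \<bullet> u = 0" and Fv: "\<And>y. y \<in> ?F \<Longrightarrow> y \<bullet> v = b" and c: "c > 0"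
    and P: "\<And>k l. \<lbrakk>k \<ge> 0; l \<ge> 0\<rbrakk> \<Longrightarrow> \<exists>P. compact P \<and> measure lebesgue P = c * k * l \<and>
       P \<subseteq> ?F + closed_segment 0 (k *\<^sub>R v) + closed_segment 0 (l *\<^sub>R u)"
    using parallelepiped_over_face[OF convex_support_set[OF K'(2)] F n u0 Fu] by blast
  \<comment> \<open>\<open>v\<close> is orthogonal both to the face and to \<open>u\<close>, so the
    sum lies in a hyperplane.\<close>
  have null: "negligible (?F + closed_segment 0 u)"
  proof (rule negligible_subset)
    show "negligible {z. v \<bullet> z = b}" using v by (intro negligible_hyperplane) simp
    show "?F + closed_segment 0 u \<subseteq> {z. v \<bullet> z = b}"
      using Fv v(2) by (auto elim!: set_plus_elim simp: in_segment inner_add_right inner_commute)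
  qed
  let ?n = "real CARD('n)" and ?I = "closed_segment 0 v"
  define W where "W = measure lebesgue K"
  define a where "a = ?V (?I # replicate (CARD('n) - 1) K)"
  have W: "W > 0"
  proof -
    obtain z r where z: "r > 0" "ball z r \<subseteq> K" using K'(3) by (meson ex_in_conv mem_interior)
    have "0 < measure lebesgue (ball z r)" using content_ball_pos[OF z(1), of z] by simp
    also have "\<dots> \<le> W"
      unfolding W_def using z K' by (intro measure_mono_fmeasurable) (auto simp: lmeasurable_compact)
    finally show ?thesis .
  qed
  have a: "a > 0"
    using mixed_volume_segment_pos[OF V ccK _ v(1)] W unfolding a_def W_def dim by simp
  \<comment> \<open>Chosen so that the upper estimate \<open>(?n - 1) * a * (s * \<mu>)\<close> is
    exactly half of the lower estimate \<open>c * s * W\<close>.\<close>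
  define \<mu> where "\<mu> = c * W / (2 * (?n - 1) * a)"
  have n1: "?n - 1 > 0" using n by linarith
  have \<mu>: "\<mu> > 0" using c W n1 a by (simp add: \<mu>_def)
  obtain s where s: "s > 0"
    "?n * (?V (convex hull (insert (x + s *\<^sub>R u) K) # replicate (CARD('n) - 1) K) - W) \<le> s * \<mu>"
    using first_variation_upper_bound[OF V ccK u x reg null \<mu>] unfolding dim W_def by blast
  define A where "A = convex hull (insert (x + s *\<^sub>R u) K)"
  note A = pushed_hull[OF ccK xK s(1), of u, folded A_def]
  define p where "p = ?V (A # replicate (CARD('n) - 1) K)"
  define q where "q = ?V (A # ?I # replicate (CARD('n) - 2) K)"
  have up: "?n * (p - W) \<le> s * \<mu>" using s(2) by (simp add: A_def p_def)
  have low: "c * s \<le> ?n * (?n - 1) * (q - a)"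
    using first_variation_segment_lower_bound[OF V ccK _ u v(2) c P x s(1)] n
    unfolding dim A_def[symmetric] q_def[symmetric] a_def[symmetric] by (simp add: of_nat_diff)
  have p: "W \<le> p"
    using mixed_volume_superset_ge[OF V ccK A(1,2)] unfolding dim p_def W_def .
  have nsA: "\<nexists>y. A = {y}"
  proof
    assume "\<exists>y. A = {y}"
    then have "interior A = {}" by auto
    then show False using K'(3) interior_mono[OF A(2)] by blast
  qed
  have nsI: "\<nexists>y. ?I = {y}"
  proof
    assume "\<exists>y. ?I = {y}"
    then obtain y where "?I = {y}" by blast
    then have "0 \<in> {y}" "v \<in> {y}" using ends_in_segment[of 0 v] by auto
    then show False using v(1) by simp
  qed
  have ccI: "compact_convex ?I" by (simp add: compact_convex_def)
  have "q * W \<le> p * a"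
    using bezout_if_b2_le_1[OF b2 A(1) nsA ccI nsI] W p a
    unfolding dim q_def[symmetric] p_def[symmetric] a_def[symmetric] W_def[symmetric] by linarith
  \<comment> \<open>For \<open>A = K\<close> both sides of the inequality would be
    \<open>a * W\<close>; subtracting this leaves the increments.\<close>
  then have "(q - a) * W \<le> (p - W) * a" by (simp add: algebra_simps)
  then have "?n * (?n - 1) * ((q - a) * W) \<le> ?n * (?n - 1) * ((p - W) * a)"
    using n1 by (intro mult_left_mono) auto
  also have "\<dots> = (?n - 1) * a * (?n * (p - W))" by (simp only: mult_ac)
  also have "\<dots> \<le> (?n - 1) * a * (s * \<mu>)" using n1 a by (intro mult_left_mono up) auto
  also have "\<dots> = c * s * W / 2"
  proof -
    have "m * a * (s * (c * W / (2 * m * a))) = c * s * W / 2" if "m > 0" for m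
      using that a by (simp add: field_simps)
    from this[OF n1] show ?thesis by (simp only: \<mu>_def)
  qed
  finally have "(?n * (?n - 1) * (q - a)) * W \<le> c * s * W / 2" by (simp only: mult.assoc)
  moreover have "c * s * W \<le> (?n * (?n - 1) * (q - a)) * W" using W by (intro mult_right_mono low) auto
  moreover have "0 < c * s * W" using c s(1) W by simp
  ultimately show False by linarith
qed

theorem theorem1:
  fixes K :: "(real ^ 'n) set"
  assumes "CARD('n) \<ge> 2"
    and "convex_body K"
    and "0 \<in> interior K"
    and "b2 K = 1"
  shows "surface_area_measure K
           {u \<in> sphere 0 1. aff_dim (support_set K u) = int CARD('n) - 2} = 0"
  unfolding surface_area_measure_def
  by (rule hausdorff_measure_singular_points[OF assms(2)])
    (use codimension_2_face_singular[OF assms(1,2)] assms(4) in auto)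

end
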